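(* For every $\mathbb{K}\in\{\mathbb{R},\mathbb{C},\mathbb{H}\}$, as $n\to\infty$, $$\log|\mathrm{per}_{\mathbb{K}}G_n^{\mathbb{K}}|=\frac12\log(n!)+O_{\mathbb{P}}(\log n)=\frac n2\log n-\frac n2+O_{\mathbb{P}}(\log n).$$
   Context: $\mathbb{H}$ denotes the quaternions, $\beta=\dim_{\mathbb{R}}\mathbb{K}$. For $A=(a_{ij})\in\mathbb{K}^{n\times n}$ the row-ordered permanent is $\mathrm{per}_{\mathbb{K}}A=\sum_{\sigma\in S_n}a_{1,\sigma(1)}a_{2,\sigma(2)}\cdots a_{n,\sigma(n)}$. A standard $\mathbb{K}$-Gaussian has independent $N(0,1/\beta)$ real coordinates, and $G_n^{\mathbb{K}}$ is an $n\times n$ matrix with i.i.d. standard $\mathbb{K}$-Gaussian entries. $Y_n=O_{\mathbb{P}}(\log n)$ means that $Y_n/\log n$ is bounded in probability: for every $\eta>0$ there are $M<\infty$ and $n_0$ with $\mathbb{P}(|Y_n|>M\log n)\le\eta$ for all $n\ge n_0$. *)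

theory Defs
  imports "HOL-Probability.Probability" "HOL-Combinatorics.Permutations"
begin

section \<open>Quaternions\<close>

text \<open>
  The Hamilton quaternions \<open>a + b i + c j + d k\<close> as a real normed division algebra and a
  four-dimensional Euclidean space with orthonormal basis \<open>1, i, j, k\<close>.
\<close>

codatatype quat = Quat (qre: real) (qim1: real) (qim2: real) (qim3: real)

lemma quat_eqI [intro?]:
  "\<lbrakk>qre x = qre y; qim1 x = qim1 y; qim2 x = qim2 y; qim3 x = qim3 y\<rbrakk> \<Longrightarrow> x = y"
  by (rule quat.expand) simp

lemma quat_eq_iff:
  "x = y \<longleftrightarrow> qre x = qre y \<and> qim1 x = qim1 y \<and> qim2 x = qim2 y \<and> qim3 x = qim3 y"
  by (auto intro: quat_eqI)

instantiation quat :: ab_group_add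
begin

primcorec zero_quat where
  "qre 0 = 0" | "qim1 0 = 0" | "qim2 0 = 0" | "qim3 0 = 0"

primcorec plus_quat where
  "qre (x + y) = qre x + qre y"
| "qim1 (x + y) = qim1 x + qim1 y"
| "qim2 (x + y) = qim2 x + qim2 y"
| "qim3 (x + y) = qim3 x + qim3 y"

primcorec uminus_quat where
  "qre (- x) = - qre x"
| "qim1 (- x) = - qim1 x"
| "qim2 (- x) = - qim2 x"
| "qim3 (- x) = - qim3 x"

primcorec minus_quat where
  "qre (x - y) = qre x - qre y"
| "qim1 (x - y) = qim1 x - qim1 y"
| "qim2 (x - y) = qim2 x - qim2 y"
| "qim3 (x - y) = qim3 x - qim3 y"

instance
  by standard (simp_all add: quat_eq_iff)

end

instantiation quat :: ring_1
begin

primcorec one_quat where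
  "qre 1 = 1" | "qim1 1 = 0" | "qim2 1 = 0" | "qim3 1 = 0"

primcorec times_quat where
  "qre (x * y) = qre x * qre y - qim1 x * qim1 y - qim2 x * qim2 y - qim3 x * qim3 y"
| "qim1 (x * y) = qre x * qim1 y + qim1 x * qre y + qim2 x * qim3 y - qim3 x * qim2 y"
| "qim2 (x * y) = qre x * qim2 y - qim1 x * qim3 y + qim2 x * qre y + qim3 x * qim1 y"
| "qim3 (x * y) = qre x * qim3 y + qim1 x * qim2 y - qim2 x * qim1 y + qim3 x * qre y"

instance
  by standard (simp_all add: quat_eq_iff algebra_simps)

end

instantiation quat :: real_algebra_1
begin

primcorec scaleR_quat where
  "qre (scaleR r x) = r * qre x"
| "qim1 (scaleR r x) = r * qim1 x"
| "qim2 (scaleR r x) = r * qim2 x"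
| "qim3 (scaleR r x) = r * qim3 x"

instance
  by standard (simp_all add: quat_eq_iff algebra_simps)

end

instantiation quat :: real_inner
begin

definition inner_quat :: "quat \<Rightarrow> quat \<Rightarrow> real" where
  "inner_quat x y = qre x * qre y + qim1 x * qim1 y + qim2 x * qim2 y + qim3 x * qim3 y"

definition norm_quat :: "quat \<Rightarrow> real" where
  "norm_quat x = sqrt ((qre x)\<^sup>2 + (qim1 x)\<^sup>2 + (qim2 x)\<^sup>2 + (qim3 x)\<^sup>2)"

definition sgn_quat :: "quat \<Rightarrow> quat" where
  "sgn_quat x = x /\<^sub>R norm x"

definition dist_quat :: "quat \<Rightarrow> quat \<Rightarrow> real" where
  "dist_quat x y = norm (x - y)"

definition uniformity_quat :: "(quat \<times> quat) filter" where
  "uniformity_quat = (INF e\<in>{0<..}. principal {(x, y). dist x y < e})"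

definition open_quat :: "quat set \<Rightarrow> bool" where
  "open_quat U \<longleftrightarrow> (\<forall>x\<in>U. \<forall>\<^sub>F (x', y) in uniformity. x' = x \<longrightarrow> y \<in> U)"

instance
proof
  fix x y z :: quat and r :: real and U :: "quat set"
  show "inner x x = 0 \<longleftrightarrow> x = 0"
  proof
    assume "inner x x = 0"
    hence "(qre x)\<^sup>2 + (qim1 x)\<^sup>2 + (qim2 x)\<^sup>2 + (qim3 x)\<^sup>2 = 0"
      by (simp add: inner_quat_def power2_eq_square)
    hence "(qre x)\<^sup>2 = 0" "(qim1 x)\<^sup>2 = 0" "(qim2 x)\<^sup>2 = 0" "(qim3 x)\<^sup>2 = 0"
      using zero_le_power2[of "qre x"] zero_le_power2[of "qim1 x"]
        zero_le_power2[of "qim2 x"] zero_le_power2[of "qim3 x"] by linarith+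
    thus "x = 0" by (simp add: quat_eq_iff)
  qed (simp add: inner_quat_def)
qed (simp_all add: inner_quat_def norm_quat_def sgn_quat_def dist_quat_def uniformity_quat_def
       open_quat_def algebra_simps power2_eq_square)

end

instantiation quat :: euclidean_space
begin

definition Basis_quat :: "quat set" where
  "Basis_quat = {Quat 1 0 0 0, Quat 0 1 0 0, Quat 0 0 1 0, Quat 0 0 0 1}"

instance
proof
  show "inner u v = (if u = v then 1 else 0)" if "u \<in> Basis" "v \<in> Basis" for u v :: quat
    using that unfolding Basis_quat_def by (elim insertE emptyE) (simp_all add: inner_quat_def)
  show "(\<forall>u\<in>Basis. inner x u = 0) \<longleftrightarrow> x = 0" for x :: quat
    by (simp add: Basis_quat_def inner_quat_def quat_eq_iff[of x])
qed (simp_all add: Basis_quat_def)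

end

lemma DIM_quat [simp]: "DIM(quat) = 4"
  by (simp add: Basis_quat_def)

instantiation quat :: real_normed_div_algebra
begin

definition inverse_quat :: "quat \<Rightarrow> quat" where
  "inverse_quat x = Quat (qre x) (- qim1 x) (- qim2 x) (- qim3 x) /\<^sub>R (norm x)\<^sup>2"

definition divide_quat :: "quat \<Rightarrow> quat \<Rightarrow> quat" where
  "divide_quat x y = x * inverse y"

instance
proof
  fix x y :: quat
  define k N where "k = Quat (qre x) (- qim1 x) (- qim2 x) (- qim3 x)" and "N = (norm x)\<^sup>2"
  have N: "N = (qre x)\<^sup>2 + (qim1 x)\<^sup>2 + (qim2 x)\<^sup>2 + (qim3 x)\<^sup>2"
    by (simp add: N_def norm_quat_def)
  have inv: "inverse x = k /\<^sub>R N"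
    by (simp add: inverse_quat_def k_def N_def)
  have kx: "k * x = N *\<^sub>R 1" "x * k = N *\<^sub>R 1"
    unfolding N by (simp_all add: quat_eq_iff k_def power2_eq_square)
  show "inverse x * x = 1" "x * inverse x = 1" if "x \<noteq> 0"
    using that by (simp_all add: inv kx N_def)
  show "x div y = x * inverse y" by (simp add: divide_quat_def)
  show "inverse (0::quat) = 0" by (simp add: inverse_quat_def quat_eq_iff)
  show "norm (x * y) = norm x * norm y"
    unfolding norm_quat_def real_sqrt_mult[symmetric]
    by (rule arg_cong[where f = sqrt]) (simp add: power2_eq_square algebra_simps)
qed

end


section \<open>Permanents, Gaussian matrices, boundedness in probability\<close>

text \<open>
  Matrix entries are indexed by \<open>{..<n} \<times> {..<n}\<close>. The list product multiplies the factors in the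
  order of the rows, which matters over the quaternions.
\<close>

definition permanent :: "nat \<Rightarrow> (nat \<Rightarrow> nat \<Rightarrow> 'k::ring_1) \<Rightarrow> 'k" where
  "permanent n A = (\<Sum>\<sigma> | \<sigma> permutes {..<n}. \<Prod>i\<leftarrow>[0..<n]. A i (\<sigma> i))"

text \<open>
  The real coordinates of \<open>x\<close> are \<open>x \<bullet> b\<close> for \<open>b \<in> Basis\<close>; \<open>DIM('k)\<close> is 1, 2, 4 for
  \<open>real\<close>, \<open>complex\<close>, \<open>quat\<close>. The second argument of \<open>normal_density\<close> is the standard deviation.
\<close>

definition standard_gaussian :: "'a measure \<Rightarrow> ('a \<Rightarrow> 'k::euclidean_space) \<Rightarrow> bool" where
  "standard_gaussian M X \<longleftrightarrow>
     prob_space M \<and> X \<in> borel_measurable M \<and>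
     prob_space.indep_vars M (\<lambda>_. borel) (\<lambda>b \<omega>. X \<omega> \<bullet> b) Basis \<and>
     (\<forall>b\<in>Basis. distributed M lborel (\<lambda>\<omega>. X \<omega> \<bullet> b)
        (\<lambda>x. ennreal (normal_density 0 (sqrt (1 / real DIM('k))) x)))"

definition gaussian_matrix ::
  "'a measure \<Rightarrow> nat \<Rightarrow> ('a \<Rightarrow> nat \<Rightarrow> nat \<Rightarrow> 'k::euclidean_space) \<Rightarrow> bool" where
  "gaussian_matrix M n G \<longleftrightarrow>
     prob_space M \<and>
     prob_space.indep_vars M (\<lambda>_. borel) (\<lambda>(i, j) \<omega>. G \<omega> i j) ({..<n} \<times> {..<n}) \<and>
     (\<forall>i<n. \<forall>j<n. standard_gaussian M (\<lambda>\<omega>. G \<omega> i j))"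

text \<open>\<open>Y\<^sub>n = O\<^sub>P(r\<^sub>n)\<close>, where \<open>Y\<^sub>n\<close> is a random variable on the \<open>n\<close>-th probability space.\<close>

definition bigO_prob ::
  "(nat \<Rightarrow> 'a measure) \<Rightarrow> (nat \<Rightarrow> 'a \<Rightarrow> real) \<Rightarrow> (nat \<Rightarrow> real) \<Rightarrow> bool" where
  "bigO_prob M Y r \<longleftrightarrow>
     (\<forall>n. Y n \<in> borel_measurable (M n)) \<and>
     (\<forall>\<eta>>0. \<exists>C::real. \<exists>n0. \<forall>n\<ge>n0.
        measure (M n) {\<omega> \<in> space (M n). \<bar>Y n \<omega>\<bar> > C * r n} \<le> \<eta>)"

text \<open>
  \<open>ln 0 = 0\<close> here, whereas \<open>log |0| = -\<infinity>\<close> in the mathematics. In deviations of the form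
  \<open>ln (norm (permanent n A)) - a\<^sub>n\<close> with \<open>a\<^sub>n / ln n \<rightarrow> \<infinity>\<close> this makes no difference to \<open>O\<^sub>P(ln n)\<close>:
  for every \<open>C\<close> and all large \<open>n\<close>, the event \<open>permanent n A = 0\<close> lies in
  the exceptional event \<open>\<bar>ln (norm (permanent n A)) - a\<^sub>n\<bar> > C * ln n\<close> under either convention.
\<close>

end

(*
  The rows of G are revealed from top to bottom. For tau in K write phi_n(tau) = E cis(<tau, per G_n>).
  Freeze the last row to g. For two columns p, q with the others fixed, <tau, per> is a symmetric
  real bilinear form in the two columns, so rotating the pair of Gaussian columns by 45 degrees
  splits the conditional expectation as psi(s) * cnj (psi(t)) with s, t = (g_p +- g_q) / sqrt 2, and
  the products psi(s) psi(t) are invariant under rotations of (s, t). Rotating so that |s| = |t| and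
  using AM-GM, the pair (g_p, g_q) may be replaced by pairs (u, 0) with |u|^2 = |g_p|^2 + |g_q|^2.
  Iterating, the row collapses to a single entry of modulus |g|, so that
  |phi_n(tau)| <= E Psi(|tau| |g|) whenever |phi_(n-1)(sigma)| <= Psi(|sigma|): the permanent is at
  least as anticoncentrated as the determinant. The recursion gives
  |phi_n(tau)| <= DIM(K)^2 / ((n - 2)! |tau|^2), hence a polynomial small ball bound at scale
  sqrt(n!). The upper tail is Markov's inequality for E |per G_n|^2 = n!.
*)
theory Submission
  imports Defs
begin

section \<open>Rotation invariance of Gaussian product measures\<close>

text \<open>The form in the two columns is symmetric because exchanging columns does not change a
  permanent; only column labels move, so the order of the row factors is untouched. All rotations
  have real coefficients and hence commute with quaternion entries, and one argument serves all
  three cases. The norm-equalising rotation depends on g_p and g_q alone, so the same replacement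
  works for every value of the remaining columns. After AM-GM each term is a squared modulus, real
  and nonnegative; averaging it over the remaining columns gives again a characteristic function, so
  a bound on conditional expectations becomes one on the full expectation. The recursion averages
  1/|g|^2, which is infinite for two real columns. Hence size 2 is treated separately and the
  factorial is (n-2)!; the ratio to n! is polynomial, invisible at scale log n. Decay like |tau|^-2
  is not integrable at infinity in dimensions 2 and 4, so it gives no density bound by Fourier
  inversion. The characteristic function is averaged against a Gaussian instead.\<close>

lemma distr_PiM_zip:
  fixes M :: "'i \<Rightarrow> 'a measure" and N :: "'i \<Rightarrow> 'b measure"
  assumes "finite I" and M: "\<And>i. prob_space (M i)" and N: "\<And>i. prob_space (N i)"
  shows "distr (PiM I M \<Otimes>\<^sub>M PiM I N) (PiM I (\<lambda>i. M i \<Otimes>\<^sub>M N i)) (\<lambda>(x, y). \<lambda>i\<in>I. (x i, y i))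
    = PiM I (\<lambda>i. M i \<Otimes>\<^sub>M N i)"
proof -
  interpret M: product_prob_space M I by (intro product_prob_spaceI M)
  interpret N: product_prob_space N I by (intro product_prob_spaceI N)
  interpret P: pair_prob_space "M i" "N i" for i 
    by (intro pair_prob_space.intro pair_sigma_finite.intro prob_space_imp_sigma_finite M N)
  interpret MN: product_prob_space "\<lambda>i. M i \<Otimes>\<^sub>M N i" I
    by (intro product_prob_spaceI) (rule P.prob_space_axioms)
  interpret PP: pair_prob_space "PiM I M" "PiM I N" ..
  have [measurable]: "(\<lambda>(x, y). \<lambda>i\<in>I. (x i, y i))
      \<in> PiM I M \<Otimes>\<^sub>M PiM I N \<rightarrow>\<^sub>M PiM I (\<lambda>i. M i \<Otimes>\<^sub>M N i)"
    by measurable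
  show ?thesis
  proof (rule MN.PiM_eqI)
    fix A assume A[measurable]: "\<And>i. i \<in> I \<Longrightarrow> A i \<in> sets (M i \<Otimes>\<^sub>M N i)"
    have [measurable]: "(\<lambda>y. indicator (A i) (a, y) :: ennreal) \<in> borel_measurable (N i)"
      if "i \<in> I" "a \<in> space (M i)" for i a
      using A[OF that(1)] that(2) by measurable
    have [measurable]: "(\<lambda>a. \<integral>\<^sup>+b. indicator (A i) (a, b) \<partial>N i) \<in> borel_measurable (M i)"
      if "i \<in> I" for i
      using A[OF that(1)] by measurable
    have "emeasure (distr (PiM I M \<Otimes>\<^sub>M PiM I N) (PiM I (\<lambda>i. M i \<Otimes>\<^sub>M N i))
            (\<lambda>(x, y). \<lambda>i\<in>I. (x i, y i))) (Pi\<^sub>E I A)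
        = (\<integral>\<^sup>+z. indicator (Pi\<^sub>E I A) z \<partial>distr (PiM I M \<Otimes>\<^sub>M PiM I N)
            (PiM I (\<lambda>i. M i \<Otimes>\<^sub>M N i)) (\<lambda>(x, y). \<lambda>i\<in>I. (x i, y i)))"
      using \<open>finite I\<close> by (subst nn_integral_indicator) auto
    also have "\<dots> = (\<integral>\<^sup>+z. indicator (Pi\<^sub>E I A) ((\<lambda>(x, y). \<lambda>i\<in>I. (x i, y i)) z)
        \<partial>(PiM I M \<Otimes>\<^sub>M PiM I N))"
      using \<open>finite I\<close> by (subst nn_integral_distr) auto
    also have "\<dots> = (\<integral>\<^sup>+x. \<integral>\<^sup>+y. indicator (Pi\<^sub>E I A) (\<lambda>i\<in>I. (x i, y i)) \<partial>PiM I N \<partial>PiM I M)"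
      using \<open>finite I\<close> 
      by (subst sigma_finite_measure.nn_integral_fst[symmetric])
         (auto intro: prob_space_imp_sigma_finite prob_space_PiM N)
    also have "\<dots> = (\<integral>\<^sup>+x. \<integral>\<^sup>+y. (\<Prod>i\<in>I. indicator (A i) (x i, y i)) \<partial>PiM I N \<partial>PiM I M)"
      using \<open>finite I\<close> by (intro nn_integral_cong) (auto simp: indicator_def prod_eq_1_iff PiE_iff)
    also have "\<dots> = (\<integral>\<^sup>+x. (\<Prod>i\<in>I. \<integral>\<^sup>+b. indicator (A i) (x i, b) \<partial>N i) \<partial>PiM I M)"
      using \<open>finite I\<close>
      by (intro nn_integral_cong N.product_nn_integral_prod) (auto simp: space_PiM PiE_iff)
    also have "\<dots> = (\<Prod>i\<in>I. \<integral>\<^sup>+a. \<integral>\<^sup>+b. indicator (A i) (a, b) \<partial>N i \<partial>M i)"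
      using \<open>finite I\<close> by (intro M.product_nn_integral_prod) auto
    also have "\<dots> = (\<Prod>i\<in>I. emeasure (M i \<Otimes>\<^sub>M N i) (A i))"
      by (intro prod.cong refl) (simp add: sigma_finite_measure.emeasure_pair_measure
          prob_space_imp_sigma_finite N)
    finally show "emeasure (distr (PiM I M \<Otimes>\<^sub>M PiM I N) (PiM I (\<lambda>i. M i \<Otimes>\<^sub>M N i))
      (\<lambda>(x, y). \<lambda>i\<in>I. (x i, y i))) (Pi\<^sub>E I A) = (\<Prod>i\<in>I. emeasure (M i \<Otimes>\<^sub>M N i) (A i))" .
  qed (use \<open>finite I\<close> in auto)
qed

lemma distr_PiM_unzip:
  fixes M :: "'i \<Rightarrow> 'a measure" and N :: "'i \<Rightarrow> 'b measure"
  assumes "finite I" and M: "\<And>i. prob_space (M i)" and N: "\<And>i. prob_space (N i)"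
  shows "distr (PiM I (\<lambda>i. M i \<Otimes>\<^sub>M N i)) (PiM I M \<Otimes>\<^sub>M PiM I N)
      (\<lambda>z. (\<lambda>i\<in>I. fst (z i), \<lambda>i\<in>I. snd (z i)))
    = PiM I M \<Otimes>\<^sub>M PiM I N"
proof -
  have "distr (PiM I (\<lambda>i. M i \<Otimes>\<^sub>M N i)) (PiM I M \<Otimes>\<^sub>M PiM I N)
      (\<lambda>z. (\<lambda>i\<in>I. fst (z i), \<lambda>i\<in>I. snd (z i)))
    = distr (distr (PiM I M \<Otimes>\<^sub>M PiM I N) (PiM I (\<lambda>i. M i \<Otimes>\<^sub>M N i)) (\<lambda>(x, y). \<lambda>i\<in>I. (x i, y i)))
        (PiM I M \<Otimes>\<^sub>M PiM I N) (\<lambda>z. (\<lambda>i\<in>I. fst (z i), \<lambda>i\<in>I. snd (z i)))"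
    by (simp add: distr_PiM_zip[OF assms])
  also have "\<dots> = distr (PiM I M \<Otimes>\<^sub>M PiM I N) (PiM I M \<Otimes>\<^sub>M PiM I N) (\<lambda>z. z)"
    by (subst distr_distr, measurable, rule distr_cong)
       (auto simp: space_pair_measure space_PiM PiE_iff fun_eq_iff extensional_def)
  finally show ?thesis by (simp add: distr_id)
qed

definition plane_rot :: "real \<Rightarrow> real \<Rightarrow> 'a \<times> 'a \<Rightarrow> 'a \<times> 'a::real_vector" where
  "plane_rot c d = (\<lambda>(x, y). (c *\<^sub>R x + d *\<^sub>R y, c *\<^sub>R y - d *\<^sub>R x))"

lemma plane_rot_measurable [measurable]:
  "plane_rot c d \<in> borel \<Otimes>\<^sub>M borel \<rightarrow>\<^sub>M (borel \<Otimes>\<^sub>M borel :: ('a::euclidean_space \<times> 'a) measure)"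
  unfolding plane_rot_def by measurable

text \<open>Rotating a pair of vectors rotates every pair of coordinates separately. After zipping,
  the two product measures become one product of planes, on which the map acts
  componentwise.\<close>

lemma plane_rot_PiM:
  fixes G :: "'a::euclidean_space measure"
  assumes "finite I" "prob_space G" and sets [measurable_cong]: "sets G = sets borel"
    and inv: "distr (G \<Otimes>\<^sub>M G) (G \<Otimes>\<^sub>M G) (plane_rot c d) = G \<Otimes>\<^sub>M G"
  shows "distr (PiM I (\<lambda>_. G) \<Otimes>\<^sub>M PiM I (\<lambda>_. G)) (PiM I (\<lambda>_. G) \<Otimes>\<^sub>M PiM I (\<lambda>_. G))
      (\<lambda>(x, y). (\<lambda>i\<in>I. c *\<^sub>R x i + d *\<^sub>R y i, \<lambda>i\<in>I. c *\<^sub>R y i - d *\<^sub>R x i))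
    = PiM I (\<lambda>_. G) \<Otimes>\<^sub>M PiM I (\<lambda>_. G)" (is "distr ?PP ?PP ?R = _")
proof -
  interpret G: prob_space G by fact
  interpret pair_prob_space G G ..
  let ?Z = "PiM I (\<lambda>_. G \<Otimes>\<^sub>M G)"
  let ?u = "\<lambda>z. (\<lambda>i\<in>I. fst (z i), \<lambda>i\<in>I. snd (z i))"
  have [measurable]: "plane_rot c d \<in> G \<Otimes>\<^sub>M G \<rightarrow>\<^sub>M G \<Otimes>\<^sub>M G"
    unfolding plane_rot_def by measurable
  have [measurable]: "?R \<in> ?PP \<rightarrow>\<^sub>M ?PP" by measurable
  have [measurable]: "?u \<in> ?Z \<rightarrow>\<^sub>M ?PP" by measurable
  have [measurable]: "compose I (plane_rot c d) \<in> ?Z \<rightarrow>\<^sub>M ?Z"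
    unfolding compose_def by measurable
  have unzip: "distr ?Z ?PP ?u = ?PP"
    by (rule distr_PiM_unzip) fact+
  have "distr ?PP ?PP ?R = distr (distr ?Z ?PP ?u) ?PP ?R"
    by (simp only: unzip)
  also have "\<dots> = distr ?Z ?PP (\<lambda>z. ?R (?u z))"
    by (subst distr_distr) (auto simp: o_def)
  also have "\<dots> = distr ?Z ?PP (\<lambda>z. ?u (compose I (plane_rot c d) z))"
    by (rule distr_cong) (auto simp: compose_def plane_rot_def case_prod_beta fun_eq_iff)
  also have "\<dots> = distr (distr ?Z ?Z (compose I (plane_rot c d))) ?PP ?u"
    by (subst distr_distr) (auto simp: o_def)
  also have "distr ?Z ?Z (compose I (plane_rot c d)) = PiM I (\<lambda>_. distr (G \<Otimes>\<^sub>M G) (G \<Otimes>\<^sub>M G) (plane_rot c d))"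
    using \<open>finite I\<close> by (intro distr_PiM_finite_prob_space') (auto intro: prob_space_axioms)
  also have "distr (G \<Otimes>\<^sub>M G) (G \<Otimes>\<^sub>M G) (plane_rot c d) = G \<Otimes>\<^sub>M G" by (rule inv)
  also have "distr ?Z ?PP ?u = ?PP" by (rule unzip)
  finally show ?thesis .
qed

section \<open>The centred real Gaussian law\<close>

definition real_gauss :: "real \<Rightarrow> real measure" where
  "real_gauss \<sigma> = density lborel (\<lambda>x. ennreal (normal_density 0 \<sigma> x))"

lemma sets_real_gauss [simp, measurable_cong]: "sets (real_gauss \<sigma>) = sets borel"
  by (simp add: real_gauss_def)

lemma space_real_gauss [simp]: "space (real_gauss \<sigma>) = UNIV"
  by (simp add: real_gauss_def)

lemma prob_space_real_gauss: "\<sigma> > 0 \<Longrightarrow> prob_space (real_gauss \<sigma>)"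
  unfolding real_gauss_def by (rule prob_space_normal_density)

text \<open>The rotation is the composition of the substitutions \<open>x' = c x + d y\<close> for fixed \<open>y\<close> and
  \<open>y' = (y - d x') / c\<close> for fixed \<open>x'\<close>.\<close>

lemma real_gauss_rot:
  assumes "\<sigma> > 0" "c > 0" and cd: "c\<^sup>2 + d\<^sup>2 = 1"
  shows "distr (real_gauss \<sigma> \<Otimes>\<^sub>M real_gauss \<sigma>) (real_gauss \<sigma> \<Otimes>\<^sub>M real_gauss \<sigma>) (plane_rot c d)
    = real_gauss \<sigma> \<Otimes>\<^sub>M real_gauss \<sigma>" (is "distr ?P ?P _ = ?P")
proof (rule measure_eqI)
  interpret G: prob_space "real_gauss \<sigma>" using \<open>\<sigma> > 0\<close> by (rule prob_space_real_gauss)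
  interpret PP: pair_prob_space "real_gauss \<sigma>" "real_gauss \<sigma>" ..
  have rot [measurable]: "plane_rot c d \<in> ?P \<rightarrow>\<^sub>M ?P"
    unfolding plane_rot_def by measurable
  fix A assume "A \<in> sets (distr ?P ?P (plane_rot c d))"
  hence A: "A \<in> sets ?P" by simp
  hence [measurable]: "A \<in> sets (borel \<Otimes>\<^sub>M borel)"
    by (simp cong: sets_pair_measure_cong)
  define w where "w x y = ennreal (normal_density 0 \<sigma> x) * ennreal (normal_density 0 \<sigma> y)" for x y
  have [measurable]: "case_prod w \<in> borel_measurable (borel \<Otimes>\<^sub>M borel)"
    unfolding w_def case_prod_beta by measurable
  \<comment> \<open>The rotation sends \<open>((x - d * y) / c, y)\<close> to
    \<open>(x, (y - d * x) / c)\<close>. This is thus the rotation invariance of a weight depending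
    only on x^2 + y^2, stated in the mixed coordinates (new x, old y) left by the first
    substitution.\<close>
  have w_rot: "w ((x - d * y) / c) y = w x ((y - d * x) / c)" for x y
  proof -
    have "((x - d * y) / c)\<^sup>2 + y\<^sup>2 = x\<^sup>2 + ((y - d * x) / c)\<^sup>2"
    proof -
      have "c\<^sup>2 * (((x - d * y) / c)\<^sup>2 + y\<^sup>2) = x\<^sup>2 - 2 * d * x * y + (c\<^sup>2 + d\<^sup>2) * y\<^sup>2"
        using \<open>c > 0\<close> by (simp add: power_divide field_simps power2_eq_square)
      moreover have "c\<^sup>2 * (x\<^sup>2 + ((y - d * x) / c)\<^sup>2) = (c\<^sup>2 + d\<^sup>2) * x\<^sup>2 - 2 * d * x * y + y\<^sup>2"
        using \<open>c > 0\<close> by (simp add: power_divide field_simps power2_eq_square)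
      ultimately have "c\<^sup>2 * (((x - d * y) / c)\<^sup>2 + y\<^sup>2) = c\<^sup>2 * (x\<^sup>2 + ((y - d * x) / c)\<^sup>2)"
        using cd by simp
      thus ?thesis using \<open>c > 0\<close> by simp
    qed
    moreover have "normal_density 0 \<sigma> a * normal_density 0 \<sigma> b
        = (1 / sqrt (2 * pi * \<sigma>\<^sup>2))\<^sup>2 * exp (- (a\<^sup>2 + b\<^sup>2) / (2 * \<sigma>\<^sup>2))" for a b
      by (simp add: normal_density_def power2_eq_square exp_add[symmetric] add_divide_distrib
          diff_divide_distrib)
    ultimately show ?thesis
      by (simp add: w_def ennreal_mult[symmetric])
  qed
  have int: "(\<integral>\<^sup>+z. f z \<partial>?P) = (\<integral>\<^sup>+y. \<integral>\<^sup>+x. w x y * f (x, y) \<partial>lborel \<partial>lborel)"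
    if [measurable]: "f \<in> borel_measurable (borel \<Otimes>\<^sub>M borel)" for f :: "real \<times> real \<Rightarrow> ennreal"
  proof -
    have "(\<integral>\<^sup>+z. f z \<partial>?P) = (\<integral>\<^sup>+y. \<integral>\<^sup>+x. f (x, y) \<partial>real_gauss \<sigma> \<partial>real_gauss \<sigma>)"
      by (subst PP.nn_integral_snd[symmetric]) simp_all
    also have "\<dots> = (\<integral>\<^sup>+y. normal_density 0 \<sigma> y * (\<integral>\<^sup>+x. normal_density 0 \<sigma> x * f (x, y) \<partial>lborel) \<partial>lborel)"
      unfolding real_gauss_def by (simp add: nn_integral_density)
    also have "\<dots> = (\<integral>\<^sup>+y. \<integral>\<^sup>+x. w x y * f (x, y) \<partial>lborel \<partial>lborel)"
      by (subst nn_integral_cmult[symmetric]) (auto simp: w_def mult_ac)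
    finally show ?thesis .
  qed
  have "emeasure (distr ?P ?P (plane_rot c d)) A = (\<integral>\<^sup>+z. indicator A z \<partial>distr ?P ?P (plane_rot c d))"
    using A by simp
  also have "\<dots> = (\<integral>\<^sup>+z. indicator A (plane_rot c d z) \<partial>?P)"
    using A by (subst nn_integral_distr) auto
  also have "\<dots> = (\<integral>\<^sup>+y. \<integral>\<^sup>+x. w x y * indicator A (c * x + d * y, c * y - d * x) \<partial>lborel \<partial>lborel)"
    by (subst int) (simp_all add: plane_rot_def)
  also have "\<dots> = (\<integral>\<^sup>+y. \<integral>\<^sup>+x. ennreal (1 / c) * (w x ((y - d * x) / c) * indicator A (x, (y - d * x) / c)) \<partial>lborel \<partial>lborel)"
  proof (rule nn_integral_cong)
    fix y :: real
    have "(\<integral>\<^sup>+x. w x y * indicator A (c * x + d * y, c * y - d * x) \<partial>lborel)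
      = \<bar>1 / c\<bar> * (\<integral>\<^sup>+x. w (- d * y / c + (1 / c) * x) y *
          indicator A (c * (- d * y / c + (1 / c) * x) + d * y, c * y - d * (- d * y / c + (1 / c) * x)) \<partial>lborel)"
      using \<open>c > 0\<close> by (subst nn_integral_real_affine[where c = "1 / c" and t = "- d * y / c"]) auto
    also have "\<dots> = ennreal (1 / c) * (\<integral>\<^sup>+x. w x ((y - d * x) / c) * indicator A (x, (y - d * x) / c) \<partial>lborel)"
    proof -
      have 1: "- d * y / c + (1 / c) * x = (x - d * y) / c" for x
        by (simp add: diff_divide_distrib)
      have 2: "c * ((x - d * y) / c) + d * y = x" for x
        using \<open>c > 0\<close> by simp
      have 3: "c * y - d * ((x - d * y) / c) = (y - d * x) / c" for x
      proof -
        have "c * y - d * ((x - d * y) / c) = ((c\<^sup>2 + d\<^sup>2) * y - d * x) / c"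
          using \<open>c > 0\<close> by (simp add: field_simps power2_eq_square)
        thus ?thesis by (simp add: cd)
      qed
      show ?thesis using \<open>c > 0\<close> by (simp only: 1 2 3 w_rot) simp
    qed
    also have "\<dots> = (\<integral>\<^sup>+x. ennreal (1 / c) * (w x ((y - d * x) / c) * indicator A (x, (y - d * x) / c)) \<partial>lborel)"
      by (subst nn_integral_cmult) auto
    finally show "(\<integral>\<^sup>+x. w x y * indicator A (c * x + d * y, c * y - d * x) \<partial>lborel)
      = (\<integral>\<^sup>+x. ennreal (1 / c) * (w x ((y - d * x) / c) * indicator A (x, (y - d * x) / c)) \<partial>lborel)" .
  qed
  \<comment> \<open>The first substitution contributed the factor 1/c. With the integrals exchanged,
    the second one contributes c and cancels it.\<close>
  also have "\<dots> = (\<integral>\<^sup>+x. \<integral>\<^sup>+y. ennreal (1 / c) * (w x ((y - d * x) / c) * indicator A (x, (y - d * x) / c)) \<partial>lborel \<partial>lborel)"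
    by (rule lborel_pair.Fubini') auto
  also have "\<dots> = (\<integral>\<^sup>+x. \<integral>\<^sup>+y. w x y * indicator A (x, y) \<partial>lborel \<partial>lborel)"
  proof (rule nn_integral_cong)
    fix x :: real
    have 1: "(d * x + c * y - d * x) / c = y" for y
      using \<open>c > 0\<close> by simp
    have "(\<integral>\<^sup>+y. ennreal (1 / c) * (w x ((y - d * x) / c) * indicator A (x, (y - d * x) / c)) \<partial>lborel)
      = \<bar>c\<bar> * (\<integral>\<^sup>+y. ennreal (1 / c) * (w x ((d * x + c * y - d * x) / c) *
          indicator A (x, (d * x + c * y - d * x) / c)) \<partial>lborel)"
      using \<open>c > 0\<close> by (subst nn_integral_real_affine[where c = c and t = "d * x"]) auto
    also have "\<dots> = \<bar>c\<bar> * (ennreal (1 / c) * (\<integral>\<^sup>+y. w x y * indicator A (x, y) \<partial>lborel))"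
      unfolding 1 by (subst nn_integral_cmult) auto
    also have "\<dots> = (\<integral>\<^sup>+y. w x y * indicator A (x, y) \<partial>lborel)"
      using \<open>c > 0\<close> by (simp add: mult.assoc[symmetric] ennreal_mult[symmetric])
    finally show "(\<integral>\<^sup>+y. ennreal (1 / c) * (w x ((y - d * x) / c) * indicator A (x, (y - d * x) / c)) \<partial>lborel)
      = (\<integral>\<^sup>+y. w x y * indicator A (x, y) \<partial>lborel)" .
  qed
  also have "\<dots> = (\<integral>\<^sup>+y. \<integral>\<^sup>+x. w x y * indicator A (x, y) \<partial>lborel \<partial>lborel)"
    by (rule lborel_pair.Fubini') auto
  also have "\<dots> = (\<integral>\<^sup>+z. indicator A z \<partial>?P)"
    by (subst int) simp_all
  also have "\<dots> = emeasure ?P A" using A by simp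
  finally show "emeasure (distr ?P ?P (plane_rot c d)) A = emeasure ?P A" .
qed simp

section \<open>The standard Gaussian on a Euclidean space\<close>

lemma pair_prob_spaceI: "prob_space M \<Longrightarrow> prob_space N \<Longrightarrow> pair_prob_space M N"
  by (intro pair_prob_space.intro pair_sigma_finite.intro prob_space_imp_sigma_finite)

lemma cis_measurable [measurable]: "cis \<in> borel_measurable borel"
  by (intro borel_measurable_continuous_onI continuous_intros)

lemma real_gauss_char:
  assumes "\<sigma> > 0"
  shows "(\<integral>x. cis (t * x) \<partial>real_gauss \<sigma>) = of_real (exp (- (\<sigma> * t)\<^sup>2 / 2))"
proof -
  have "of_real (exp (- (\<sigma> * t)\<^sup>2 / 2)) = char std_normal_distribution (\<sigma> * t)"
    by (simp add: char_std_normal_distribution)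
  also have "\<dots> = (\<integral>x. std_normal_density x *\<^sub>R cis (\<sigma> * t * x) \<partial>lborel)"
    unfolding char_def by (subst integral_density) (auto simp: cis_conv_exp)
  also have "\<dots> = (\<integral>x. normal_density 0 \<sigma> x *\<^sub>R cis (t * x) \<partial>lborel)"
    using \<open>\<sigma> > 0\<close>
    by (subst (2) lborel_integral_real_affine[where c = \<sigma> and t = 0])
       (auto simp: normal_density_def power_mult_distrib real_sqrt_mult mult_ac
         simp flip: integral_scaleR_right intro!: Bochner_Integration.integral_cong)
  also have "\<dots> = (\<integral>x. cis (t * x) \<partial>real_gauss \<sigma>)"
    unfolding real_gauss_def by (subst integral_density) auto
  finally show ?thesis ..
qed

text \<open>Tilting a centred Gaussian density by exp(-s x^2) gives 1/k times the centred Gaussian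
  density of standard deviation \<sigma>/k, where k^2 = 1 + 2 s \<sigma>^2; the total mass is read
  off.\<close>

lemma real_gauss_laplace:
  assumes "\<sigma> > 0" "s \<ge> 0"
  shows "(\<integral>\<^sup>+x. ennreal (exp (- s * x\<^sup>2)) \<partial>real_gauss \<sigma>) = ennreal (1 / sqrt (1 + 2 * s * \<sigma>\<^sup>2))"
proof -
  define k where "k = sqrt (1 + 2 * s * \<sigma>\<^sup>2)"
  have k2: "k\<^sup>2 = 1 + 2 * s * \<sigma>\<^sup>2" and "k > 0"
    using assms by (auto simp: k_def add_pos_nonneg)
  have *: "normal_density 0 \<sigma> x * exp (- s * x\<^sup>2) = 1 / k * normal_density 0 (\<sigma> / k) x" for x
  proof -
    have "- x\<^sup>2 / (2 * \<sigma>\<^sup>2) - s * x\<^sup>2 = - x\<^sup>2 / (2 * (\<sigma> / k)\<^sup>2)"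
      using assms \<open>k > 0\<close> unfolding power_divide k2 by (simp add: field_simps)
    thus ?thesis
      using assms \<open>k > 0\<close>
      by (simp add: normal_density_def real_sqrt_mult real_sqrt_divide power_divide mult_exp_exp)
  qed
  have **: "ennreal (normal_density 0 \<sigma> x) * ennreal (exp (- s * x\<^sup>2))
      = ennreal (1 / k) * ennreal (normal_density 0 (\<sigma> / k) x)" for x
    using \<open>k > 0\<close> by (simp only: ennreal_mult[symmetric] * normal_density_nonneg exp_ge_zero
        zero_le_divide_1_iff less_imp_le)
  have "(\<integral>\<^sup>+x. ennreal (exp (- s * x\<^sup>2)) \<partial>real_gauss \<sigma>)
      = (\<integral>\<^sup>+x. ennreal (1 / k) * ennreal (normal_density 0 (\<sigma> / k) x) \<partial>lborel)"
    unfolding real_gauss_def by (subst nn_integral_density) (simp_all only: **, simp_all)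
  also have "\<dots> = ennreal (1 / k) * emeasure (real_gauss (\<sigma> / k)) UNIV"
    by (subst nn_integral_cmult) (auto simp: real_gauss_def emeasure_density)
  also have "emeasure (real_gauss (\<sigma> / k)) UNIV = 1"
    using prob_space.emeasure_space_1[OF prob_space_real_gauss[of "\<sigma> / k"]] assms \<open>k > 0\<close> by simp
  finally show ?thesis by (simp add: k_def)
qed

lemma real_gauss_uminus: "distr (real_gauss \<sigma>) (real_gauss \<sigma>) uminus = real_gauss \<sigma>"
proof (rule measure_eqI)
  fix A assume "A \<in> sets (distr (real_gauss \<sigma>) (real_gauss \<sigma>) uminus)"
  hence [measurable]: "A \<in> sets borel" by simp
  have [measurable]: "uminus \<in> real_gauss \<sigma> \<rightarrow>\<^sub>M real_gauss \<sigma>" by measurable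
  have "emeasure (distr (real_gauss \<sigma>) (real_gauss \<sigma>) uminus) A = (\<integral>\<^sup>+x. indicator A (- x) \<partial>real_gauss \<sigma>)"
    by (subst nn_integral_indicator[symmetric], simp, subst nn_integral_distr) auto
  also have "\<dots> = (\<integral>\<^sup>+x. ennreal (normal_density 0 \<sigma> x) * indicator A (- x) \<partial>lborel)"
    unfolding real_gauss_def by (subst nn_integral_density) auto
  also have "\<dots> = (\<integral>\<^sup>+x. ennreal (normal_density 0 \<sigma> x) * indicator A x \<partial>lborel)"
    by (subst nn_integral_real_affine[where c = "-1" and t = 0]) (auto simp: normal_density_def)
  also have "\<dots> = emeasure (real_gauss \<sigma>) A"
    unfolding real_gauss_def by (subst emeasure_density) auto
  finally show "emeasure (distr (real_gauss \<sigma>) (real_gauss \<sigma>) uminus) A = emeasure (real_gauss \<sigma>) A" .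
qed simp

lemma real_gauss_second_moment:
  assumes "\<sigma> > 0"
  shows "(\<integral>\<^sup>+x. ennreal (x\<^sup>2) \<partial>real_gauss \<sigma>) = ennreal (\<sigma>\<^sup>2)"
proof -
  have "has_bochner_integral lborel (\<lambda>x. normal_density 0 \<sigma> x * (x - 0) ^ (2 * 1)) (fact (2 * 1) / ((2 / \<sigma>\<^sup>2) ^ 1 * fact 1))"
    by (rule normal_moment_even) fact
  hence hb: "has_bochner_integral lborel (\<lambda>x. normal_density 0 \<sigma> x * x\<^sup>2) (\<sigma>\<^sup>2)"
    by simp
  have "(\<integral>\<^sup>+x. ennreal (x\<^sup>2) \<partial>real_gauss \<sigma>) = (\<integral>\<^sup>+x. ennreal (normal_density 0 \<sigma> x * x\<^sup>2) \<partial>lborel)"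
    unfolding real_gauss_def by (subst nn_integral_density) (auto simp: ennreal_mult)
  also have "\<dots> = ennreal (\<sigma>\<^sup>2)"
    using hb by (subst nn_integral_eq_integral) (auto simp: has_bochner_integral_iff)
  finally show ?thesis .
qed

text \<open>A concrete model of the standard Gaussian law, normalised so that the squared norm has
  mean 1. \<open>standard_gaussian_distr\<close> identifies it with the law of any variable
  satisfying \<open>standard_gaussian\<close>.\<close>

definition kgauss :: "'k::euclidean_space measure" where
  "kgauss = distr (PiM Basis (\<lambda>_. real_gauss (sqrt (1 / real DIM('k))))) borel (\<lambda>x. \<Sum>b\<in>Basis. x b *\<^sub>R b)"

lemma sets_kgauss [simp, measurable_cong]: "sets kgauss = sets borel"
  by (simp add: kgauss_def)

lemma space_kgauss [simp]: "space kgauss = UNIV"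
  by (simp add: kgauss_def)

lemma std_dev_pos: "sqrt (1 / real DIM('k::euclidean_space)) > 0"
  by simp

lemma prob_space_kgauss: "prob_space (kgauss :: 'k::euclidean_space measure)"
  unfolding kgauss_def
  by (intro prob_space.prob_space_distr prob_space_PiM prob_space_real_gauss std_dev_pos) simp

lemma norm_sum_Basis: "(norm (\<Sum>b\<in>Basis. f b *\<^sub>R (b::'k::euclidean_space)))\<^sup>2 = (\<Sum>b\<in>Basis. (f b)\<^sup>2)"
  by (subst power2_norm_eq_inner, subst euclidean_inner) (simp add: power2_eq_square)

lemma kgauss_rot:
  assumes "c > 0" and cd: "c\<^sup>2 + d\<^sup>2 = 1"
  shows "distr (kgauss \<Otimes>\<^sub>M kgauss) (kgauss \<Otimes>\<^sub>M kgauss) (plane_rot c d)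
    = kgauss \<Otimes>\<^sub>M (kgauss :: 'k::euclidean_space measure)"
proof -
  let ?N = "real_gauss (sqrt (1 / real DIM('k)))"
  let ?P = "PiM (Basis :: 'k set) (\<lambda>_. ?N)"
  let ?s = "\<lambda>x. \<Sum>b\<in>Basis. x b *\<^sub>R (b::'k)"
  let ?K = "borel \<Otimes>\<^sub>M borel :: ('k \<times> 'k) measure"
  let ?S = "\<lambda>(x, y). (?s x, ?s y)"
  let ?R = "\<lambda>(x, y). (\<lambda>i\<in>Basis. c *\<^sub>R x i + d *\<^sub>R y i, \<lambda>i\<in>Basis. c *\<^sub>R y i - d *\<^sub>R x i)"
  have [measurable]: "?S \<in> ?P \<Otimes>\<^sub>M ?P \<rightarrow>\<^sub>M ?K" by measurable
  have [measurable]: "?R \<in> ?P \<Otimes>\<^sub>M ?P \<rightarrow>\<^sub>M ?P \<Otimes>\<^sub>M ?P" by measurable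
  have PP: "distr (?P \<Otimes>\<^sub>M ?P) (?P \<Otimes>\<^sub>M ?P) ?R = ?P \<Otimes>\<^sub>M ?P"
    by (intro plane_rot_PiM real_gauss_rot prob_space_real_gauss std_dev_pos assms) simp_all
  have KK: "kgauss \<Otimes>\<^sub>M kgauss = distr (?P \<Otimes>\<^sub>M ?P) ?K ?S"
    unfolding kgauss_def
    by (rule pair_measure_distr)
       (auto intro!: prob_space_imp_sigma_finite prob_space.prob_space_distr prob_space_PiM
         prob_space_real_gauss std_dev_pos)
  have "distr (kgauss \<Otimes>\<^sub>M kgauss) (kgauss \<Otimes>\<^sub>M kgauss) (plane_rot c d)
      = distr (distr (?P \<Otimes>\<^sub>M ?P) ?K ?S) ?K (plane_rot c d)"
    by (subst KK, rule distr_cong) (auto cong: sets_pair_measure_cong)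
  also have "\<dots> = distr (?P \<Otimes>\<^sub>M ?P) ?K (\<lambda>z. plane_rot c d (?S z))"
    by (subst distr_distr) (auto simp: o_def)
  also have "\<dots> = distr (?P \<Otimes>\<^sub>M ?P) ?K (\<lambda>z. ?S (?R z))"
    by (rule distr_cong)
       (auto simp: plane_rot_def sum.distrib sum_subtractf scaleR_sum_right algebra_simps)
  also have "\<dots> = distr (distr (?P \<Otimes>\<^sub>M ?P) (?P \<Otimes>\<^sub>M ?P) ?R) ?K ?S"
    by (subst distr_distr) (auto simp: o_def)
  also have "\<dots> = kgauss \<Otimes>\<^sub>M kgauss" by (simp only: PP KK)
  finally show ?thesis .
qed

lemma kgauss_uminus: "distr kgauss borel uminus = (kgauss :: 'k::euclidean_space measure)"
proof -
  let ?N = "real_gauss (sqrt (1 / real DIM('k)))"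
  let ?P = "PiM (Basis :: 'k set) (\<lambda>_. ?N)"
  let ?s = "\<lambda>x. \<Sum>b\<in>Basis. x b *\<^sub>R (b::'k)"
  have [measurable]: "compose Basis uminus \<in> ?P \<rightarrow>\<^sub>M ?P"
    unfolding compose_def by measurable
  have "distr ?P ?P (compose Basis uminus) = PiM Basis (\<lambda>_. distr ?N ?N uminus)"
    by (intro distr_PiM_finite_prob_space') (auto intro: prob_space_real_gauss)
  hence P: "distr ?P ?P (compose Basis uminus) = ?P"
    by (simp only: real_gauss_uminus)
  have "distr (distr ?P borel ?s) borel uminus = distr ?P borel (\<lambda>x. ?s (compose Basis uminus x))"
    by (subst distr_distr) (auto simp: o_def compose_def sum_negf intro!: distr_cong)
  also have "\<dots> = distr (distr ?P ?P (compose Basis uminus)) borel ?s"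
    by (subst distr_distr) (auto simp: o_def)
  finally show ?thesis by (simp only: P kgauss_def)
qed

lemma kgauss_second_moment: "(\<integral>\<^sup>+x. ennreal ((norm x)\<^sup>2) \<partial>(kgauss :: 'k::euclidean_space measure)) = 1"
proof -
  let ?N = "real_gauss (sqrt (1 / real DIM('k)))"
  let ?P = "PiM (Basis :: 'k set) (\<lambda>_. ?N)"
  interpret N: product_prob_space "\<lambda>_::'k. ?N" "Basis"
    by (intro product_prob_spaceI prob_space_real_gauss std_dev_pos)
  have "(\<integral>\<^sup>+x. ennreal ((norm x)\<^sup>2) \<partial>(kgauss :: 'k measure)) = (\<integral>\<^sup>+x. (\<Sum>b\<in>Basis. ennreal ((x b)\<^sup>2)) \<partial>?P)"
    unfolding kgauss_def by (subst nn_integral_distr) (auto simp: norm_sum_Basis)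
  also have "\<dots> = (\<Sum>b\<in>(Basis::'k set). \<integral>\<^sup>+x. ennreal ((x b)\<^sup>2) \<partial>?P)"
    by (rule nn_integral_sum) auto
  also have "\<dots> = (\<Sum>b\<in>(Basis::'k set). \<integral>\<^sup>+x. ennreal (x\<^sup>2) \<partial>?N)"
  proof (rule sum.cong[OF refl])
    fix b :: 'k assume "b \<in> Basis"
    hence "?N = distr ?P ?N (\<lambda>x. x b)"
      by (subst distr_PiM_component) (auto intro: prob_space_real_gauss)
    hence "(\<integral>\<^sup>+x. ennreal (x\<^sup>2) \<partial>?N) = (\<integral>\<^sup>+x. ennreal (x\<^sup>2) \<partial>distr ?P ?N (\<lambda>x. x b))"
      by simp
    thus "(\<integral>\<^sup>+x. ennreal ((x b)\<^sup>2) \<partial>?P) = (\<integral>\<^sup>+x. ennreal (x\<^sup>2) \<partial>?N)"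
      using \<open>b \<in> Basis\<close> by (subst (asm) nn_integral_distr) auto
  qed
  also have "\<dots> = (\<Sum>b\<in>(Basis::'k set). ennreal (1 / real DIM('k)))"
    by (subst real_gauss_second_moment) (simp_all add: std_dev_pos)
  also have "\<dots> = 1"
    by (simp add: ennreal_of_nat_eq_real_of_nat flip: ennreal_mult)
  finally show ?thesis .
qed

text \<open>Serves twice: as the characteristic function of a 1 by 1 permanent, which starts the
  recursion, and, read backwards, to express a Gaussian weight as an average of characters in the
  small ball estimate.\<close>

lemma kgauss_char:
  fixes \<tau> :: "'k::euclidean_space"
  shows "(\<integral>x. cis (\<tau> \<bullet> x) \<partial>kgauss) = of_real (exp (- (norm \<tau>)\<^sup>2 / (2 * real DIM('k))))"
proof -
  let ?\<sigma> = "sqrt (1 / real DIM('k))"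
  let ?P = "PiM (Basis :: 'k set) (\<lambda>_. real_gauss ?\<sigma>)"
  interpret N: product_prob_space "\<lambda>_::'k. real_gauss ?\<sigma>" "Basis"
    by (intro product_prob_spaceI prob_space_real_gauss std_dev_pos)
  have cis_sum: "cis (\<Sum>b\<in>B. f b) = (\<Prod>b\<in>B. cis (f b))" if "finite B" for B :: "'k set" and f
    using that by (induction rule: finite_induct) (auto simp: cis_mult[symmetric])
  have "(\<integral>x. cis (\<tau> \<bullet> x) \<partial>kgauss) = (\<integral>x. (\<Prod>b\<in>Basis. cis ((\<tau> \<bullet> b) * x b)) \<partial>?P)"
    unfolding kgauss_def
    by (subst integral_distr) (auto simp: inner_sum_right cis_sum mult.commute)
  also have "\<dots> = (\<Prod>b\<in>Basis. \<integral>x. cis ((\<tau> \<bullet> b) * x) \<partial>real_gauss ?\<sigma>)"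
    by (intro N.product_integral_prod)
       (auto intro!: finite_measure.integrable_const_bound[where B = 1] prob_space.finite_measure
         prob_space_real_gauss)
  also have "\<dots> = (\<Prod>b\<in>Basis. of_real (exp (- (\<tau> \<bullet> b)\<^sup>2 / (2 * real DIM('k)))))"
    by (subst real_gauss_char) (auto simp: power_mult_distrib mult.commute)
  also have "\<dots> = of_real (exp (\<Sum>b\<in>Basis. - (\<tau> \<bullet> b)\<^sup>2 / (2 * real DIM('k))))"
    by (simp add: exp_sum)
  also have "(\<Sum>b\<in>Basis. - (\<tau> \<bullet> b)\<^sup>2 / (2 * real DIM('k))) = - (norm \<tau>)\<^sup>2 / (2 * real DIM('k))"
    by (subst power2_norm_eq_inner, subst euclidean_inner)
       (simp add: sum_divide_distrib sum_negf power2_eq_square)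
  finally show ?thesis .
qed

lemma kgauss_laplace:
  assumes "s \<ge> 0"
  shows "(\<integral>\<^sup>+x. ennreal (exp (- s * (norm x)\<^sup>2)) \<partial>(kgauss :: 'k::euclidean_space measure))
    = ennreal ((1 / sqrt (1 + 2 * s / real DIM('k))) ^ DIM('k))"
proof -
  let ?\<sigma> = "sqrt (1 / real DIM('k))"
  let ?P = "PiM (Basis :: 'k set) (\<lambda>_. real_gauss ?\<sigma>)"
  interpret N: product_prob_space "\<lambda>_::'k. real_gauss ?\<sigma>" "Basis"
    by (intro product_prob_spaceI prob_space_real_gauss std_dev_pos)
  have "(\<integral>\<^sup>+x. ennreal (exp (- s * (norm x)\<^sup>2)) \<partial>(kgauss :: 'k measure))
      = (\<integral>\<^sup>+x. (\<Prod>b\<in>Basis. ennreal (exp (- s * (x b)\<^sup>2))) \<partial>?P)"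
    unfolding kgauss_def
    by (subst nn_integral_distr)
       (auto simp: norm_sum_Basis sum_distrib_left exp_sum prod_ennreal simp flip: sum_negf)
  also have "\<dots> = (\<Prod>b\<in>(Basis::'k set). \<integral>\<^sup>+x. ennreal (exp (- s * x\<^sup>2)) \<partial>real_gauss ?\<sigma>)"
    by (intro N.product_nn_integral_prod) auto
  also have "\<dots> = ennreal ((1 / sqrt (1 + 2 * s / real DIM('k))) ^ DIM('k))"
    using assms by (subst real_gauss_laplace) (auto simp: ennreal_power)
  finally show ?thesis .
qed

section \<open>Row expansion of the permanent\<close>

text \<open>Expansion along the last row for the rows below \<open>m\<close> and the columns in
  \<open>C\<close>, with \<open>A j i\<close> in row \<open>i\<close> and column \<open>j\<close>.
  The last-row factor stands on the right, which keeps the row order over the quaternions. The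
  column index comes first so that replacing a column is a function update.\<close>

primrec rperm :: "nat \<Rightarrow> 'c set \<Rightarrow> ('c \<Rightarrow> nat \<Rightarrow> 'k) \<Rightarrow> 'k::ring_1" where
  "rperm 0 C A = 1"
| "rperm (Suc m) C A = (\<Sum>j\<in>C. rperm m (C - {j}) A * A j m)"

lemma rperm_cong:
  "(\<And>j i. j \<in> C \<Longrightarrow> i < m \<Longrightarrow> A j i = B j i) \<Longrightarrow> rperm m C A = rperm m C B"
proof (induction m arbitrary: C)
  case (Suc m)
  have "rperm m (C - {j}) A = rperm m (C - {j}) B" for j
    using Suc.prems by (intro Suc.IH) auto
  thus ?case using Suc.prems by simp
qed simp

lemma rperm_fun_upd_notin: "p \<notin> C \<Longrightarrow> rperm m C (A(p := x)) = rperm m C A"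
  by (rule rperm_cong) auto

text \<open>With as many columns as rows, every term contains exactly one entry of column
  \<open>p\<close>. The coefficients are real, so they can be pulled out from the middle of a
  noncommutative product.\<close>

lemma rperm_column_linear:
  fixes A :: "'c \<Rightarrow> nat \<Rightarrow> 'k::real_algebra_1"
  assumes "finite C" "card C = m" "p \<in> C"
  shows "rperm m C (A(p := (\<lambda>i. a *\<^sub>R x i + b *\<^sub>R y i)))
    = a *\<^sub>R rperm m C (A(p := x)) + b *\<^sub>R rperm m C (A(p := y))"
  using assms
proof (induction m arbitrary: C)
  case (Suc m)
  let ?B = "A(p := (\<lambda>i. a *\<^sub>R x i + b *\<^sub>R y i))"
  have IH: "rperm m (C - {j}) ?B
      = a *\<^sub>R rperm m (C - {j}) (A(p := x)) + b *\<^sub>R rperm m (C - {j}) (A(p := y))"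
    if "j \<in> C - {p}" for j
    using Suc.prems that by (intro Suc.IH) auto
  have split: "rperm (Suc m) C (A(p := z))
      = rperm m (C - {p}) A * z m + (\<Sum>j\<in>C - {p}. rperm m (C - {j}) (A(p := z)) * A j m)" for z
    using Suc.prems
    by (simp add: sum.remove[of C p] rperm_fun_upd_notin del: fun_upd_apply)
       (auto intro!: sum.cong)
  have "(\<Sum>j\<in>C - {p}. rperm m (C - {j}) ?B * A j m)
      = a *\<^sub>R (\<Sum>j\<in>C - {p}. rperm m (C - {j}) (A(p := x)) * A j m)
        + b *\<^sub>R (\<Sum>j\<in>C - {p}. rperm m (C - {j}) (A(p := y)) * A j m)"
    unfolding scaleR_sum_right sum.distrib[symmetric]
    by (intro sum.cong refl) (simp add: IH distrib_right del: fun_upd_apply)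
  thus ?case
    unfolding split by (simp add: algebra_simps)
qed simp

lemma rperm_image:
  "inj_on f C \<Longrightarrow> rperm m (f ` C) A = rperm m C (\<lambda>j. A (f j))"
proof (induction m arbitrary: C)
  case (Suc m)
  have "rperm m (f ` C - {f j}) A = rperm m (C - {j}) (\<lambda>j. A (f j))" if "j \<in> C" for j
  proof -
    have "f ` C - {f j} = f ` (C - {j})"
      using Suc.prems that by (auto simp: inj_on_def)
    thus ?thesis using Suc.prems by (auto intro!: Suc.IH intro: inj_on_subset)
  qed
  thus ?case using Suc.prems by (simp add: sum.reindex)
qed simp

text \<open>Relabelling the columns by the transposition of \<open>p\<close> and \<open>q\<close>
  permutes the terms without touching the order of the row factors. The first part makes the form in
  two columns symmetric; the second lets both columns share one linear term.\<close>

lemma rperm_swap: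
  assumes "p \<noteq> q" "p \<notin> D" "q \<notin> D"
  shows "rperm m (insert p (insert q D)) (A(p := x, q := y)) = rperm m (insert p (insert q D)) (A(p := y, q := x))"
    and "rperm m (insert p D) (A(p := x)) = rperm m (insert q D) (A(q := x))"
proof -
  define f where "f = Transposition.transpose p q"
  have inj: "inj_on f E" for E
    by (rule inj_on_inverseI[of _ f]) (simp add: f_def)
  have "f ` D = D"
    using assms by (auto simp: f_def Transposition.transpose_def)
  hence im: "f ` insert p (insert q D) = insert p (insert q D)" "f ` insert p D = insert q D"
    by (auto simp: f_def)
  show "rperm m (insert p (insert q D)) (A(p := x, q := y)) = rperm m (insert p (insert q D)) (A(p := y, q := x))"
    by (subst im(1)[symmetric], subst rperm_image[OF inj], rule rperm_cong)
       (use assms in \<open>auto simp: f_def Transposition.transpose_def\<close>)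
  show "rperm m (insert p D) (A(p := x)) = rperm m (insert q D) (A(q := x))"
    by (subst im(2)[symmetric], subst rperm_image[OF inj], rule rperm_cong)
       (use assms in \<open>auto simp: f_def Transposition.transpose_def\<close>)
qed

text \<open>An injection on \<open>m + 1\<close> rows is the image of the last row together with an
  injection of the other rows into the remaining columns, which is the shape of the recursive
  expansion.\<close>

lemma rperm_eq_sum_injections:
  assumes "finite C"
  shows "rperm m C A = (\<Sum>f\<in>{f \<in> {..<m} \<rightarrow>\<^sub>E C. inj_on f {..<m}}. \<Prod>i\<leftarrow>[0..<m]. A (f i) i)"
  using assms
proof (induction m arbitrary: C)
  case (Suc m)
  let ?I = "\<lambda>m C. {f \<in> {..<m} \<rightarrow>\<^sub>E C. inj_on f {..<m}}"
  have "finite (?I m D)" if "finite D" for m :: nat and D :: "'a set"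
    using that by (intro finite_subset[OF _ finite_PiE[of "{..<m}" "\<lambda>_. D"]]) auto
  hence "rperm (Suc m) C A = (\<Sum>(j, f)\<in>(SIGMA j:C. ?I m (C - {j})). (\<Prod>i\<leftarrow>[0..<m]. A (f i) i) * A j m)"
    using Suc by (subst sum.Sigma[symmetric]) (auto simp: sum_distrib_right)
  also have "\<dots> = (\<Sum>f\<in>?I (Suc m) C. \<Prod>i\<leftarrow>[0..<Suc m]. A (f i) i)"
  proof (rule sum.reindex_bij_witness[of _ "\<lambda>f. (f m, restrict f {..<m})" "\<lambda>(j, f). f(m := j)"])
    fix f assume "f \<in> ?I (Suc m) C"
    hence f: "f \<in> {..<Suc m} \<rightarrow>\<^sub>E C" "inj_on f {..<Suc m}" by auto
    show "(case (f m, restrict f {..<m}) of (j, f) \<Rightarrow> f(m := j)) = f"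
      using f by (auto simp: fun_eq_iff PiE_iff extensional_def)
    have "f i \<noteq> f m" if "i < m" for i
      using inj_onD[OF f(2), of i m] that by auto
    thus "(f m, restrict f {..<m}) \<in> (SIGMA j:C. ?I m (C - {j}))"
      using f by (auto simp: PiE_iff inj_on_def)
  next
    fix z assume "z \<in> (SIGMA j:C. ?I m (C - {j}))"
    then obtain j f where z: "z = (j, f)" "j \<in> C" "f \<in> {..<m} \<rightarrow>\<^sub>E C - {j}" "inj_on f {..<m}"
      by auto
    show "((case z of (j, f) \<Rightarrow> f(m := j)) m, restrict (case z of (j, f) \<Rightarrow> f(m := j)) {..<m}) = z"
      using z by (auto simp: fun_eq_iff PiE_iff extensional_def)
    show "(case z of (j, f) \<Rightarrow> f(m := j)) \<in> ?I (Suc m) C"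
      using z by (force simp: PiE_iff extensional_def inj_on_def less_Suc_eq)
    have "(\<Prod>i\<leftarrow>[0..<m]. A (if i = m then j else f i) i) = (\<Prod>i\<leftarrow>[0..<m]. A (f i) i)"
      by (rule arg_cong[where f = prod_list]) auto
    thus "(\<Prod>i\<leftarrow>[0..<Suc m]. A ((case z of (j, f) \<Rightarrow> f(m := j)) i) i)
        = (case z of (j, f) \<Rightarrow> (\<Prod>i\<leftarrow>[0..<m]. A (f i) i) * A j m)"
      by (simp add: z(1) cong: map_cong)
  qed
  finally show ?case .
qed simp

lemma permanent_eq_rperm: "permanent n A = rperm n {..<n} (\<lambda>j i. A i j)"
proof -
  have "permanent n A = (\<Sum>f\<in>{f \<in> {..<n} \<rightarrow>\<^sub>E {..<n}. inj_on f {..<n}}. \<Prod>i\<leftarrow>[0..<n]. A i (f i))"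
    unfolding permanent_def
  proof (rule sum.reindex_bij_witness[of _ "\<lambda>f i. if i < n then f i else i" "\<lambda>\<sigma>. restrict \<sigma> {..<n}"])
    fix \<sigma> assume "\<sigma> \<in> {\<sigma>. \<sigma> permutes {..<n}}"
    hence \<sigma>: "\<sigma> permutes {..<n}" by simp
    show "(\<lambda>i. if i < n then restrict \<sigma> {..<n} i else i) = \<sigma>"
      using permutes_not_in[OF \<sigma>] by (auto simp: fun_eq_iff)
    show "restrict \<sigma> {..<n} \<in> {f \<in> {..<n} \<rightarrow>\<^sub>E {..<n}. inj_on f {..<n}}"
      using permutes_in_image[OF \<sigma>] permutes_inj_on[OF \<sigma>, of "{..<n}"] by auto
    show "(\<Prod>i\<leftarrow>[0..<n]. A i (restrict \<sigma> {..<n} i)) = (\<Prod>i\<leftarrow>[0..<n]. A i (\<sigma> i))"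
      by (rule arg_cong[where f = prod_list]) auto
  next
    fix f assume "f \<in> {f \<in> {..<n} \<rightarrow>\<^sub>E {..<n}. inj_on f {..<n}}"
    hence f: "f \<in> {..<n} \<rightarrow>\<^sub>E {..<n}" "inj_on f {..<n}" by auto
    have "bij_betw f {..<n} {..<n}"
      unfolding bij_betw_def using f by (intro conjI endo_inj_surj) (auto simp: PiE_iff)
    hence "bij_betw (\<lambda>i. if i < n then f i else i) {..<n} {..<n}"
      by (subst bij_betw_cong[of _ _ f]) auto
    thus "(\<lambda>i. if i < n then f i else i) \<in> {\<sigma>. \<sigma> permutes {..<n}}"
      by (auto intro!: bij_imp_permutes split: if_splits)
    show "restrict (\<lambda>i. if i < n then f i else i) {..<n} = f"
      using f by (auto simp: fun_eq_iff PiE_iff extensional_def)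
  qed
  thus ?thesis by (simp add: rperm_eq_sum_injections)
qed

lemma rperm_measurable:
  fixes A :: "'a \<Rightarrow> 'c \<Rightarrow> nat \<Rightarrow> 'k::{real_normed_div_algebra, euclidean_space}"
  assumes "\<And>j i. j \<in> C \<Longrightarrow> i < m \<Longrightarrow> (\<lambda>\<omega>. A \<omega> j i) \<in> borel_measurable N"
  shows "(\<lambda>\<omega>. rperm m C (A \<omega>)) \<in> borel_measurable N"
  using assms
proof (induction m arbitrary: C)
  case (Suc m)
  show ?case
    unfolding rperm.simps
    by (intro borel_measurable_sum borel_measurable_times Suc.IH) (auto intro: Suc.prems)
qed simp

section \<open>Characteristic functions of symmetric bilinear forms\<close>

lemma (in pair_prob_space) integral_mult_prod:
  fixes f :: "'a \<Rightarrow> complex" and h :: "'b \<Rightarrow> complex"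
  assumes [measurable]: "f \<in> borel_measurable M1" "h \<in> borel_measurable M2"
    and "\<And>x. norm (f x) \<le> 1" "\<And>y. norm (h y) \<le> 1"
  shows "(\<integral>z. f (fst z) * h (snd z) \<partial>(M1 \<Otimes>\<^sub>M M2)) = (\<integral>x. f x \<partial>M1) * (\<integral>y. h y \<partial>M2)"
proof -
  have "integrable (M1 \<Otimes>\<^sub>M M2) (\<lambda>(x, y). f x * h y)"
    using assms(3,4) by (intro integrable_const_bound[where B = 1])
      (auto simp: norm_mult case_prod_beta intro!: AE_I2 mult_le_one)
  from integral_fst[OF this] show ?thesis unfolding case_prod_unfold by simp
qed

locale gaussian_pair = prob_space N
  for N :: "'v measure" +
  fixes cmb :: "real \<Rightarrow> real \<Rightarrow> 'v \<Rightarrow> 'v \<Rightarrow> 'v"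
    and b :: "'v \<Rightarrow> 'v \<Rightarrow> real" and l :: "'s::real_inner \<Rightarrow> 'v \<Rightarrow> real"
  assumes cmb_measurable: "(\<lambda>(x, y). (cmb c d x y, cmb (- d) c x y)) \<in> N \<Otimes>\<^sub>M N \<rightarrow>\<^sub>M N \<Otimes>\<^sub>M N"
    and cmb_inv: "c > 0 \<Longrightarrow> c\<^sup>2 + d\<^sup>2 = 1 \<Longrightarrow>
      distr (N \<Otimes>\<^sub>M N) (N \<Otimes>\<^sub>M N) (\<lambda>(x, y). (cmb c d x y, cmb (- d) c x y)) = N \<Otimes>\<^sub>M N"
    and b_measurable [measurable]: "(\<lambda>(x, y). b x y) \<in> borel_measurable (N \<Otimes>\<^sub>M N)"
    and l_measurable [measurable]: "l s \<in> borel_measurable N"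
    and b_sym: "b x y = b y x"
    and b_linear: "b (cmb c d x y) z = c * b x z + d * b y z"
    and l_linear: "l s (cmb c d x y) = c * l s x + d * l s y"
    and l_add: "l (s + t) x = l s x + l t x"
    and l_scaleR: "l (r *\<^sub>R s) x = r * l s x"
begin

sublocale pair_prob_space N N ..

text \<open>The function psi of the overview. The factor 1/2 is the one produced when a rotation by
  45 degrees diagonalises \<open>b\<close>.\<close>

definition half_char :: "'s \<Rightarrow> complex" where
  "half_char s = (\<integral>x. cis (b x x / 2 + l s x) \<partial>N)"

definition pair_char :: "'s \<Rightarrow> 's \<Rightarrow> complex" where
  "pair_char s t = (\<integral>z. cis (b (fst z) (snd z) + l s (fst z) + l t (snd z)) \<partial>(N \<Otimes>\<^sub>M N))"

lemma b_linear2: "b z (cmb c d x y) = c * b z x + d * b z y"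
  by (simp add: b_sym[of z] b_linear)

lemma b_diag_measurable [measurable]: "(\<lambda>x. b x x) \<in> borel_measurable N"
  using measurable_compose[OF _ b_measurable, of "\<lambda>x. (x, x)" N] by simp

lemma l_diff: "l (s - t) x = l s x - l t x"
  using l_add[of s "- t"] l_scaleR[of "-1" t] by simp

lemma integral_rot:
  fixes h :: "'v \<times> 'v \<Rightarrow> complex"
  assumes "c > 0" "c\<^sup>2 + d\<^sup>2 = 1" and [measurable]: "h \<in> borel_measurable (N \<Otimes>\<^sub>M N)"
  shows "(\<integral>z. h z \<partial>(N \<Otimes>\<^sub>M N))
    = (\<integral>z. h (cmb c d (fst z) (snd z), cmb (- d) c (fst z) (snd z)) \<partial>(N \<Otimes>\<^sub>M N))"
proof -
  have "(\<integral>z. h z \<partial>(N \<Otimes>\<^sub>M N))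
    = (\<integral>z. h z \<partial>distr (N \<Otimes>\<^sub>M N) (N \<Otimes>\<^sub>M N) (\<lambda>(x, y). (cmb c d x y, cmb (- d) c x y)))"
    by (simp only: cmb_inv[OF assms(1,2)])
  also have "\<dots> = (\<integral>z. h (cmb c d (fst z) (snd z), cmb (- d) c (fst z) (snd z)) \<partial>(N \<Otimes>\<^sub>M N))"
    by (subst integral_distr) (auto simp: cmb_measurable case_prod_beta)
  finally show ?thesis .
qed

text \<open>The product is one integral over the pair of columns whose quadratic part
  \<open>b x x + b y y\<close> is invariant under rotation. Rotating the columns therefore only
  moves the linear part, that is, it rotates \<open>(s, t)\<close>.\<close>

lemma half_char_rot:
  assumes "c > 0" "c\<^sup>2 + d\<^sup>2 = 1"
  shows "half_char s * half_char t = half_char (c *\<^sub>R s - d *\<^sub>R t) * half_char (d *\<^sub>R s + c *\<^sub>R t)"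
proof -
  have prod: "half_char u * half_char v
    = (\<integral>z. cis ((b (fst z) (fst z) + b (snd z) (snd z)) / 2 + l u (fst z) + l v (snd z)) \<partial>(N \<Otimes>\<^sub>M N))" for u v
    unfolding half_char_def
    by (subst integral_mult_prod[symmetric]) (auto simp: cis_mult add_divide_distrib ac_simps)
  have q: "(c * (c * x) + d * (d * x)) = x" for x
    using assms(2) by (simp flip: mult.assoc distrib_right power2_eq_square)
  have diag: "b (cmb c d x y) (cmb c d x y) + b (cmb (- d) c x y) (cmb (- d) c x y) = b x x + b y y" for x y
  proof -
    have "b (cmb c d x y) (cmb c d x y) + b (cmb (- d) c x y) (cmb (- d) c x y)
        = (c\<^sup>2 + d\<^sup>2) * (b x x + b y y)"
      by (simp add: b_linear b_linear2 b_sym[of y x] algebra_simps power2_eq_square)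
    thus ?thesis by (simp add: assms(2))
  qed
  show ?thesis
    unfolding prod
    by (subst integral_rot[OF assms])
       (auto simp: diag l_linear l_add l_diff l_scaleR algebra_simps)
qed

text \<open>Under the rotation by 45 degrees \<open>b x y\<close> becomes (\<open>b y y\<close> -
  \<open>b x x\<close>) / 2, so the two columns decouple. The minus sign turns the factor belonging
  to \<open>x\<close> into a complex conjugate, with \<open>t - s\<close> in place of
  \<open>s - t\<close>.\<close>

lemma pair_char_eq:
  "pair_char s t = half_char ((1 / sqrt 2) *\<^sub>R (s + t)) * cnj (half_char ((1 / sqrt 2) *\<^sub>R (t - s)))"
proof -
  define c :: real where "c = 1 / sqrt 2"
  have c: "c > 0" "c\<^sup>2 + c\<^sup>2 = 1" and cc: "c * c = 1 / 2"
    by (auto simp: c_def power_divide)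
  have cc': "c * (c * x) = x / 2" for x
    by (simp add: cc flip: mult.assoc)
  have b: "b (cmb c c x y) (cmb (- c) c x y) = b y y / 2 - b x x / 2" for x y
    by (simp add: b_linear b_linear2 b_sym[of y x] algebra_simps cc')
  have "pair_char s t = (\<integral>z. cnj (cis (b (fst z) (fst z) / 2 + l (c *\<^sub>R (t - s)) (fst z)))
      * cis (b (snd z) (snd z) / 2 + l (c *\<^sub>R (s + t)) (snd z)) \<partial>(N \<Otimes>\<^sub>M N))"
    unfolding pair_char_def
    by (subst integral_rot[OF c])
       (auto simp: b l_linear l_add l_diff l_scaleR cis_cnj cis_mult algebra_simps)
  also have "\<dots> = (\<integral>x. cnj (cis (b x x / 2 + l (c *\<^sub>R (t - s)) x)) \<partial>N) * half_char (c *\<^sub>R (s + t))"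
    unfolding half_char_def by (rule integral_mult_prod) (auto simp: cis_cnj)
  finally show ?thesis
    by (simp add: half_char_def c_def)
qed

text \<open>Rotation by a right angle, as the square of the rotation by 45 degrees.\<close>

lemma half_char_minus: "half_char (- t) = half_char t"
proof -
  define c :: real where "c = 1 / sqrt 2"
  have c: "c > 0" "c\<^sup>2 + c\<^sup>2 = 1" and cc: "c * c = 1 / 2"
    by (auto simp: c_def power_divide)
  have quarter: "half_char s * half_char t = half_char (- t) * half_char s" for s t
  proof -
    have "c *\<^sub>R (c *\<^sub>R s - c *\<^sub>R t) - c *\<^sub>R (c *\<^sub>R s + c *\<^sub>R t) = - t"
      and "c *\<^sub>R (c *\<^sub>R s - c *\<^sub>R t) + c *\<^sub>R (c *\<^sub>R s + c *\<^sub>R t) = s"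
      by (simp_all add: algebra_simps cc flip: scaleR_add_left)
    thus ?thesis
      using half_char_rot[OF c, of s t] half_char_rot[OF c, of "c *\<^sub>R s - c *\<^sub>R t" "c *\<^sub>R s + c *\<^sub>R t"]
      by simp
  qed
  \<comment> \<open>The first instance can be cancelled unless \<open>half_char t\<close> is 0; in
    that case the second instance says that the square of \<open>half_char (- t)\<close> is
    0.\<close>
  show ?thesis
    using quarter[of t t] quarter[of "- t" t] by (auto simp: mult.commute)
qed

text \<open>For t = 0 the two factors have opposite arguments, so evenness of
  \<open>half_char\<close> makes the product a squared modulus. This positivity is what survives
  averaging over the other columns.\<close>

lemma pair_char_zero: "pair_char s 0 = of_real ((norm (half_char ((1 / sqrt 2) *\<^sub>R s)))\<^sup>2)"
  by (simp add: pair_char_eq half_char_minus complex_norm_square del: of_real_power)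

text \<open>Rotate the product of the two factors, apply AM-GM, and read each squared modulus as a
  \<open>pair_char\<close> with second entry 0. The bound uses real parts because, unlike moduli,
  they commute with the later integration.\<close>

lemma norm_pair_char_le:
  assumes "c > 0" "c\<^sup>2 + d\<^sup>2 = 1"
  shows "norm (pair_char s t) \<le> (Re (pair_char (c *\<^sub>R (s + t) - d *\<^sub>R (t - s)) 0)
      + Re (pair_char (d *\<^sub>R (s + t) + c *\<^sub>R (t - s)) 0)) / 2"
proof -
  define r where "r = 1 / sqrt (2::real)"
  define u v where "u = half_char (r *\<^sub>R (c *\<^sub>R (s + t) - d *\<^sub>R (t - s)))"
    and "v = half_char (r *\<^sub>R (d *\<^sub>R (s + t) + c *\<^sub>R (t - s)))"
  have "norm (pair_char s t) = norm (half_char (r *\<^sub>R (s + t)) * half_char (r *\<^sub>R (t - s)))"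
    by (simp add: pair_char_eq norm_mult r_def)
  also have "half_char (r *\<^sub>R (s + t)) * half_char (r *\<^sub>R (t - s)) = u * v"
    by (subst half_char_rot[OF assms]) (simp add: u_def v_def algebra_simps)
  also have "norm (u * v) \<le> ((norm u)\<^sup>2 + (norm v)\<^sup>2) / 2"
    using sum_squares_bound[of "norm u" "norm v"] by (simp add: norm_mult)
  finally show ?thesis
    by (simp add: pair_char_zero u_def v_def r_def)
qed

end

text \<open>Every rotation of (s+t, t-s) keeps the total squared norm 2(|s|^2 + |t|^2). The
  difference of the two squared norms is P cos \<phi> - Q sin \<phi> in the doubled angle \<phi>, so
  a zero of this expression gives equal norms.\<close>

lemma rotation_to_equal_norms:
  fixes s t :: "'a::real_inner"
  obtains c d :: real where "c > 0" "c\<^sup>2 + d\<^sup>2 = 1"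
    "norm (c *\<^sub>R (s + t) - d *\<^sub>R (t - s)) = sqrt ((norm s)\<^sup>2 + (norm t)\<^sup>2)"
    "norm (d *\<^sub>R (s + t) + c *\<^sub>R (t - s)) = sqrt ((norm s)\<^sup>2 + (norm t)\<^sup>2)"
proof -
  define P Q where "P = 4 * (s \<bullet> t)" and "Q = 2 * (t \<bullet> t - s \<bullet> s)"
  \<comment> \<open>Restricting \<phi> to (-pi/2, pi/2] keeps the half angle within pi/4 of 0, so
    its cosine is positive as the rotation lemmas require.\<close>
  obtain \<phi> where \<phi>: "- pi / 2 < \<phi>" "\<phi> \<le> pi / 2" "P * cos \<phi> = Q * sin \<phi>"
  proof (cases "Q = 0")
    case True
    thus ?thesis by (intro that[of "pi / 2"]) auto
  next
    case False
    have "P * cos (arctan (P / Q)) = Q * sin (arctan (P / Q))"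
      using False by (simp add: cos_arctan sin_arctan)
    thus ?thesis using arctan_lbound arctan_ubound by (intro that[of "arctan (P / Q)"]) (auto simp: less_imp_le)
  qed
  define c d where "c = cos (\<phi> / 2)" and "d = sin (\<phi> / 2)"
  have "c > 0" unfolding c_def using \<phi> by (intro cos_gt_zero_pi) (use pi_gt_zero in linarith)+
  have cd: "c\<^sup>2 + d\<^sup>2 = 1" by (simp add: c_def d_def)
  have dbl: "cos \<phi> = c\<^sup>2 - d\<^sup>2" "sin \<phi> = 2 * d * c"
    using cos_double[of "\<phi> / 2"] sin_double[of "\<phi> / 2"] by (simp_all add: c_def d_def)
  let ?u = "c *\<^sub>R (s + t) - d *\<^sub>R (t - s)" and ?v = "d *\<^sub>R (s + t) + c *\<^sub>R (t - s)"
  have "?u \<bullet> ?u - ?v \<bullet> ?v = (c\<^sup>2 - d\<^sup>2) * P - 2 * d * c * Q"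
    by (simp add: P_def Q_def algebra_simps inner_commute[of t s] power2_eq_square)
  also have "\<dots> = 0" using \<phi>(3) by (simp add: dbl algebra_simps)
  finally have 1: "?u \<bullet> ?u = ?v \<bullet> ?v" by simp
  have "?u \<bullet> ?u + ?v \<bullet> ?v = (c\<^sup>2 + d\<^sup>2) * (2 * (s \<bullet> s + t \<bullet> t))"
    by (simp add: algebra_simps inner_commute[of t s] power2_eq_square)
  hence "?u \<bullet> ?u + ?v \<bullet> ?v = 2 * (s \<bullet> s + t \<bullet> t)" by (simp add: cd)
  moreover have "x = z \<and> y = z" if "x = y" "x + y = 2 * z" for x y z :: real
    using that by linarith
  ultimately have "?u \<bullet> ?u = s \<bullet> s + t \<bullet> t" "?v \<bullet> ?v = s \<bullet> s + t \<bullet> t" using 1 by blast+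
  hence "norm ?u = sqrt ((norm s)\<^sup>2 + (norm t)\<^sup>2)" "norm ?v = sqrt ((norm s)\<^sup>2 + (norm t)\<^sup>2)"
    unfolding power2_norm_eq_inner by (simp_all only: norm_eq_sqrt_inner)
  with \<open>c > 0\<close> cd show ?thesis by (rule that)
qed

section \<open>Gaussian matrices with a frozen last row\<close>

lemma prob_space_column: "prob_space (PiM I (\<lambda>_. kgauss :: 'k::euclidean_space measure))"
  by (intro prob_space_PiM prob_space_kgauss)

text \<open>Matrices are stored by columns: \<open>A j i\<close> is the entry in row \<open>i\<close> and column \<open>j\<close>.\<close>

definition gmat :: "nat \<Rightarrow> 'c set \<Rightarrow> ('c \<Rightarrow> nat \<Rightarrow> 'k::euclidean_space) measure" where
  "gmat m C = PiM C (\<lambda>_. PiM {..<m} (\<lambda>_. kgauss))"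

lemma prob_space_gmat: "prob_space (gmat m C)"
  unfolding gmat_def by (intro prob_space_PiM prob_space_column)

lemma gmat_entry_measurable:
  assumes "j \<in> C" "i < m"
  shows "(\<lambda>A. A j i) \<in> borel_measurable (gmat m C)"
proof -
  have "(\<lambda>A. A j i) \<in> gmat m C \<rightarrow>\<^sub>M kgauss"
    unfolding gmat_def
    by (rule measurable_compose[OF measurable_component_singleton[of j C] measurable_component_singleton])
       (use assms in auto)
  thus ?thesis by (simp only: measurable_cong_sets[OF refl sets_kgauss])
qed

definition chf :: "nat \<Rightarrow> 'c set \<Rightarrow> 'k::{real_normed_div_algebra, euclidean_space} \<Rightarrow> complex" where
  "chf m C \<tau> = (\<integral>A. cis (\<tau> \<bullet> rperm m C A) \<partial>gmat m C)"

text \<open>The conditional characteristic function of the permanent of \<open>m + 1\<close> rows,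
  given that its last row is \<open>g\<close>.\<close>

definition row_char ::
  "nat \<Rightarrow> 'c set \<Rightarrow> 'k::{real_normed_div_algebra, euclidean_space} \<Rightarrow> ('c \<Rightarrow> 'k) \<Rightarrow> complex" where
  "row_char m C \<tau> g = (\<integral>A. cis (\<tau> \<bullet> (\<Sum>j\<in>C. rperm m (C - {j}) A * g j)) \<partial>gmat m C)"

text \<open>Right multiplication by \<open>s\<close> scales all norms by |s|, hence so does its
  adjoint; the two inequalities are Cauchy-Schwarz tested on \<open>\<sigma>\<close> and on
  \<open>\<tau> * inverse s\<close>. This absorbs an entry of the last row into the frequency, with
  exact control of the modulus.\<close>

lemma inner_mult_right_adjoint:
  fixes s \<tau> :: "'k::{real_normed_div_algebra, euclidean_space}"
  obtains \<sigma> where "norm \<sigma> = norm \<tau> * norm s" "\<And>x. \<tau> \<bullet> (x * s) = \<sigma> \<bullet> x"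
proof (cases "s = 0")
  case True
  thus ?thesis by (intro that[of 0]) auto
next
  case False
  define \<sigma> where "\<sigma> = adjoint (\<lambda>x. x * s) \<tau>"
  have lin: "linear (\<lambda>x. x * s)"
    by (simp add: linear_iff algebra_simps)
  have \<sigma>: "\<tau> \<bullet> (x * s) = \<sigma> \<bullet> x" for x
    using adjoint_works[OF lin, of x \<tau>] by (simp add: \<sigma>_def inner_commute)
  have "(norm \<sigma>)\<^sup>2 = \<tau> \<bullet> (\<sigma> * s)" by (simp add: \<sigma> power2_norm_eq_inner)
  also have "\<dots> \<le> norm \<tau> * norm (\<sigma> * s)" by (rule norm_cauchy_schwarz)
  also have "\<dots> = norm \<sigma> * (norm \<tau> * norm s)" by (simp add: norm_mult)
  finally have "norm \<sigma> \<le> norm \<tau> * norm s"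
    by (cases "\<sigma> = 0") (auto simp: power2_eq_square)
  moreover have "norm \<tau> * norm s \<le> norm \<sigma>"
  proof -
    have "(norm \<tau>)\<^sup>2 = \<sigma> \<bullet> (\<tau> * inverse s)"
      using False by (simp add: \<sigma>[symmetric] power2_norm_eq_inner mult.assoc)
    also have "\<dots> \<le> norm \<sigma> * (norm \<tau> / norm s)"
      using norm_cauchy_schwarz[of \<sigma> "\<tau> * inverse s"]
      by (simp only: norm_mult norm_inverse divide_inverse)
    finally show ?thesis using False
      by (cases "\<tau> = 0") (auto simp: power2_eq_square field_simps)
  qed
  ultimately show ?thesis using \<sigma> by (intro that[of \<sigma>]) auto
qed

lemma integrable_bounded_1:
  fixes f :: "'a \<Rightarrow> complex"
  assumes "prob_space M" "f \<in> borel_measurable M" "\<And>x. norm (f x) \<le> 1"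
  shows "integrable M f"
proof -
  interpret prob_space M by fact
  show ?thesis using assms by (intro integrable_const_bound[where B = 1]) auto
qed

text \<open>The non-integrable case is included: there the Bochner integral is 0 by
  convention.\<close>

lemma norm_integral_le_1:
  fixes f :: "'a \<Rightarrow> complex"
  assumes "prob_space M" "\<And>x. norm (f x) \<le> 1"
  shows "norm (\<integral>x. f x \<partial>M) \<le> 1"
proof (cases "integrable M f")
  case True
  have "norm (\<integral>x. f x \<partial>M) \<le> (\<integral>x. norm (f x) \<partial>M)" by (rule integral_norm_bound)
  also have "\<dots> \<le> 1"
    using assms True by (intro prob_space.integral_le_const integrable_norm) auto
  finally show ?thesis .
qed (simp add: not_integrable_integral_eq)

text \<open>Only the cofactor of column \<open>j\<close> survives. It does not contain column
  \<open>j\<close>, which integrates out with mass 1, and what remains is a characteristic function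
  one size smaller.\<close>

lemma row_char_single:
  fixes \<tau> :: "'k::{real_normed_div_algebra, euclidean_space}" and g :: "'c \<Rightarrow> 'k"
  assumes "finite C" "j \<in> C" and g0: "\<And>i. i \<in> C - {j} \<Longrightarrow> g i = 0"
  obtains \<sigma> :: 'k where "norm \<sigma> = norm \<tau> * norm (g j)" "row_char m C \<tau> g = chf m (C - {j}) \<sigma>"
proof -
  obtain \<sigma> where \<sigma>: "norm \<sigma> = norm \<tau> * norm (g j)" "\<And>x. \<tau> \<bullet> (x * g j) = \<sigma> \<bullet> x"
    by (rule inner_mult_right_adjoint[of \<tau> "g j"]) blast
  define f where "f A = cis (\<tau> \<bullet> (\<Sum>i\<in>C. rperm m (C - {i}) A * g i))" for A
  have f: "f A = cis (\<sigma> \<bullet> rperm m (C - {j}) A)" for A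
    using assms by (simp add: f_def sum.remove[of C j] \<sigma>)
  let ?N = "PiM {..<m} (\<lambda>_. kgauss :: 'k measure)"
  interpret N: product_prob_space "\<lambda>_. ?N" C
    by (intro product_prob_spaceI prob_space_column)
  have meas: "(\<lambda>A. rperm m (C - {j}) A) \<in> borel_measurable (gmat m C :: ('c \<Rightarrow> nat \<Rightarrow> 'k) measure)"
    by (rule rperm_measurable) (auto intro: gmat_entry_measurable)
  have "integrable (gmat m C) f"
    unfolding f using meas by (intro integrable_bounded_1 prob_space_gmat) auto
  moreover have ins: "insert j (C - {j}) = C" using assms by auto
  ultimately have int: "integrable (PiM (insert j (C - {j})) (\<lambda>_. ?N)) f"
    by (simp add: gmat_def)
  have "row_char m C \<tau> g = integral\<^sup>L (PiM (insert j (C - {j})) (\<lambda>_. ?N)) f"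
    by (simp only: ins row_char_def f_def[symmetric] gmat_def)
  also have "\<dots> = (\<integral>x. (\<integral>y. f (x(j := y)) \<partial>?N) \<partial>PiM (C - {j}) (\<lambda>_. ?N))"
    using \<open>finite C\<close> by (intro N.product_integral_insert int) auto
  also have "\<dots> = (\<integral>x. f x \<partial>PiM (C - {j}) (\<lambda>_. ?N))"
    by (simp add: f rperm_fun_upd_notin prob_space.prob_space[OF prob_space_column] del: fun_upd_apply)
  also have "\<dots> = chf m (C - {j}) \<sigma>"
    by (simp add: f chf_def gmat_def)
  finally show ?thesis by (rule that[OF \<sigma>(1)])
qed

lemma gmat_split_pair:
  fixes f :: "('c \<Rightarrow> nat \<Rightarrow> 'k::euclidean_space) \<Rightarrow> complex"
  assumes "finite D" "p \<notin> D" "q \<notin> D" "p \<noteq> q"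
    and f: "f \<in> borel_measurable (gmat m (insert p (insert q D)))" "\<And>A. norm (f A) \<le> 1"
  defines "N \<equiv> PiM {..<m} (\<lambda>_. kgauss :: 'k measure)"
  shows "(\<lambda>(w, z). f (w(q := fst z, p := snd z))) \<in> borel_measurable (gmat m D \<Otimes>\<^sub>M (N \<Otimes>\<^sub>M N))"
    and "(\<integral>A. f A \<partial>gmat m (insert p (insert q D)))
      = (\<integral>w. (\<integral>z. f (w(q := fst z, p := snd z)) \<partial>(N \<Otimes>\<^sub>M N)) \<partial>gmat m D)"
proof -
  have pN: "prob_space N" by (simp add: N_def prob_space_column)
  interpret N: product_prob_space "\<lambda>_::'c. N" D
    by (intro product_prob_spaceI pN)
  interpret NN: pair_prob_space N N by (intro pair_prob_spaceI pN)
  have g: "gmat m E = PiM E (\<lambda>_. N)" for E :: "'c set" by (simp add: gmat_def N_def)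
  have upd: "(\<lambda>(w, z). w(q := fst z, p := snd z))
      \<in> PiM D (\<lambda>_. N) \<Otimes>\<^sub>M (N \<Otimes>\<^sub>M N) \<rightarrow>\<^sub>M PiM (insert p (insert q D)) (\<lambda>_. N)"
    unfolding case_prod_beta
    by (intro measurable_fun_upd[where J = "insert q D"] measurable_fun_upd[where J = D]) auto
  show meas: "(\<lambda>(w, z). f (w(q := fst z, p := snd z))) \<in> borel_measurable (gmat m D \<Otimes>\<^sub>M (N \<Otimes>\<^sub>M N))"
    using measurable_compose[OF upd f(1)[unfolded g]] by (simp add: g case_prod_beta)
  have int: "integrable (PiM (insert p (insert q D)) (\<lambda>_. N)) f"
    using f by (intro integrable_bounded_1 prob_space_PiM pN) (auto simp: g)
  have "(\<integral>A. f A \<partial>gmat m (insert p (insert q D)))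
      = (\<integral>w. (\<integral>y. f (w(p := y)) \<partial>N) \<partial>PiM (insert q D) (\<lambda>_. N))"
    unfolding g using assms by (intro N.product_integral_insert int) auto
  also have "\<dots> = (\<integral>w. (\<integral>x. (\<integral>y. f (w(q := x, p := y)) \<partial>N) \<partial>N) \<partial>PiM D (\<lambda>_. N))"
  proof (rule N.product_integral_insert)
    have upd': "(\<lambda>(w, y). w(p := y)) \<in> PiM (insert q D) (\<lambda>_. N) \<Otimes>\<^sub>M N \<rightarrow>\<^sub>M PiM (insert p (insert q D)) (\<lambda>_. N)"
      unfolding case_prod_beta by (intro measurable_fun_upd[where J = "insert q D"]) auto
    have "(\<lambda>(w, y). f (w(p := y))) \<in> borel_measurable (PiM (insert q D) (\<lambda>_. N) \<Otimes>\<^sub>M N)"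
      using measurable_compose[OF upd' f(1)[unfolded g]] by (simp add: case_prod_beta)
    thus "integrable (PiM (insert q D) (\<lambda>_. N)) (\<lambda>w. \<integral>y. f (w(p := y)) \<partial>N)"
      using f(2)
      by (intro integrable_bounded_1 prob_space_PiM pN sigma_finite_measure.borel_measurable_lebesgue_integral prob_space_imp_sigma_finite)
         (auto intro!: norm_integral_le_1 pN simp del: fun_upd_apply)
  qed (use assms in auto)
  also have "\<dots> = (\<integral>w. (\<integral>z. f (w(q := fst z, p := snd z)) \<partial>(N \<Otimes>\<^sub>M N)) \<partial>PiM D (\<lambda>_. N))"
  proof (rule Bochner_Integration.integral_cong[OF refl])
    fix w assume w: "w \<in> space (PiM D (\<lambda>_. N))"
    have "integrable (N \<Otimes>\<^sub>M N) (\<lambda>z. f (w(q := fst z, p := snd z)))"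
      using measurable_compose[OF measurable_Pair1'[OF w[folded g]] meas[unfolded g[symmetric]]] f(2)
      by (intro integrable_bounded_1) (auto intro: NN.prob_space_axioms)
    from NN.integral_fst'[OF this]
    show "(\<integral>x. (\<integral>y. f (w(q := x, p := y)) \<partial>N) \<partial>N) = (\<integral>z. f (w(q := fst z, p := snd z)) \<partial>(N \<Otimes>\<^sub>M N))"
      by simp
  qed
  finally show "(\<integral>A. f A \<partial>gmat m (insert p (insert q D)))
      = (\<integral>w. (\<integral>z. f (w(q := fst z, p := snd z)) \<partial>(N \<Otimes>\<^sub>M N)) \<partial>gmat m D)"
    by (simp only: g)
qed

text \<open>Conditionally on the columns other than \<open>p\<close> and \<open>q\<close>, the pair
  of columns is an instance of \<open>gaussian_pair\<close>, where \<open>norm_pair_char_le\<close>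
  applies. The replacements \<open>u\<close> and \<open>v\<close> do not depend on the condition, so
  integrating the bound yields the same kind of quantity again.\<close>

lemma row_char_pair:
  fixes \<tau> :: "'k::{real_normed_div_algebra, euclidean_space}" and g :: "'c \<Rightarrow> 'k"
  assumes "finite C" "card C = Suc m" "p \<in> C" "q \<in> C" "p \<noteq> q"
  obtains u v where "norm u = sqrt ((norm (g p))\<^sup>2 + (norm (g q))\<^sup>2)"
    "norm v = sqrt ((norm (g p))\<^sup>2 + (norm (g q))\<^sup>2)"
    "norm (row_char m C \<tau> g)
      \<le> (norm (row_char m C \<tau> (g(p := u, q := 0))) + norm (row_char m C \<tau> (g(p := v, q := 0)))) / 2"
proof -
  define D where "D = C - {p, q}"
  have D: "finite D" "p \<notin> D" "q \<notin> D" "C = insert p (insert q D)" "C - {p} = insert q D" "C - {q} = insert p D"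
    using assms by (auto simp: D_def)
  have card_D: "card (insert q D) = m" "card (insert p D) = m"
    and card_CD: "card (C - {j}) = m" if "j \<in> C" for j
    using assms that by (auto simp flip: D(5,6))
  define N where "N = PiM {..<m} (\<lambda>_::nat. kgauss :: 'k measure)"
  define cmb where "cmb c d x y = (\<lambda>i\<in>{..<m}. c *\<^sub>R x i + d *\<^sub>R y i)" for c d :: real and x y :: "nat \<Rightarrow> 'k"
  \<comment> \<open>A frozen entry at j in \<open>D\<close> leaves both columns in the cofactor,
    which gives the bilinear part. A frozen entry at \<open>p\<close> or \<open>q\<close> removes
    that column and leaves the other one, which gives the linear part; by column relabelling one
    \<open>l\<close> serves both cases.\<close>
  define b where "b w x y = \<tau> \<bullet> (\<Sum>j\<in>D. rperm m (C - {j}) (w(q := x, p := y)) * g j)" for w x y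
  define l where "l w s x = \<tau> \<bullet> (rperm m (insert q D) (w(q := x)) * s)" for w s x
  have pN: "prob_space N" by (simp add: N_def prob_space_column)
  have entry: "(\<lambda>z. fst z i) \<in> borel_measurable (N \<Otimes>\<^sub>M N)" "(\<lambda>z. snd z i) \<in> borel_measurable (N \<Otimes>\<^sub>M N)"
    "(\<lambda>x. x i) \<in> borel_measurable N" if "i < m" for i
  proof -
    have "(\<lambda>x. x i) \<in> N \<rightarrow>\<^sub>M kgauss"
      unfolding N_def using that by (intro measurable_component_singleton) auto
    thus 1: "(\<lambda>x. x i) \<in> borel_measurable N"
      by (simp only: measurable_cong_sets[OF refl sets_kgauss])
    show "(\<lambda>z. fst z i) \<in> borel_measurable (N \<Otimes>\<^sub>M N)" "(\<lambda>z. snd z i) \<in> borel_measurable (N \<Otimes>\<^sub>M N)"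
      using measurable_compose[OF measurable_fst 1] measurable_compose[OF measurable_snd 1] by auto
  qed
  have upd_entry: "(\<lambda>z. (w(q := fst z, p := snd z)) k i) \<in> borel_measurable (N \<Otimes>\<^sub>M N)"
    "(\<lambda>x. (w(q := x)) k i) \<in> borel_measurable N" if "i < m" for w k i
    using entry[OF that] by (cases "k = p"; cases "k = q"; simp)+
  have cmb_measurable: "(\<lambda>z. cmb c d (fst z) (snd z)) \<in> N \<Otimes>\<^sub>M N \<rightarrow>\<^sub>M N" for c d
  proof -
    have "(\<lambda>z. \<lambda>i\<in>{..<m}. c *\<^sub>R fst z i + d *\<^sub>R snd z i) \<in> N \<Otimes>\<^sub>M N \<rightarrow>\<^sub>M PiM {..<m} (\<lambda>_. kgauss)"
      using entry
      by (intro measurable_restrict, subst measurable_cong_sets[OF refl sets_kgauss])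
         (auto intro!: borel_measurable_add borel_measurable_scaleR)
    thus ?thesis by (simp add: cmb_def flip: N_def)
  qed
  have cmb_upd: "rperm m E (w(k := cmb c d x y)) = c *\<^sub>R rperm m E (w(k := x)) + d *\<^sub>R rperm m E (w(k := y))"
    if "finite E" "card E = m" "k \<in> E" for E w k c d x y
    using rperm_column_linear[OF that, of w c x d y]
    by (subst rperm_cong[of _ _ _ "w(k := (\<lambda>i. c *\<^sub>R x i + d *\<^sub>R y i))"]) (auto simp: cmb_def)
  have rperm_sym: "rperm m (C - {j}) (w(q := x, p := y)) = rperm m (C - {j}) (w(q := y, p := x))"
    if "j \<in> D" for j w x y
  proof -
    have "C - {j} = insert p (insert q (D - {j}))" using D that by auto
    thus ?thesis
      using rperm_swap(1)[of p q "D - {j}" m w x y] D \<open>p \<noteq> q\<close> by (simp add: fun_upd_twist[of q p])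
  qed
  have gp: "gaussian_pair N cmb (b w) (l w)" for w
  proof (intro gaussian_pair.intro pN gaussian_pair_axioms.intro)
    fix c d r :: real and x y z :: "nat \<Rightarrow> 'k" and s t :: 'k
    show "(\<lambda>(x, y). (cmb c d x y, cmb (- d) c x y)) \<in> N \<Otimes>\<^sub>M N \<rightarrow>\<^sub>M N \<Otimes>\<^sub>M N"
      unfolding case_prod_beta
      by (intro measurable_Pair cmb_measurable)
    show "distr (N \<Otimes>\<^sub>M N) (N \<Otimes>\<^sub>M N) (\<lambda>(x, y). (cmb c d x y, cmb (- d) c x y)) = N \<Otimes>\<^sub>M N"
      if "c > 0" "c\<^sup>2 + d\<^sup>2 = 1"
      using plane_rot_PiM[OF finite_lessThan[of m] prob_space_kgauss sets_kgauss kgauss_rot[OF that]]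
      by (simp add: N_def cmb_def)
    show "(\<lambda>(x, y). b w x y) \<in> borel_measurable (N \<Otimes>\<^sub>M N)"
      unfolding b_def case_prod_beta
      by (intro borel_measurable_inner borel_measurable_sum borel_measurable_times rperm_measurable
            borel_measurable_const) (rule upd_entry)
    show "l w s \<in> borel_measurable N"
      unfolding l_def[abs_def]
      by (intro borel_measurable_inner borel_measurable_times rperm_measurable borel_measurable_const)
         (rule upd_entry)
    show b_sym: "b w x y = b w y x" for x y
      by (auto simp: b_def rperm_sym simp del: fun_upd_apply intro!: sum.cong arg_cong[where f = "inner \<tau>"])
    have "b w z (cmb c d x y) = c * b w z x + d * b w z y"
    proof -
      have "(\<Sum>j\<in>D. rperm m (C - {j}) (w(q := z, p := cmb c d x y)) * g j)
        = (\<Sum>j\<in>D. c *\<^sub>R (rperm m (C - {j}) (w(q := z, p := x)) * g j)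
            + d *\<^sub>R (rperm m (C - {j}) (w(q := z, p := y)) * g j))"
        using D card_CD \<open>finite C\<close> by (intro sum.cong refl) (subst cmb_upd; auto simp: algebra_simps)
      thus ?thesis
        by (simp add: b_def sum.distrib inner_add_right flip: scaleR_sum_right)
    qed
    thus "b w (cmb c d x y) z = c * b w x z + d * b w y z"
      by (simp only: b_sym[of _ z])
    show "l w s (cmb c d x y) = c * l w s x + d * l w s y"
      unfolding l_def using D card_D
      by (subst cmb_upd) (auto simp: algebra_simps inner_add_right assms)
    show "l w (s + t) x = l w s x + l w t x" "l w (r *\<^sub>R s) x = r * l w s x"
      by (simp_all add: l_def algebra_simps inner_add_right)
  qed
  define F where "F w s t = gaussian_pair.pair_char N (b w) (l w) s t" for w s t
  have expand: "(\<lambda>w. F w s t) \<in> borel_measurable (gmat m D)" (is ?meas)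
    "row_char m C \<tau> (g(p := s, q := t)) = (\<integral>w. F w s t \<partial>gmat m D)" (is ?eq) for s t
  proof -
    define f where "f A = cis (\<tau> \<bullet> (\<Sum>j\<in>C. rperm m (C - {j}) A * (g(p := s, q := t)) j))" for A
    have fm: "f \<in> borel_measurable (gmat m (insert p (insert q D)))"
      unfolding f_def[abs_def] D(4)[symmetric]
      by (intro measurable_compose[OF _ cis_measurable] borel_measurable_inner borel_measurable_sum
        borel_measurable_times rperm_measurable borel_measurable_const) (auto intro: gmat_entry_measurable)
    \<comment> \<open>The entries cross over: \<open>s\<close>, at position \<open>p\<close>,
      multiplies the cofactor without column \<open>p\<close>, so it is attached to
      \<open>x\<close>, the content of column \<open>q\<close>; likewise \<open>t\<close> goes with
      \<open>y\<close>.\<close>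
    have f_upd: "f (w(q := x, p := y)) = cis (b w x y + l w s x + l w t y)" for w x y
    proof -
      have "(\<Sum>j\<in>C. rperm m (C - {j}) (w(q := x, p := y)) * (g(p := s, q := t)) j)
          = rperm m (insert q D) (w(q := x)) * s + (rperm m (insert p D) (w(p := y)) * t
            + (\<Sum>j\<in>D. rperm m (C - {j}) (w(q := x, p := y)) * g j))"
      proof -
        have "rperm m (insert q D) (w(q := x, p := y)) = rperm m (insert q D) (w(q := x))"
          using D \<open>p \<noteq> q\<close> by (intro rperm_cong) auto
        moreover have "rperm m (insert p D) (w(q := x, p := y)) = rperm m (insert p D) (w(p := y))"
          using D \<open>p \<noteq> q\<close> by (intro rperm_cong) auto
        moreover have "(\<Sum>j\<in>D. rperm m (C - {j}) (w(q := x, p := y)) * (g(p := s, q := t)) j)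
            = (\<Sum>j\<in>D. rperm m (C - {j}) (w(q := x, p := y)) * g j)"
          using D by (intro sum.cong refl) auto
        ultimately show ?thesis
          using D(1-3) \<open>p \<noteq> q\<close> by (subst (1) D(4)) (simp add: D(5,6) del: fun_upd_apply, simp)
      qed
      also have "rperm m (insert p D) (w(p := y)) = rperm m (insert q D) (w(q := y))"
        using D \<open>p \<noteq> q\<close> by (intro rperm_swap(2)) auto
      finally have eq: "(\<Sum>j\<in>C. rperm m (C - {j}) (w(q := x, p := y)) * (g(p := s, q := t)) j)
          = rperm m (insert q D) (w(q := x)) * s + (rperm m (insert q D) (w(q := y)) * t
            + (\<Sum>j\<in>D. rperm m (C - {j}) (w(q := x, p := y)) * g j))" .
      show ?thesis
        unfolding f_def b_def l_def eq by (simp only: inner_add_right add_ac)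
    qed
    have F: "F w s t = (\<integral>z. f (w(q := fst z, p := snd z)) \<partial>(N \<Otimes>\<^sub>M N))" for w
      unfolding F_def gaussian_pair.pair_char_def[OF gp] f_upd ..
    note split = gmat_split_pair[OF D(1-3) \<open>p \<noteq> q\<close> fm, folded N_def]
    interpret NN: pair_prob_space N N by (intro pair_prob_spaceI pN)
    show ?meas
      unfolding F by (rule NN.borel_measurable_lebesgue_integral) (rule split(1), simp add: f_def)
    show ?eq
      unfolding F by (subst split(2)[symmetric]) (simp_all add: f_def[abs_def] row_char_def D(4)[symmetric])
  qed
  \<comment> \<open>The rotation is fixed here, before the remaining columns \<open>w\<close> enter;
    only \<open>g p\<close> and \<open>g q\<close> determine it.\<close>
  obtain c d where cd: "c > 0" "c\<^sup>2 + d\<^sup>2 = 1"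
    and norms: "norm (c *\<^sub>R (g p + g q) - d *\<^sub>R (g q - g p)) = sqrt ((norm (g p))\<^sup>2 + (norm (g q))\<^sup>2)"
      "norm (d *\<^sub>R (g p + g q) + c *\<^sub>R (g q - g p)) = sqrt ((norm (g p))\<^sup>2 + (norm (g q))\<^sup>2)"
    by (rule rotation_to_equal_norms)
  define u v where "u = c *\<^sub>R (g p + g q) - d *\<^sub>R (g q - g p)" and "v = d *\<^sub>R (g p + g q) + c *\<^sub>R (g q - g p)"
  have F1: "norm (F w s t) \<le> 1" for w s t
  proof -
    interpret NN: pair_prob_space N N by (intro pair_prob_spaceI pN)
    show ?thesis
      unfolding F_def gaussian_pair.pair_char_def[OF gp]
      by (intro norm_integral_le_1 NN.prob_space_axioms) simp
  qed
  have int: "integrable (gmat m D) (\<lambda>w. F w s t)" for s t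
    by (intro integrable_bounded_1 prob_space_gmat expand(1) F1)
  have "norm (row_char m C \<tau> g) = norm (\<integral>w. F w (g p) (g q) \<partial>gmat m D)"
    by (simp flip: expand(2))
  also have "\<dots> \<le> (\<integral>w. norm (F w (g p) (g q)) \<partial>gmat m D)"
    by (rule integral_norm_bound)
  also have "\<dots> \<le> (\<integral>w. (Re (F w u 0) + Re (F w v 0)) / 2 \<partial>gmat m D)"
    using int gaussian_pair.norm_pair_char_le[OF gp cd]
    by (intro integral_mono) (auto simp: F_def u_def v_def)
  also have "\<dots> = (Re (\<integral>w. F w u 0 \<partial>gmat m D) + Re (\<integral>w. F w v 0 \<partial>gmat m D)) / 2"
    using int by simp
  \<comment> \<open>Both integrands are real and nonnegative by \<open>pair_char_zero\<close>, so
    passing from real parts back to moduli costs nothing.\<close>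
  also have "\<dots> \<le> (norm (\<integral>w. F w u 0 \<partial>gmat m D) + norm (\<integral>w. F w v 0 \<partial>gmat m D)) / 2"
    by (intro divide_right_mono add_mono complex_Re_le_cmod) auto
  finally show ?thesis
    using norms by (intro that[of u v]) (simp_all add: expand(2) u_def v_def del: fun_upd_apply)
qed

lemma sqrt_sum_sq_collapse:
  assumes "finite C" "p \<in> C" "q \<in> C" "p \<noteq> q" "norm u = sqrt ((norm (g p))\<^sup>2 + (norm (g q))\<^sup>2)"
  shows "(\<Sum>j\<in>C. (norm ((g(p := u, q := 0)) j))\<^sup>2) = (\<Sum>j\<in>C. (norm (g j :: 'k::real_normed_vector))\<^sup>2)"
proof -
  have "(\<Sum>j\<in>C - {p} - {q}. (norm ((g(p := u, q := 0)) j))\<^sup>2) = (\<Sum>j\<in>C - {p} - {q}. (norm (g j))\<^sup>2)"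
    by (intro sum.cong) auto
  thus ?thesis
    using assms by (simp add: sum.remove[of C p] sum.remove[of "C - {p}" q])
qed

text \<open>Each merge of two nonzero entries preserves the Euclidean norm of the row exactly and
  shortens its support, so the induction ends at a row with at most one nonzero entry. As the norm
  never changes, \<open>\<Psi>\<close> may be an arbitrary function of the modulus.\<close>

lemma norm_row_char_le:
  fixes \<tau> :: "'k::{real_normed_div_algebra, euclidean_space}" and g :: "'c \<Rightarrow> 'k" and \<Psi> :: "real \<Rightarrow> ennreal"
  assumes "finite C" "card C = Suc m"
    and chf: "\<And>j (\<sigma> :: 'k). j \<in> C \<Longrightarrow> ennreal (norm (chf m (C - {j}) \<sigma>)) \<le> \<Psi> (norm \<sigma>)"
  shows "ennreal (norm (row_char m C \<tau> g)) \<le> \<Psi> (norm \<tau> * sqrt (\<Sum>j\<in>C. (norm (g j))\<^sup>2))"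
proof (induction "card {j \<in> C. g j \<noteq> 0}" arbitrary: g rule: less_induct)
  case less
  show ?case
  proof (cases "\<exists>p\<in>C. \<exists>q\<in>C. p \<noteq> q \<and> g p \<noteq> 0 \<and> g q \<noteq> 0")
    case True
    then obtain p q where pq: "p \<in> C" "q \<in> C" "p \<noteq> q" "g p \<noteq> 0" "g q \<noteq> 0" by blast
    obtain u v where uv: "norm u = sqrt ((norm (g p))\<^sup>2 + (norm (g q))\<^sup>2)"
      "norm v = sqrt ((norm (g p))\<^sup>2 + (norm (g q))\<^sup>2)"
      "norm (row_char m C \<tau> g)
        \<le> (norm (row_char m C \<tau> (g(p := u, q := 0))) + norm (row_char m C \<tau> (g(p := v, q := 0)))) / 2"
      by (rule row_char_pair[OF assms(1,2) pq(1-3), of g \<tau>])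
    have IH: "ennreal (norm (row_char m C \<tau> (g(p := w, q := 0))))
        \<le> \<Psi> (norm \<tau> * sqrt (\<Sum>j\<in>C. (norm (g j))\<^sup>2))"
      if "norm w = sqrt ((norm (g p))\<^sup>2 + (norm (g q))\<^sup>2)" for w
    proof -
      have "{j \<in> C. (g(p := w, q := 0)) j \<noteq> 0} \<subset> {j \<in> C. g j \<noteq> 0}"
        using pq by auto
      hence "card {j \<in> C. (g(p := w, q := 0)) j \<noteq> 0} < card {j \<in> C. g j \<noteq> 0}"
        using \<open>finite C\<close> by (intro psubset_card_mono) auto
      from less[OF this] show ?thesis
        by (simp only: sqrt_sum_sq_collapse[OF \<open>finite C\<close> pq(1-3) that])
    qed
    \<comment> \<open>The average of the two terms is at most the larger one, and both satisfy the
      same bound by induction.\<close>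
    have "norm (row_char m C \<tau> g)
        \<le> max (norm (row_char m C \<tau> (g(p := u, q := 0)))) (norm (row_char m C \<tau> (g(p := v, q := 0))))"
    proof -
      have "x \<le> max a b" if "x \<le> (a + b) / 2" for x a b :: real
        using that by (auto simp: max_def)
      thus ?thesis using uv(3) by blast
    qed
    thus ?thesis
      using IH[OF uv(1)] IH[OF uv(2)]
      by (auto simp: le_max_iff_disj simp del: fun_upd_apply intro: order.trans[OF ennreal_leI])
  next
    case False
    have "C \<noteq> {}" using \<open>card C = Suc m\<close> by auto
    \<comment> \<open>The zero row is covered as well: then any column may play the part of
      \<open>j\<close>.\<close>
    with False obtain j where j: "j \<in> C" "\<And>i. i \<in> C - {j} \<Longrightarrow> g i = 0" by blast
    obtain \<sigma> :: 'k where \<sigma>: "norm \<sigma> = norm \<tau> * norm (g j)" "row_char m C \<tau> g = chf m (C - {j}) \<sigma>"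
      by (rule row_char_single[OF \<open>finite C\<close> j, where \<tau> = \<tau> and m = m])
    have "(\<Sum>i\<in>C. (norm (g i))\<^sup>2) = (norm (g j))\<^sup>2"
      using \<open>finite C\<close> j by (simp add: sum.remove[of C j])
    thus ?thesis using chf[OF j(1), of \<sigma>] by (simp add: \<sigma>)
  qed
qed

section \<open>Revealing the last row\<close>

lemma gmat_Suc:
  assumes "finite C"
  shows "(\<lambda>(g, A). \<lambda>j\<in>C. (A j)(m := g j))
      \<in> PiM C (\<lambda>_. kgauss) \<Otimes>\<^sub>M gmat m C \<rightarrow>\<^sub>M (gmat (Suc m) C :: ('c \<Rightarrow> nat \<Rightarrow> 'k::euclidean_space) measure)"
      (is ?meas)
    and "gmat (Suc m) C = distr (PiM C (\<lambda>_. kgauss) \<Otimes>\<^sub>M gmat m C)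
      (gmat (Suc m) C :: ('c \<Rightarrow> nat \<Rightarrow> 'k) measure) (\<lambda>(g, A). \<lambda>j\<in>C. (A j)(m := g j))" (is ?eq)
proof -
  let ?G = "kgauss :: 'k measure"
  let ?N = "PiM {..<m} (\<lambda>_. ?G)" and ?N' = "PiM {..<Suc m} (\<lambda>_. ?G)"
  let ?Z = "\<lambda>(g, A). \<lambda>j\<in>C. (g j, A j)" and ?U = "\<lambda>(a, x). x(m := a)"
  interpret GN: pair_prob_space ?G ?N by (intro pair_prob_spaceI prob_space_kgauss prob_space_column)
  have U: "?U \<in> ?G \<Otimes>\<^sub>M ?N \<rightarrow>\<^sub>M ?N'"
    unfolding case_prod_beta lessThan_Suc
    by (intro measurable_fun_upd[where J = "{..<m}"]) auto
  have N': "distr (?G \<Otimes>\<^sub>M ?N) ?N' ?U = ?N'"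
    unfolding lessThan_Suc by (rule distr_pair_PiM_eq_PiM) (auto intro: prob_space_kgauss)
  have Z: "?Z \<in> PiM C (\<lambda>_. ?G) \<Otimes>\<^sub>M PiM C (\<lambda>_. ?N) \<rightarrow>\<^sub>M PiM C (\<lambda>_. ?G \<Otimes>\<^sub>M ?N)"
    by measurable
  have U': "compose C ?U \<in> PiM C (\<lambda>_. ?G \<Otimes>\<^sub>M ?N) \<rightarrow>\<^sub>M PiM C (\<lambda>_. ?N')"
    unfolding compose_def
    by (intro measurable_restrict measurable_compose[OF _ U] measurable_component_singleton)
  have UZ: "compose C ?U (\<lambda>j\<in>C. (g j, A j)) = (\<lambda>j\<in>C. (A j)(m := g j))" for g A
    by (auto simp: compose_def fun_eq_iff)
  have UZ': "compose C ?U \<circ> ?Z = (\<lambda>(g, A). \<lambda>j\<in>C. (A j)(m := g j))"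
    by (simp only: o_def case_prod_unfold UZ[unfolded case_prod_unfold])
  show ?meas
    unfolding gmat_def UZ'[symmetric] using Z U' by (rule measurable_comp)
  have "gmat (Suc m) C = PiM C (\<lambda>_. distr (?G \<Otimes>\<^sub>M ?N) ?N' ?U)"
    by (simp only: N' gmat_def)
  also have "\<dots> = distr (PiM C (\<lambda>_. ?G \<Otimes>\<^sub>M ?N)) (PiM C (\<lambda>_. ?N')) (compose C ?U)"
    using \<open>finite C\<close> U
    by (intro distr_PiM_finite_prob_space'[symmetric] GN.prob_space_axioms prob_space_column)
  also have "PiM C (\<lambda>_. ?G \<Otimes>\<^sub>M ?N)
      = distr (PiM C (\<lambda>_. ?G) \<Otimes>\<^sub>M PiM C (\<lambda>_. ?N)) (PiM C (\<lambda>_. ?G \<Otimes>\<^sub>M ?N)) ?Z"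
    by (intro distr_PiM_zip[symmetric] prob_space_kgauss prob_space_column) fact
  also have "distr \<dots> (PiM C (\<lambda>_. ?N')) (compose C ?U)
      = distr (PiM C (\<lambda>_. ?G) \<Otimes>\<^sub>M PiM C (\<lambda>_. ?N)) (PiM C (\<lambda>_. ?N')) (compose C ?U \<circ> ?Z)"
    by (rule distr_distr[OF U' Z])
  finally show ?eq by (simp only: UZ' gmat_def)
qed

lemma rperm_Suc_split:
  "rperm (Suc m) C (\<lambda>j\<in>C. (A j)(m := g j)) = (\<Sum>j\<in>C. rperm m (C - {j}) A * g j)"
proof -
  have "rperm m (C - {j}) (\<lambda>j\<in>C. (A j)(m := g j)) = rperm m (C - {j}) A" for j
    by (rule rperm_cong) auto
  thus ?thesis by (auto intro!: sum.cong)
qed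

text \<open>One step of the recursion: average the conditional characteristic function over the last
  row, move the modulus inside, and insert the collapsed bound. Values of \<open>\<Psi>\<close> in
  the extended reals admit an infinite bound at frequency 0.\<close>

lemma norm_chf_Suc_le:
  fixes \<tau> :: "'k::{real_normed_div_algebra, euclidean_space}" and \<Psi> :: "real \<Rightarrow> ennreal"
  assumes "finite C" "card C = Suc m"
    and chf: "\<And>j (\<sigma> :: 'k). j \<in> C \<Longrightarrow> ennreal (norm (chf m (C - {j}) \<sigma>)) \<le> \<Psi> (norm \<sigma>)"
  shows "ennreal (norm (chf (Suc m) C \<tau>))
    \<le> (\<integral>\<^sup>+g. \<Psi> (norm \<tau> * sqrt (\<Sum>j\<in>C. (norm (g j))\<^sup>2)) \<partial>PiM C (\<lambda>_. kgauss :: 'k measure))"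
proof -
  let ?G = "PiM C (\<lambda>_. kgauss :: 'k measure)" and ?A = "gmat m C :: ('a \<Rightarrow> nat \<Rightarrow> 'k) measure"
  interpret GA: pair_prob_space ?G ?A by (intro pair_prob_spaceI prob_space_column prob_space_gmat)
  define f where "f A = cis (\<tau> \<bullet> rperm (Suc m) C A)" for A
  have f: "f \<in> borel_measurable (gmat (Suc m) C)"
    unfolding f_def[abs_def]
    by (intro measurable_compose[OF _ cis_measurable] borel_measurable_inner rperm_measurable
        borel_measurable_const gmat_entry_measurable)
  let ?h = "\<lambda>(g, A). f (\<lambda>j\<in>C. (A j)(m := g j))"
  have h: "?h \<in> borel_measurable (?G \<Otimes>\<^sub>M ?A)"
    using measurable_compose[OF gmat_Suc(1)[OF \<open>finite C\<close>] f] by (simp add: case_prod_beta)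
  have int: "integrable (?G \<Otimes>\<^sub>M ?A) ?h"
    by (intro integrable_bounded_1 GA.prob_space_axioms h) (auto simp: f_def)
  have "chf (Suc m) C \<tau> = (\<integral>A. f A \<partial>distr (?G \<Otimes>\<^sub>M ?A) (gmat (Suc m) C) (\<lambda>(g, A). \<lambda>j\<in>C. (A j)(m := g j)))"
    by (simp only: chf_def f_def gmat_Suc(2)[OF \<open>finite C\<close>, symmetric])
  also have "\<dots> = (\<integral>z. ?h z \<partial>(?G \<Otimes>\<^sub>M ?A))"
    by (subst integral_distr[OF gmat_Suc(1)[OF \<open>finite C\<close>] f]) (simp only: case_prod_unfold)
  also have "\<dots> = (\<integral>g. \<integral>A. f (\<lambda>j\<in>C. (A j)(m := g j)) \<partial>?A \<partial>?G)"
    using GA.integral_fst'[OF int] by simp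
  also have "\<dots> = (\<integral>g. row_char m C \<tau> g \<partial>?G)"
    by (simp only: f_def rperm_Suc_split row_char_def)
  finally have chf_eq: "chf (Suc m) C \<tau> = (\<integral>g. row_char m C \<tau> g \<partial>?G)" .
  have "integrable ?G (\<lambda>g. \<integral>A. f (\<lambda>j\<in>C. (A j)(m := g j)) \<partial>?A)"
    using GA.integrable_fst'[OF int] by simp
  hence "integrable ?G (\<lambda>g. row_char m C \<tau> g)"
    by (simp only: f_def rperm_Suc_split row_char_def)
  hence "ennreal (norm (chf (Suc m) C \<tau>)) \<le> (\<integral>\<^sup>+g. ennreal (norm (row_char m C \<tau> g)) \<partial>?G)"
    unfolding chf_eq by (rule integral_norm_bound_ennreal)
  also have "\<dots> \<le> (\<integral>\<^sup>+g. \<Psi> (norm \<tau> * sqrt (\<Sum>j\<in>C. (norm (g j))\<^sup>2)) \<partial>?G)"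
    by (intro nn_integral_mono norm_row_char_le assms)
  finally show ?thesis .
qed

section \<open>Decay of the characteristic function\<close>

lemma PiM_kgauss_laplace:
  assumes "finite C" "s \<ge> 0"
  shows "(\<integral>\<^sup>+g. ennreal (exp (- s * (\<Sum>j\<in>C. (norm (g j))\<^sup>2))) \<partial>PiM C (\<lambda>_. kgauss :: 'k::euclidean_space measure))
    = ennreal ((1 / sqrt (1 + 2 * s / real DIM('k))) ^ (DIM('k) * card C))"
proof -
  interpret product_prob_space "\<lambda>_. kgauss :: 'k measure" C
    by (intro product_prob_spaceI prob_space_kgauss)
  have "(\<integral>\<^sup>+g. ennreal (exp (- s * (\<Sum>j\<in>C. (norm (g j))\<^sup>2))) \<partial>PiM C (\<lambda>_. kgauss :: 'k measure))
      = (\<integral>\<^sup>+g. (\<Prod>j\<in>C. ennreal (exp (- s * (norm (g j))\<^sup>2))) \<partial>PiM C (\<lambda>_. kgauss :: 'k measure))"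
    using \<open>finite C\<close>
    by (intro nn_integral_cong) (simp add: sum_distrib_left exp_sum prod_ennreal flip: sum_negf)
  also have "\<dots> = (\<Prod>j\<in>C. \<integral>\<^sup>+x. ennreal (exp (- s * (norm x)\<^sup>2)) \<partial>(kgauss :: 'k measure))"
    using \<open>finite C\<close> by (intro product_nn_integral_prod) auto
  also have "\<dots> = ennreal ((1 / sqrt (1 + 2 * s / real DIM('k))) ^ DIM('k)) ^ card C"
    by (simp only: kgauss_laplace[OF \<open>s \<ge> 0\<close>] prod_constant)
  also have "\<dots> = ennreal ((1 / sqrt (1 + 2 * s / real DIM('k))) ^ (DIM('k) * card C))"
    using \<open>s \<ge> 0\<close> by (simp add: ennreal_power power_mult)
  finally show ?thesis .
qed

lemma inverse_sqrt_power: "x > 0 \<Longrightarrow> (1 / sqrt x) ^ n = x powr (- real n / 2)"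
  by (simp add: powr_half_sqrt[symmetric] powr_minus_divide[symmetric] powr_realpow[symmetric]
      powr_powr)

lemma nn_integral_powr_tail:
  assumes "a > 0" "k > (2::real)"
  shows "(\<integral>\<^sup>+s. ennreal ((1 + a * s) powr (- k / 2)) * indicator {0..} s \<partial>lborel) = ennreal (2 / (a * (k - 2)))"
proof -
  define F where "F s = - (2 / (a * (k - 2))) * (1 + a * s) powr (1 - k / 2)" for s
  have "(\<integral>\<^sup>+s. ennreal ((1 + a * s) powr (- k / 2)) * indicator {0..} s \<partial>lborel) = 0 - F 0"
  proof (rule nn_integral_FTC_atLeast)
    fix s :: real assume "s \<ge> 0"
    hence "1 + a * s > 0" using \<open>a > 0\<close> by (simp add: add_pos_nonneg)
    hence "(F has_field_derivative - (2 / (a * (k - 2))) * ((1 - k / 2) * (1 + a * s) powr (1 - k / 2 - 1) * a)) (at s)"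
      unfolding F_def using assms by (auto intro!: derivative_eq_intros)
    also have "- (2 / (a * (k - 2))) * ((1 - k / 2) * (1 + a * s) powr (1 - k / 2 - 1) * a)
        = (1 + a * s) powr (- k / 2)"
      using assms by (simp add: field_simps)
    finally show "(F has_field_derivative (1 + a * s) powr (- k / 2)) (at s)" .
  next
    have "filterlim (\<lambda>s. 1 + a * s) at_top at_top"
      using \<open>a > 0\<close>
      by (intro filterlim_tendsto_add_at_top[OF tendsto_const] filterlim_tendsto_pos_mult_at_top[OF tendsto_const])
         (auto simp: filterlim_ident)
    hence "((\<lambda>s. (1 + a * s) powr (1 - k / 2)) \<longlongrightarrow> 0) at_top"
      using assms by (intro tendsto_neg_powr) auto
    from tendsto_mult_left[OF this, of "- (2 / (a * (k - 2)))"] show "(F \<longlongrightarrow> 0) at_top"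
      by (simp add: F_def[abs_def])
  qed auto
  thus ?thesis by (simp add: F_def)
qed

text \<open>The function 1/t^2 with value \<infinity> at 0, written as a Laplace integral. The value
  at 0 makes the decay bound hold at every frequency, where real division would give the false bound
  0; the integral form reduces Gaussian averages to \<open>PiM_kgauss_laplace\<close> by
  Fubini.\<close>

definition laplace_inv_sq :: "real \<Rightarrow> ennreal" where
  "laplace_inv_sq t = (\<integral>\<^sup>+s. ennreal (exp (- s * t\<^sup>2)) * indicator {0..} s \<partial>lborel)"

lemma laplace_inv_sq_0 [simp]: "laplace_inv_sq 0 = \<top>"
proof -
  have "emeasure lborel {0::real..} = \<top>"
  proof (rule ccontr)
    assume "emeasure lborel {0::real..} \<noteq> \<top>"
    then obtain n :: nat where n: "emeasure lborel {0::real..} < of_nat n"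
      using ennreal_Ex_less_of_nat by (auto simp: top.not_eq_extremum)
    have "of_nat n = emeasure lborel {0..real n}"
      by (simp add: ennreal_of_nat_eq_real_of_nat)
    also have "\<dots> \<le> emeasure lborel {0::real..}" by (intro emeasure_mono) auto
    finally show False using n by simp
  qed
  thus ?thesis by (simp add: laplace_inv_sq_def)
qed

lemma laplace_inv_sq_eq:
  assumes "t \<noteq> 0"
  shows "laplace_inv_sq t = ennreal (1 / t\<^sup>2)"
proof -
  define T where "T = t\<^sup>2"
  have "T \<noteq> 0" using assms by (simp add: T_def)
  define F where "F s = - (1 / T) * exp (- s * T)" for s
  have "laplace_inv_sq t = 0 - F 0"
    unfolding laplace_inv_sq_def T_def[symmetric]
  proof (rule nn_integral_FTC_atLeast)
    show "(F has_field_derivative exp (- s * T)) (at s)" for s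
      unfolding F_def using \<open>T \<noteq> 0\<close> by (auto intro!: derivative_eq_intros)
    have "filterlim (\<lambda>s. s * T) at_top at_top"
      using assms by (intro filterlim_at_top_mult_tendsto_pos[OF tendsto_const]) (auto simp: filterlim_ident T_def)
    hence "filterlim (\<lambda>s. - s * T) at_bot at_top"
      by (simp add: filterlim_uminus_at_top)
    hence "((\<lambda>s. exp (- s * T)) \<longlongrightarrow> 0) at_top"
      by (rule filterlim_compose[OF exp_at_bot])
    from tendsto_mult_left[OF this, of "- (1 / T)"] show "(F \<longlongrightarrow> 0) at_top"
      by (simp add: F_def[abs_def])
  qed auto
  thus ?thesis by (simp add: F_def T_def)
qed

text \<open>This is the inverse moment of a chi-square variable with \<open>DIM('k) * card C\<close>
  degrees of freedom; more than two degrees are what makes it finite. After exchanging integrals it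
  is the integral of a power of 1 + as.\<close>

lemma nn_integral_laplace_inv_sq:
  assumes "finite C" "DIM('k) * card C > 2" "t > 0"
  shows "(\<integral>\<^sup>+g. laplace_inv_sq (t * sqrt (\<Sum>j\<in>C. (norm (g j))\<^sup>2)) \<partial>PiM C (\<lambda>_. kgauss :: 'k::euclidean_space measure))
    = ennreal (real DIM('k) / ((real (DIM('k) * card C) - 2) * t\<^sup>2))"
proof -
  let ?G = "PiM C (\<lambda>_. kgauss :: 'k measure)"
  interpret G: prob_space ?G by (rule prob_space_column)
  interpret pair_sigma_finite ?G lborel ..
  have [measurable]: "(\<lambda>g. \<Sum>j\<in>C. (norm (g j))\<^sup>2) \<in> borel_measurable ?G"
    by measurable
  have sq: "(t * sqrt (\<Sum>j\<in>C. (norm (g j))\<^sup>2))\<^sup>2 = t\<^sup>2 * (\<Sum>j\<in>C. (norm (g j))\<^sup>2)" for g :: "'a \<Rightarrow> 'k"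
    by (simp add: power_mult_distrib sum_nonneg)
  have "(\<integral>\<^sup>+g. laplace_inv_sq (t * sqrt (\<Sum>j\<in>C. (norm (g j))\<^sup>2)) \<partial>?G)
      = (\<integral>\<^sup>+s. \<integral>\<^sup>+g. ennreal (exp (- s * (t\<^sup>2 * (\<Sum>j\<in>C. (norm (g j))\<^sup>2)))) * indicator {0..} s \<partial>?G \<partial>lborel)"
    unfolding laplace_inv_sq_def sq by (rule Fubini'[symmetric]) measurable
  also have "\<dots> = (\<integral>\<^sup>+s. ennreal ((1 + 2 * t\<^sup>2 / real DIM('k) * s) powr (- real (DIM('k) * card C) / 2))
      * indicator {0..} s \<partial>lborel)"
  proof (rule nn_integral_cong)
    fix s :: real
    show "(\<integral>\<^sup>+g. ennreal (exp (- s * (t\<^sup>2 * (\<Sum>j\<in>C. (norm (g j))\<^sup>2)))) * indicator {0..} s \<partial>?G)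
      = ennreal ((1 + 2 * t\<^sup>2 / real DIM('k) * s) powr (- real (DIM('k) * card C) / 2)) * indicator {0..} s"
    proof (cases "s \<ge> 0")
      case True
      hence "1 + 2 * (s * t\<^sup>2) / real DIM('k) > 0" by (intro add_pos_nonneg) auto
      moreover have "(\<integral>\<^sup>+g. ennreal (exp (- s * (t\<^sup>2 * (\<Sum>j\<in>C. (norm (g j))\<^sup>2)))) \<partial>?G)
          = (\<integral>\<^sup>+g. ennreal (exp (- (s * t\<^sup>2) * (\<Sum>j\<in>C. (norm (g j))\<^sup>2))) \<partial>?G)"
        by (simp add: mult.assoc)
      ultimately show ?thesis
        using True PiM_kgauss_laplace[where 'k = 'k, OF \<open>finite C\<close>, of "s * t\<^sup>2"]
        by (simp add: inverse_sqrt_power mult_ac)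
    qed simp
  qed
  also have "\<dots> = ennreal (2 / (2 * t\<^sup>2 / real DIM('k) * (real (DIM('k) * card C) - 2)))"
    using assms by (intro nn_integral_powr_tail) (auto simp flip: of_nat_mult)
  also have "2 / (2 * t\<^sup>2 / real DIM('k) * (real (DIM('k) * card C) - 2))
      = real DIM('k) / ((real (DIM('k) * card C) - 2) * t\<^sup>2)"
  proof -
    have "2 / (2 * x / b * c) = b / (c * x)" for x b c :: real by simp
    thus ?thesis .
  qed
  finally show ?thesis .
qed

section \<open>The recursion in the size of the matrix\<close>

lemma chf_one: "chf (Suc 0) {j} (\<sigma> :: 'k::{real_normed_div_algebra, euclidean_space})
    = of_real (exp (- (norm \<sigma>)\<^sup>2 / (2 * real DIM('k))))"
proof -
  let ?N = "PiM {..<Suc 0} (\<lambda>_. kgauss :: 'k measure)"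
  interpret N: product_prob_space "\<lambda>_. ?N" "{j}"
    by (intro product_prob_spaceI prob_space_column)
  interpret G: product_prob_space "\<lambda>_. kgauss :: 'k measure" "{0::nat}"
    by (intro product_prob_spaceI prob_space_kgauss)
  have 0: "{..<Suc 0} = {0}" by auto
  have "chf (Suc 0) {j} \<sigma> = (\<integral>A. cis (\<sigma> \<bullet> A j 0) \<partial>PiM {j} (\<lambda>_. ?N))"
    by (simp add: chf_def gmat_def)
  also have "\<dots> = (\<integral>x. cis (\<sigma> \<bullet> x 0) \<partial>?N)"
    by (rule N.product_integral_singleton) measurable
  also have "\<dots> = (\<integral>x. cis (\<sigma> \<bullet> x) \<partial>kgauss)"
    unfolding 0 by (rule G.product_integral_singleton) measurable
  finally show ?thesis by (simp only: kgauss_char)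
qed

text \<open>For two real columns the average of 1/|g|^2 diverges, so the step from size 1 to size 2
  uses the exact Gaussian characteristic function. Its average is (1 +
  |\<tau>|^2/\<beta>^2)^(-\<beta>) with \<beta> = \<open>DIM('k)\<close>, which is at most
  \<beta>^2/|\<tau>|^2.\<close>

lemma norm_chf_two_le:
  fixes \<tau> :: "'k::{real_normed_div_algebra, euclidean_space}"
  assumes "finite C" "card C = 2"
  shows "ennreal (norm (chf 2 C \<tau>)) \<le> ennreal ((real DIM('k))\<^sup>2) * laplace_inv_sq (norm \<tau>)"
proof (cases "\<tau> = 0")
  case True
  thus ?thesis by (simp add: ennreal_mult_top)
next
  case False
  let ?\<beta> = "real DIM('k)"
  have "?\<beta> > 0" by simp
  have chf1: "ennreal (norm (chf (Suc 0) (C - {j}) \<sigma>)) \<le> ennreal (exp (- (norm \<sigma>)\<^sup>2 / (2 * ?\<beta>)))"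
    if "j \<in> C" for j and \<sigma> :: 'k
  proof -
    have "card (C - {j}) = Suc 0" using assms that by simp
    then obtain i where "C - {j} = {i}" by (auto simp: card_1_singleton_iff)
    thus ?thesis by (simp add: chf_one)
  qed
  define x where "x = 1 + (norm \<tau>)\<^sup>2 / ?\<beta>\<^sup>2"
  have x: "x \<ge> 1" by (simp add: x_def)
  have "ennreal (norm (chf (Suc (Suc 0)) C \<tau>))
      \<le> (\<integral>\<^sup>+g. ennreal (exp (- (norm \<tau> * sqrt (\<Sum>j\<in>C. (norm (g j))\<^sup>2))\<^sup>2 / (2 * ?\<beta>))) \<partial>PiM C (\<lambda>_. kgauss :: 'k measure))"
    using assms by (intro norm_chf_Suc_le chf1) auto
  also have "\<dots> = (\<integral>\<^sup>+g. ennreal (exp (- ((norm \<tau>)\<^sup>2 / (2 * ?\<beta>)) * (\<Sum>j\<in>C. (norm (g j))\<^sup>2))) \<partial>PiM C (\<lambda>_. kgauss :: 'k measure))"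
    by (intro nn_integral_cong) (simp add: power_mult_distrib sum_nonneg)
  also have "\<dots> = ennreal ((1 / sqrt (1 + 2 * ((norm \<tau>)\<^sup>2 / (2 * ?\<beta>)) / ?\<beta>)) ^ (DIM('k) * card C))"
    using assms by (intro PiM_kgauss_laplace) auto
  also have "1 + 2 * ((norm \<tau>)\<^sup>2 / (2 * ?\<beta>)) / ?\<beta> = x"
    by (simp add: x_def power2_eq_square)
  also have "(1 / sqrt x) ^ (DIM('k) * card C) = (1 / x) ^ DIM('k)"
    using x by (simp add: assms power_mult[symmetric] mult.commute[of _ 2] power_mult power_one_over)
  also have "ennreal ((1 / x) ^ DIM('k)) \<le> ennreal (?\<beta>\<^sup>2 / (norm \<tau>)\<^sup>2)"
  proof (rule ennreal_leI)
    have "(1 / x) ^ DIM('k) \<le> (1 / x) ^ 1"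
      using x by (intro power_decreasing) (auto simp: Suc_le_eq)
    also have "\<dots> \<le> ?\<beta>\<^sup>2 / (norm \<tau>)\<^sup>2"
    proof -
      have "(norm \<tau>)\<^sup>2 \<le> ?\<beta>\<^sup>2 * x" by (simp add: x_def distrib_left)
      thus ?thesis using False x by (simp add: field_simps)
    qed
    finally show "(1 / x) ^ DIM('k) \<le> ?\<beta>\<^sup>2 / (norm \<tau>)\<^sup>2" .
  qed
  also have "\<dots> = ennreal (?\<beta>\<^sup>2) * laplace_inv_sq (norm \<tau>)"
    using False by (simp add: laplace_inv_sq_eq flip: ennreal_mult)
  finally show ?thesis by (simp add: numeral_2_eq_2)
qed

text \<open>Averaging the inverse square over a row of \<open>m + 1\<close> entries costs
  \<beta>/(\<beta>(m+1) - 2), at most 1/(m-1). From size 2 on, these factors multiply up to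
  1/(n-2)!.\<close>

lemma norm_chf_le_laplace:
  fixes \<tau> :: "'k::{real_normed_div_algebra, euclidean_space}"
  assumes "m \<ge> 2" "finite C" "card C = m"
  shows "ennreal (norm (chf m C \<tau>))
    \<le> ennreal ((real DIM('k))\<^sup>2 / fact (m - 2)) * laplace_inv_sq (norm \<tau>)"
  using assms
proof (induction m arbitrary: C \<tau> rule: dec_induct)
  case base
  thus ?case using norm_chf_two_le[of C \<tau>] by simp
next
  case (step m)
  let ?\<beta> = "real DIM('k)"
  let ?K = "?\<beta>\<^sup>2 / fact (m - 2)"
  show ?case
  proof (cases "\<tau> = 0")
    case True
    thus ?thesis by (simp add: ennreal_mult_top)
  next
    case False
    have \<beta>: "?\<beta> \<ge> 1" by (simp add: Suc_le_eq)
    \<comment> \<open>There are now at least three columns, so even over the reals the inverse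
      moment is finite.\<close>
    have "DIM('k) * card C \<ge> 1 * 3"
      using step by (intro mult_le_mono) (auto simp: Suc_le_eq)
    hence big: "DIM('k) * card C > 2" by linarith
    have "ennreal (norm (chf (Suc m) C \<tau>))
        \<le> (\<integral>\<^sup>+g. ennreal ?K * laplace_inv_sq (norm \<tau> * sqrt (\<Sum>j\<in>C. (norm (g j))\<^sup>2)) \<partial>PiM C (\<lambda>_. kgauss :: 'k measure))"
      using step by (intro norm_chf_Suc_le[where \<Psi> = "\<lambda>t. ennreal ?K * laplace_inv_sq t"] step.IH) auto
    also have "\<dots> = ennreal ?K * (\<integral>\<^sup>+g. laplace_inv_sq (norm \<tau> * sqrt (\<Sum>j\<in>C. (norm (g j))\<^sup>2)) \<partial>PiM C (\<lambda>_. kgauss :: 'k measure))"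
      unfolding laplace_inv_sq_def by (rule nn_integral_cmult) measurable
    also have "\<dots> = ennreal ?K * ennreal (?\<beta> / ((real (DIM('k) * card C) - 2) * (norm \<tau>)\<^sup>2))"
      using False step big by (subst nn_integral_laplace_inv_sq) auto
    also have "\<dots> \<le> ennreal ?K * ennreal (1 / (real (m - 1) * (norm \<tau>)\<^sup>2))"
    proof (intro mult_left_mono ennreal_leI)
      have m: "real (m - 1) = real m - 1" "real m - 1 > 0" using step by auto
      \<comment> \<open>The gap between the two sides is 2\<beta> - 2, so the estimate is an
        equality over the reals.\<close>
      have "?\<beta> * (real m - 1) \<le> ?\<beta> * (real m + 1) - 2"
        using \<beta> by (simp add: algebra_simps)
      moreover have "?\<beta> * (real m - 1) > 0" using m by simp
      ultimately have "?\<beta> / (?\<beta> * (real m + 1) - 2) \<le> ?\<beta> / (?\<beta> * (real m - 1))"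
        using \<beta> m by (intro divide_left_mono mult_pos_pos) linarith+
      also have "\<dots> = 1 / (real m - 1)" by simp
      finally have "?\<beta> / (?\<beta> * (real m + 1) - 2) / (norm \<tau>)\<^sup>2 \<le> 1 / (real m - 1) / (norm \<tau>)\<^sup>2"
        by (intro divide_right_mono) auto
      moreover have "real (DIM('k) * card C) = ?\<beta> * (real m + 1)"
        by (simp add: step.prems algebra_simps)
      ultimately show "?\<beta> / ((real (DIM('k) * card C) - 2) * (norm \<tau>)\<^sup>2) \<le> 1 / (real (m - 1) * (norm \<tau>)\<^sup>2)"
        by (simp only: m(1) divide_divide_eq_left)
    qed auto
    also have "\<dots> = ennreal (?K / real (m - 1)) * laplace_inv_sq (norm \<tau>)"
      using False by (simp add: laplace_inv_sq_eq flip: ennreal_mult)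
    also have "?K / real (m - 1) = ?\<beta>\<^sup>2 / fact (Suc m - 2)"
    proof -
      have "Suc m - 2 = Suc (m - 2)" "m - 1 = Suc (m - 2)" using step by auto
      thus ?thesis by (simp only: fact_Suc) (simp add: mult.commute)
    qed
    finally show ?thesis .
  qed
qed

lemma norm_chf_le:
  fixes \<tau> :: "'k::{real_normed_div_algebra, euclidean_space}"
  assumes "n \<ge> 2" "finite C" "card C = n" "\<tau> \<noteq> 0"
  shows "norm (chf n C \<tau>) \<le> (real DIM('k))\<^sup>2 / (fact (n - 2) * (norm \<tau>)\<^sup>2)"
  using norm_chf_le_laplace[OF assms(1-3), of \<tau>] assms(4)
  by (simp add: laplace_inv_sq_eq flip: ennreal_mult)

section \<open>Transfer to arbitrary probability spaces\<close>

lemma standard_gaussian_distr: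
  fixes X :: "'a \<Rightarrow> 'k::euclidean_space"
  assumes "standard_gaussian M X"
  shows "distr M borel X = kgauss"
proof -
  let ?\<sigma> = "sqrt (1 / real DIM('k))"
  let ?s = "\<lambda>x. \<Sum>b\<in>Basis. x b *\<^sub>R (b::'k)"
  interpret prob_space M using assms by (simp add: standard_gaussian_def)
  have X [measurable]: "X \<in> borel_measurable M"
    and ind: "indep_vars (\<lambda>_. borel) (\<lambda>b \<omega>. X \<omega> \<bullet> b) Basis"
    and nd: "\<And>b. b \<in> Basis \<Longrightarrow> distributed M lborel (\<lambda>\<omega>. X \<omega> \<bullet> b) (\<lambda>x. ennreal (normal_density 0 ?\<sigma> x))"
    using assms by (auto simp: standard_gaussian_def)
  have coord: "distr M borel (\<lambda>\<omega>. X \<omega> \<bullet> b) = real_gauss ?\<sigma>" if "b \<in> Basis" for b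
  proof -
    have "distr M borel (\<lambda>\<omega>. X \<omega> \<bullet> b) = distr M lborel (\<lambda>\<omega>. X \<omega> \<bullet> b)"
      by (intro distr_cong) auto
    also have "\<dots> = real_gauss ?\<sigma>"
      using nd[OF that] by (simp add: distributed_def real_gauss_def)
    finally show ?thesis .
  qed
  have "distr M (PiM Basis (\<lambda>_. borel)) (\<lambda>\<omega>. \<lambda>b\<in>Basis. X \<omega> \<bullet> b) = PiM Basis (\<lambda>b. distr M borel (\<lambda>\<omega>. X \<omega> \<bullet> b))"
    using ind by (subst (asm) indep_vars_iff_distr_eq_PiM) auto
  also have "\<dots> = PiM (Basis :: 'k set) (\<lambda>_. real_gauss ?\<sigma>)"
    by (intro PiM_cong refl coord)
  finally have "kgauss = distr (distr M (PiM Basis (\<lambda>_. borel)) (\<lambda>\<omega>. \<lambda>b\<in>Basis. X \<omega> \<bullet> b)) borel ?s"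
    by (simp only: kgauss_def)
  also have "\<dots> = distr M borel (\<lambda>\<omega>. ?s (\<lambda>b\<in>Basis. X \<omega> \<bullet> b))"
    by (subst distr_distr) (auto simp: o_def)
  also have "\<dots> = distr M borel X"
    by (intro distr_cong refl) (simp add: euclidean_representation)
  finally show ?thesis ..
qed

text \<open>The inverse map is checked first: preimages of rectangles under uncurrying are
  rectangles, and these determine a finite product measure. Inverting it then gives the
  claim.\<close>

lemma distr_PiM_curry:
  fixes K :: "'k measure"
  assumes "finite I" "finite J" "prob_space K"
  shows "distr (PiM (I \<times> J) (\<lambda>_. K)) (PiM J (\<lambda>_. PiM I (\<lambda>_. K))) (\<lambda>x. \<lambda>j\<in>J. \<lambda>i\<in>I. x (i, j))
    = PiM J (\<lambda>_. PiM I (\<lambda>_. K))"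
proof -
  let ?N = "PiM I (\<lambda>_. K)" and ?u = "\<lambda>A. \<lambda>(i, j)\<in>I \<times> J. A j i" and ?c = "\<lambda>x. \<lambda>j\<in>J. \<lambda>i\<in>I. x (i, j)"
  let ?P = "PiM (I \<times> J) (\<lambda>_. K)" and ?Q = "PiM J (\<lambda>_. ?N)"
  interpret P: product_prob_space "\<lambda>_. K" "I \<times> J" by (intro product_prob_spaceI assms)
  interpret N: product_prob_space "\<lambda>_. K" I by (intro product_prob_spaceI assms)
  interpret Q: product_prob_space "\<lambda>_. ?N" J by (intro product_prob_spaceI prob_space_PiM assms)
  have "(\<lambda>A. A j i) \<in> ?Q \<rightarrow>\<^sub>M K" if "i \<in> I" "j \<in> J" for i j
    by (rule measurable_compose[OF measurable_component_singleton[of j J] measurable_component_singleton])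
       (use that in auto)
  hence u [measurable]: "?u \<in> ?Q \<rightarrow>\<^sub>M ?P"
    by (intro measurable_restrict) auto
  have c [measurable]: "?c \<in> ?P \<rightarrow>\<^sub>M ?Q"
    by (intro measurable_restrict measurable_component_singleton) auto
  have "distr ?Q ?P ?u = ?P"
  proof (rule P.PiM_eqI)
    fix B :: "'a \<times> 'b \<Rightarrow> 'k set" assume B: "\<And>z. z \<in> I \<times> J \<Longrightarrow> B z \<in> sets K"
    have "?u -` Pi\<^sub>E (I \<times> J) B \<inter> space ?Q = (\<Pi>\<^sub>E j\<in>J. \<Pi>\<^sub>E i\<in>I. B (i, j))"
      using sets.sets_into_space[OF B]
      by (fastforce simp: space_PiM PiE_iff extensional_def split: prod.splits)
    moreover have "Pi\<^sub>E (I \<times> J) B \<in> sets ?P"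
      using B assms by (intro sets_PiM_I_finite) auto
    ultimately have "emeasure (distr ?Q ?P ?u) (Pi\<^sub>E (I \<times> J) B) = emeasure ?Q (\<Pi>\<^sub>E j\<in>J. \<Pi>\<^sub>E i\<in>I. B (i, j))"
      by (simp add: emeasure_distr)
    also have "\<dots> = (\<Prod>j\<in>J. emeasure ?N (\<Pi>\<^sub>E i\<in>I. B (i, j)))"
      using B assms by (intro Q.emeasure_PiM sets_PiM_I_finite) auto
    also have "\<dots> = (\<Prod>j\<in>J. \<Prod>i\<in>I. emeasure K (B (i, j)))"
      using B assms by (intro prod.cong refl N.emeasure_PiM) auto
    also have "\<dots> = (\<Prod>z\<in>I \<times> J. emeasure K (B z))"
      by (subst prod.swap) (simp add: prod.cartesian_product)
    finally show "emeasure (distr ?Q ?P ?u) (Pi\<^sub>E (I \<times> J) B) = (\<Prod>z\<in>I \<times> J. emeasure K (B z))" .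
  qed (use assms in auto)
  hence "distr ?P ?Q ?c = distr (distr ?Q ?P ?u) ?Q ?c" by simp
  also have "\<dots> = distr ?Q ?Q (\<lambda>A. A)"
    by (subst distr_distr, measurable, rule distr_cong)
       (auto simp: space_PiM PiE_iff fun_eq_iff extensional_def)
  finally show ?thesis by (simp add: distr_id)
qed

lemma gaussian_matrix_distr:
  fixes G :: "'a \<Rightarrow> nat \<Rightarrow> nat \<Rightarrow> 'k::euclidean_space"
  assumes "gaussian_matrix M n G" "n > 0"
  shows "(\<lambda>\<omega>. \<lambda>j\<in>{..<n}. \<lambda>i\<in>{..<n}. G \<omega> i j) \<in> M \<rightarrow>\<^sub>M gmat n {..<n}"
    and "distr M (gmat n {..<n}) (\<lambda>\<omega>. \<lambda>j\<in>{..<n}. \<lambda>i\<in>{..<n}. G \<omega> i j) = gmat n {..<n}"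
proof -
  let ?S = "{..<n} \<times> {..<n}" and ?K = "kgauss :: 'k measure"
  let ?P = "PiM ?S (\<lambda>_. ?K)" and ?X = "\<lambda>\<omega>. \<lambda>z\<in>?S. G \<omega> (fst z) (snd z)"
  interpret prob_space M using assms by (simp add: gaussian_matrix_def)
  have std: "standard_gaussian M (\<lambda>\<omega>. G \<omega> i j)" if "i < n" "j < n" for i j
    using assms that by (simp add: gaussian_matrix_def)
  hence "(\<lambda>\<omega>. G \<omega> i j) \<in> borel_measurable M" if "i < n" "j < n" for i j
    using that unfolding standard_gaussian_def by blast
  hence rv: "(\<lambda>\<omega>. G \<omega> (fst z) (snd z)) \<in> borel_measurable M" if "z \<in> ?S" for z
    using that by auto
  hence rvK: "(\<lambda>\<omega>. G \<omega> (fst z) (snd z)) \<in> M \<rightarrow>\<^sub>M ?K" if "z \<in> ?S" for z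
    using that by (subst measurable_cong_sets[OF refl sets_kgauss])
  have ind: "indep_vars (\<lambda>_. borel) (\<lambda>z \<omega>. G \<omega> (fst z) (snd z)) ?S"
    using assms by (simp add: gaussian_matrix_def case_prod_unfold)
  \<comment> \<open>The characterisation of independence by the product law is applied with a
    nonempty index set; this is where \<open>n > 0\<close> enters.\<close>
  have "?S \<noteq> {}" using \<open>n > 0\<close> by auto
  hence "distr M (PiM ?S (\<lambda>_. borel)) ?X = PiM ?S (\<lambda>z. distr M borel (\<lambda>\<omega>. G \<omega> (fst z) (snd z)))"
    using ind rv by (subst (asm) indep_vars_iff_distr_eq_PiM') auto
  also have "\<dots> = ?P"
    by (intro PiM_cong refl standard_gaussian_distr std) auto
  also have "distr M (PiM ?S (\<lambda>_. borel)) ?X = distr M ?P ?X"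
    by (intro distr_cong refl sets_PiM_cong) auto
  finally have P: "distr M ?P ?X = ?P" .
  have X: "?X \<in> M \<rightarrow>\<^sub>M ?P"
    by (intro measurable_restrict rvK)
  have c: "(\<lambda>x. \<lambda>j\<in>{..<n}. \<lambda>i\<in>{..<n}. x (i, j)) \<in> ?P \<rightarrow>\<^sub>M gmat n {..<n}"
    unfolding gmat_def by (intro measurable_restrict measurable_component_singleton) auto
  have comp: "(\<lambda>x. \<lambda>j\<in>{..<n}. \<lambda>i\<in>{..<n}. x (i, j)) \<circ> ?X = (\<lambda>\<omega>. \<lambda>j\<in>{..<n}. \<lambda>i\<in>{..<n}. G \<omega> i j)"
    by (auto simp: fun_eq_iff)
  show "(\<lambda>\<omega>. \<lambda>j\<in>{..<n}. \<lambda>i\<in>{..<n}. G \<omega> i j) \<in> M \<rightarrow>\<^sub>M gmat n {..<n}"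
    unfolding comp[symmetric] by (rule measurable_comp[OF X c])
  have "gmat n {..<n} = distr (distr M ?P ?X) (gmat n {..<n}) (\<lambda>x. \<lambda>j\<in>{..<n}. \<lambda>i\<in>{..<n}. x (i, j))"
    unfolding P gmat_def by (intro distr_PiM_curry[symmetric] prob_space_kgauss) auto
  also have "\<dots> = distr M (gmat n {..<n}) (\<lambda>\<omega>. \<lambda>j\<in>{..<n}. \<lambda>i\<in>{..<n}. G \<omega> i j)"
    by (subst distr_distr[OF c X]) (simp only: comp)
  finally show "distr M (gmat n {..<n}) (\<lambda>\<omega>. \<lambda>j\<in>{..<n}. \<lambda>i\<in>{..<n}. G \<omega> i j) = gmat n {..<n}" ..
qed

lemma permanent_eq_rperm_restrict:
  "permanent n A = rperm n {..<n} (\<lambda>j\<in>{..<n}. \<lambda>i\<in>{..<n}. A i j)"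
  unfolding permanent_eq_rperm by (rule rperm_cong) auto

lemma permanent_measurable:
  fixes G :: "'a \<Rightarrow> nat \<Rightarrow> nat \<Rightarrow> 'k::{real_normed_div_algebra, euclidean_space}"
  assumes "gaussian_matrix M n G"
  shows "(\<lambda>\<omega>. permanent n (G \<omega>)) \<in> borel_measurable M"
  unfolding permanent_eq_rperm
  by (rule rperm_measurable) (use assms in \<open>auto simp: gaussian_matrix_def standard_gaussian_def\<close>)

lemma permanent_char:
  fixes G :: "'a \<Rightarrow> nat \<Rightarrow> nat \<Rightarrow> 'k::{real_normed_div_algebra, euclidean_space}"
  assumes "gaussian_matrix M n G" "n > 0"
  shows "(\<integral>\<omega>. cis (\<tau> \<bullet> permanent n (G \<omega>)) \<partial>M) = chf n {..<n} \<tau>"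
proof -
  have "rperm n {..<n} \<in> borel_measurable (gmat n {..<n} :: (nat \<Rightarrow> nat \<Rightarrow> 'k) measure)"
    by (rule rperm_measurable) (auto intro: gmat_entry_measurable)
  hence [measurable]: "(\<lambda>A. cis (\<tau> \<bullet> rperm n {..<n} A)) \<in> borel_measurable (gmat n {..<n})"
    by measurable
  have "chf n {..<n} \<tau> = (\<integral>A. cis (\<tau> \<bullet> rperm n {..<n} A)
      \<partial>distr M (gmat n {..<n}) (\<lambda>\<omega>. \<lambda>j\<in>{..<n}. \<lambda>i\<in>{..<n}. G \<omega> i j))"
    by (simp only: chf_def gaussian_matrix_distr(2)[OF assms])
  also have "\<dots> = (\<integral>\<omega>. cis (\<tau> \<bullet> permanent n (G \<omega>)) \<partial>M)"
    by (subst integral_distr) (auto simp: gaussian_matrix_distr(1)[OF assms] permanent_eq_rperm_restrict)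
  finally show ?thesis ..
qed

section \<open>Second moment\<close>

text \<open>The Gaussian is symmetric, so averaging over x and -x and applying the parallelogram law
  removes the cross term. Everything stays nonnegative, and twice the integral is computed before 2
  is cancelled.\<close>

lemma nn_integral_kgauss_affine:
  fixes a b :: "'k::{real_normed_div_algebra, euclidean_space}"
  shows "(\<integral>\<^sup>+x. ennreal ((norm (b + a * x))\<^sup>2) \<partial>kgauss) = ennreal ((norm b)\<^sup>2) + ennreal ((norm a)\<^sup>2)"
proof -
  let ?I = "\<integral>\<^sup>+x. ennreal ((norm (b + a * x))\<^sup>2) \<partial>kgauss"
  have "?I = (\<integral>\<^sup>+x. ennreal ((norm (b + a * x))\<^sup>2) \<partial>distr kgauss borel uminus)"
    by (simp only: kgauss_uminus)
  also have "\<dots> = (\<integral>\<^sup>+x. ennreal ((norm (b - a * x))\<^sup>2) \<partial>kgauss)"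
    by (subst nn_integral_distr) auto
  finally have "2 * ?I = ?I + (\<integral>\<^sup>+x. ennreal ((norm (b - a * x))\<^sup>2) \<partial>kgauss)"
    by (simp add: mult_2)
  also have "\<dots> = (\<integral>\<^sup>+x. ennreal ((norm (b + a * x))\<^sup>2) + ennreal ((norm (b - a * x))\<^sup>2) \<partial>kgauss)"
    by (rule nn_integral_add[symmetric]) auto
  also have "\<dots> = (\<integral>\<^sup>+x. ennreal (2 * (norm b)\<^sup>2) + ennreal (2 * (norm a)\<^sup>2) * ennreal ((norm x)\<^sup>2) \<partial>(kgauss :: 'k measure))"
  proof (rule nn_integral_cong)
    fix x :: 'k
    have "(norm (b + a * x))\<^sup>2 + (norm (b - a * x))\<^sup>2 = 2 * (norm b)\<^sup>2 + 2 * (norm (a * x))\<^sup>2"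
      by (simp add: power2_norm_eq_inner algebra_simps)
    thus "ennreal ((norm (b + a * x))\<^sup>2) + ennreal ((norm (b - a * x))\<^sup>2)
        = ennreal (2 * (norm b)\<^sup>2) + ennreal (2 * (norm a)\<^sup>2) * ennreal ((norm x)\<^sup>2)"
      by (simp add: norm_mult power_mult_distrib mult.assoc flip: ennreal_plus ennreal_mult)
  qed
  also have "\<dots> = ennreal (2 * (norm b)\<^sup>2) + ennreal (2 * (norm a)\<^sup>2)"
    by (subst nn_integral_add)
       (auto simp: nn_integral_cmult kgauss_second_moment prob_space.emeasure_space_1[OF prob_space_kgauss, simplified])
  also have "\<dots> = 2 * (ennreal ((norm b)\<^sup>2) + ennreal ((norm a)\<^sup>2))"
    by (simp add: ennreal_mult distrib_left)
  finally show ?thesis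
    by (subst (asm) ennreal_mult_cancel_left) auto
qed

lemma nn_integral_PiM_kgauss_linear:
  fixes a :: "'c \<Rightarrow> 'k::{real_normed_div_algebra, euclidean_space}"
  assumes "finite C"
  shows "(\<integral>\<^sup>+g. ennreal ((norm (\<Sum>j\<in>C. a j * g j))\<^sup>2) \<partial>PiM C (\<lambda>_. kgauss)) = (\<Sum>j\<in>C. ennreal ((norm (a j))\<^sup>2))"
  using assms
proof (induction C rule: finite_induct)
  case empty
  thus ?case by simp
next
  case (insert i C)
  interpret product_prob_space "\<lambda>_. kgauss :: 'k measure" C
    by (intro product_prob_spaceI prob_space_kgauss)
  have upd: "(\<Sum>j\<in>insert i C. a j * (g(i := x)) j) = (\<Sum>j\<in>C. a j * g j) + a i * x" for g x
  proof -
    have "(\<Sum>j\<in>C. a j * (g(i := x)) j) = (\<Sum>j\<in>C. a j * g j)"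
      using insert by (intro sum.cong) auto
    thus ?thesis using insert by (simp add: add.commute)
  qed
  have "(\<integral>\<^sup>+g. ennreal ((norm (\<Sum>j\<in>insert i C. a j * g j))\<^sup>2) \<partial>PiM (insert i C) (\<lambda>_. kgauss))
      = (\<integral>\<^sup>+g. \<integral>\<^sup>+x. ennreal ((norm (\<Sum>j\<in>insert i C. a j * (g(i := x)) j))\<^sup>2) \<partial>kgauss \<partial>PiM C (\<lambda>_. kgauss))"
    using insert by (intro product_nn_integral_insert) measurable
  also have "\<dots> = (\<integral>\<^sup>+g. ennreal ((norm (\<Sum>j\<in>C. a j * g j))\<^sup>2) + ennreal ((norm (a i))\<^sup>2) \<partial>PiM C (\<lambda>_. kgauss))"
    unfolding upd nn_integral_kgauss_affine ..
  also have "\<dots> = (\<Sum>j\<in>C. ennreal ((norm (a j))\<^sup>2)) + ennreal ((norm (a i))\<^sup>2)"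
    by (subst nn_integral_add) (auto simp: insert.IH prob_space.emeasure_space_1[OF prob_space_column])
  finally show ?case using insert by (simp add: add.commute sum_nonneg flip: ennreal_plus)
qed

text \<open>The conditioning is opposite to that for the characteristic function: with the upper
  rows fixed, the last row enters linearly with the cofactors as coefficients. Each of the
  \<open>m + 1\<close> cofactors contributes m!.\<close>

lemma nn_integral_rperm_square:
  assumes "finite C" "card C = m"
  shows "(\<integral>\<^sup>+A. ennreal ((norm (rperm m C A :: 'k::{real_normed_div_algebra, euclidean_space}))\<^sup>2) \<partial>gmat m C) = fact m"
  using assms
proof (induction m arbitrary: C)
  case 0
  thus ?case using prob_space.emeasure_space_1[OF prob_space_gmat[of 0 C]] by simp
next
  case (Suc m)
  let ?G = "PiM C (\<lambda>_. kgauss :: 'k measure)" and ?A = "gmat m C :: ('a \<Rightarrow> nat \<Rightarrow> 'k) measure"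
  interpret GA: pair_prob_space ?G ?A by (intro pair_prob_spaceI prob_space_column prob_space_gmat)
  let ?N = "PiM {..<m} (\<lambda>_. kgauss :: 'k measure)"
  have meas: "rperm k D \<in> borel_measurable (gmat k' C :: ('a \<Rightarrow> nat \<Rightarrow> 'k) measure)" if "D \<subseteq> C" "k \<le> k'" for D k k'
    by (rule rperm_measurable) (use that in \<open>auto intro: gmat_entry_measurable\<close>)
  define f where "f A = ennreal ((norm (rperm (Suc m) C A :: 'k))\<^sup>2)" for A
  have f: "f \<in> borel_measurable (gmat (Suc m) C)"
    using meas[of C "Suc m" "Suc m"] unfolding f_def[abs_def] by measurable
  have h: "(\<lambda>z. f (\<lambda>j\<in>C. (snd z j)(m := fst z j))) \<in> borel_measurable (?G \<Otimes>\<^sub>M ?A)"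
    using measurable_compose[OF gmat_Suc(1)[OF \<open>finite C\<close>] f] by (simp add: case_prod_beta)
  \<comment> \<open>The cofactor ignores column \<open>j\<close>, so integrating over all of
    \<open>C\<close> or over \<open>C - {j}\<close> gives the same value.\<close>
  have marginal: "(\<integral>\<^sup>+A. ennreal ((norm (rperm m (C - {j}) A :: 'k))\<^sup>2) \<partial>?A) = fact m" if "j \<in> C" for j
  proof -
    interpret N: product_prob_space "\<lambda>_. ?N" C
      by (intro product_prob_spaceI prob_space_column)
    have ins: "insert j (C - {j}) = C" using that by auto
    have "(\<integral>\<^sup>+A. ennreal ((norm (rperm m (C - {j}) A :: 'k))\<^sup>2) \<partial>?A)
        = (\<integral>\<^sup>+A. ennreal ((norm (rperm m (C - {j}) A))\<^sup>2) \<partial>PiM (insert j (C - {j})) (\<lambda>_. ?N))"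
      by (simp only: ins gmat_def)
    also have "\<dots> = (\<integral>\<^sup>+A. \<integral>\<^sup>+y. ennreal ((norm (rperm m (C - {j}) (A(j := y))))\<^sup>2) \<partial>?N \<partial>PiM (C - {j}) (\<lambda>_. ?N))"
    proof (rule N.product_nn_integral_insert)
      have [measurable]: "rperm m (C - {j}) \<in> borel_measurable (PiM (insert j (C - {j})) (\<lambda>_. ?N))"
        using meas[of "C - {j}" m m] by (simp only: ins gmat_def) auto
      show "(\<lambda>A. ennreal ((norm (rperm m (C - {j}) A))\<^sup>2)) \<in> borel_measurable (PiM (insert j (C - {j})) (\<lambda>_. ?N))"
        by measurable
    qed (use \<open>finite C\<close> in auto)
    also have "\<dots> = (\<integral>\<^sup>+A. ennreal ((norm (rperm m (C - {j}) A :: 'k))\<^sup>2) \<partial>gmat m (C - {j}))"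
      by (simp add: rperm_fun_upd_notin gmat_def prob_space.emeasure_space_1[OF prob_space_column]
          del: fun_upd_apply)
    also have "\<dots> = fact m"
      using Suc.prems that by (intro Suc.IH) auto
    finally show ?thesis .
  qed
  have "(\<integral>\<^sup>+A. f A \<partial>gmat (Suc m) C)
      = (\<integral>\<^sup>+A. f A \<partial>distr (?G \<Otimes>\<^sub>M ?A) (gmat (Suc m) C) (\<lambda>(g, A). \<lambda>j\<in>C. (A j)(m := g j)))"
    by (simp only: gmat_Suc(2)[OF \<open>finite C\<close>, symmetric])
  also have "\<dots> = (\<integral>\<^sup>+z. f (\<lambda>j\<in>C. (snd z j)(m := fst z j)) \<partial>(?G \<Otimes>\<^sub>M ?A))"
    by (subst nn_integral_distr[OF gmat_Suc(1)[OF \<open>finite C\<close>]], simp add: f, simp only: case_prod_unfold)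
  also have "\<dots> = (\<integral>\<^sup>+A. \<integral>\<^sup>+g. f (\<lambda>j\<in>C. (A j)(m := g j)) \<partial>?G \<partial>?A)"
    using h by (subst GA.nn_integral_snd[symmetric]) (simp_all add: case_prod_unfold)
  also have "\<dots> = (\<integral>\<^sup>+A. (\<Sum>j\<in>C. ennreal ((norm (rperm m (C - {j}) A))\<^sup>2)) \<partial>?A)"
    by (simp only: f_def rperm_Suc_split nn_integral_PiM_kgauss_linear[OF \<open>finite C\<close>])
  also have "\<dots> = (\<Sum>j\<in>C. \<integral>\<^sup>+A. ennreal ((norm (rperm m (C - {j}) A))\<^sup>2) \<partial>?A)"
    using meas[of _ m m] by (intro nn_integral_sum) auto
  also have "\<dots> = fact (Suc m)"
    using Suc.prems by (simp add: marginal)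
  finally show ?case by (simp add: f_def)
qed

lemma permanent_large_prob:
  fixes G :: "'a \<Rightarrow> nat \<Rightarrow> nat \<Rightarrow> 'k::{real_normed_div_algebra, euclidean_space}"
  assumes G: "gaussian_matrix M n G" and "n > 0" and "t > 0"
  shows "measure M {\<omega> \<in> space M. norm (permanent n (G \<omega>)) \<ge> t * sqrt (fact n)} \<le> 1 / t\<^sup>2"
proof -
  interpret prob_space M using G by (simp add: gaussian_matrix_def)
  note [measurable] = permanent_measurable[OF G]
  have [measurable]: "rperm n {..<n} \<in> borel_measurable (gmat n {..<n} :: (nat \<Rightarrow> nat \<Rightarrow> 'k) measure)"
    by (rule rperm_measurable) (auto intro: gmat_entry_measurable)
  have "fact n = (\<integral>\<^sup>+A. ennreal ((norm (rperm n {..<n} A))\<^sup>2)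
      \<partial>distr M (gmat n {..<n}) (\<lambda>\<omega>. \<lambda>j\<in>{..<n}. \<lambda>i\<in>{..<n}. G \<omega> i j))"
    by (simp add: gaussian_matrix_distr(2)[OF G \<open>n > 0\<close>] nn_integral_rperm_square)
  also have "\<dots> = (\<integral>\<^sup>+\<omega>. ennreal ((norm (permanent n (G \<omega>)))\<^sup>2) \<partial>M)"
    by (subst nn_integral_distr) (auto simp: gaussian_matrix_distr(1)[OF G \<open>n > 0\<close>] permanent_eq_rperm_restrict)
  finally have E: "(\<integral>\<^sup>+\<omega>. ennreal ((norm (permanent n (G \<omega>)))\<^sup>2) \<partial>M) = ennreal (fact n)"
    using ennreal_of_nat_eq_real_of_nat[of "fact n"] by simp
  have ev: "norm (permanent n (G \<omega>)) \<ge> t * sqrt (fact n)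
      \<longleftrightarrow> 1 \<le> ennreal (1 / (t\<^sup>2 * fact n)) * ennreal ((norm (permanent n (G \<omega>)))\<^sup>2)" for \<omega>
  proof -
    have "norm (permanent n (G \<omega>)) \<ge> t * sqrt (fact n) \<longleftrightarrow> (norm (permanent n (G \<omega>)))\<^sup>2 \<ge> (t * sqrt (fact n))\<^sup>2"
      using \<open>t > 0\<close> by (simp add: power_mono_iff)
    also have "\<dots> \<longleftrightarrow> 1 \<le> 1 / (t\<^sup>2 * fact n) * (norm (permanent n (G \<omega>)))\<^sup>2"
      using \<open>t > 0\<close> by (simp add: power_mult_distrib field_simps)
    also have "\<dots> \<longleftrightarrow> ennreal 1 \<le> ennreal (1 / (t\<^sup>2 * fact n) * (norm (permanent n (G \<omega>)))\<^sup>2)"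
      by (subst ennreal_le_iff) auto
    also have "ennreal (1 / (t\<^sup>2 * fact n) * (norm (permanent n (G \<omega>)))\<^sup>2)
        = ennreal (1 / (t\<^sup>2 * fact n)) * ennreal ((norm (permanent n (G \<omega>)))\<^sup>2)"
      by (rule ennreal_mult) auto
    finally show ?thesis by (simp only: ennreal_1)
  qed
  have "emeasure M {\<omega> \<in> space M. norm (permanent n (G \<omega>)) \<ge> t * sqrt (fact n)}
      \<le> ennreal (1 / (t\<^sup>2 * fact n)) * (\<integral>\<^sup>+\<omega>. ennreal ((norm (permanent n (G \<omega>)))\<^sup>2) * indicator (space M) \<omega> \<partial>M)"
    unfolding ev by (rule nn_integral_Markov_inequality) auto
  also have "(\<integral>\<^sup>+\<omega>. ennreal ((norm (permanent n (G \<omega>)))\<^sup>2) * indicator (space M) \<omega> \<partial>M) = ennreal (fact n)"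
    unfolding E[symmetric] by (intro nn_integral_cong) auto
  also have "ennreal (1 / (t\<^sup>2 * fact n)) * ennreal (fact n) = ennreal (1 / t\<^sup>2)"
    by (simp flip: ennreal_mult)
  finally show ?thesis
    by (simp add: emeasure_eq_measure)
qed

section \<open>Small ball estimate\<close>

text \<open>The indicator of the ball is at most e exp(-|x|^2/\<delta>^2), whose mean is a Laplace
  transform. The exact power of \<delta> would be the dimension; the first power holds uniformly and
  is enough.\<close>

lemma kgauss_small_ball:
  assumes "\<delta> > 0"
  shows "measure kgauss {x :: 'k::euclidean_space. norm x \<le> \<delta>} \<le> exp 1 * (\<delta> * real DIM('k))"
proof -
  interpret prob_space "kgauss :: 'k measure" by (rule prob_space_kgauss)
  define y where "y = 1 + 2 / (\<delta>\<^sup>2 * real DIM('k))"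
  have y: "y \<ge> 1" by (simp add: y_def)
  have "emeasure kgauss {x :: 'k. norm x \<le> \<delta>} = (\<integral>\<^sup>+x. indicator {x. norm x \<le> \<delta>} x \<partial>(kgauss :: 'k measure))"
    by simp
  also have "\<dots> \<le> (\<integral>\<^sup>+x. ennreal (exp 1) * ennreal (exp (- (1 / \<delta>\<^sup>2) * (norm x)\<^sup>2)) \<partial>(kgauss :: 'k measure))"
  proof (rule nn_integral_mono)
    fix x :: 'k
    show "indicator {x. norm x \<le> \<delta>} x \<le> ennreal (exp 1) * ennreal (exp (- (1 / \<delta>\<^sup>2) * (norm x)\<^sup>2))"
    proof (cases "norm x \<le> \<delta>")
      case True
      hence "(norm x)\<^sup>2 / \<delta>\<^sup>2 \<le> 1" using \<open>\<delta> > 0\<close> by (simp add: power_mono)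
      hence "1 \<le> exp (1 - (norm x)\<^sup>2 / \<delta>\<^sup>2)" by simp
      hence "ennreal 1 \<le> ennreal (exp 1 * exp (- (1 / \<delta>\<^sup>2) * (norm x)\<^sup>2))"
        by (intro ennreal_leI) (simp flip: exp_add)
      thus ?thesis using True by (simp add: ennreal_mult)
    qed simp
  qed
  also have "\<dots> = ennreal (exp 1) * ennreal ((1 / sqrt (1 + 2 * (1 / \<delta>\<^sup>2) / real DIM('k))) ^ DIM('k))"
    using kgauss_laplace[where 'k = 'k, of "1 / \<delta>\<^sup>2"] by (subst nn_integral_cmult) auto
  also have "1 + 2 * (1 / \<delta>\<^sup>2) / real DIM('k) = y" by (simp add: y_def)
  also have "ennreal (exp 1) * ennreal ((1 / sqrt y) ^ DIM('k)) \<le> ennreal (exp 1) * ennreal (\<delta> * real DIM('k))"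
  proof (intro mult_left_mono ennreal_leI)
    have "(1 / sqrt y) ^ DIM('k) \<le> (1 / sqrt y) ^ 1"
      using y by (intro power_decreasing) (auto simp: Suc_le_eq)
    also have "1 / sqrt y \<le> 1 / (1 / (\<delta> * real DIM('k)))"
    proof (rule divide_left_mono)
      have "1 / (\<delta> * real DIM('k)) \<le> sqrt (1 / (\<delta>\<^sup>2 * real DIM('k)))"
      proof (rule real_le_rsqrt)
        have "1 / (\<delta>\<^sup>2 * (real DIM('k) * real DIM('k))) \<le> 1 / (\<delta>\<^sup>2 * (real DIM('k) * 1))"
          using \<open>\<delta> > 0\<close> by (intro divide_left_mono mult_left_mono) (auto simp: Suc_le_eq)
        thus "(1 / (\<delta> * real DIM('k)))\<^sup>2 \<le> 1 / (\<delta>\<^sup>2 * real DIM('k))"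
          by (simp add: power2_eq_square ac_simps)
      qed
      also have "\<dots> \<le> sqrt y"
        using \<open>\<delta> > 0\<close> by (simp add: y_def add_increasing divide_right_mono)
      finally show "1 / (\<delta> * real DIM('k)) \<le> sqrt y" .
    qed (use \<open>\<delta> > 0\<close> y in auto)
    finally show "(1 / sqrt y) ^ DIM('k) \<le> \<delta> * real DIM('k)" by simp
  qed auto
  also have "\<dots> = ennreal (exp 1 * (\<delta> * real DIM('k)))"
    using \<open>\<delta> > 0\<close> by (simp flip: ennreal_mult)
  finally show ?thesis
    using \<open>\<delta> > 0\<close> by (simp add: emeasure_eq_measure)
qed

text \<open>The indicator of |X| \<le> r is dominated by a Gaussian weight in X/r, which is itself
  the characteristic function of \<open>kgauss\<close>. Fubini turns its mean into the average of
  the characteristic function of X at \<tau>/r over a Gaussian \<tau>. The trivial bound 1 is used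
  for |\<tau>| \<le> \<delta> and the decay hypothesis elsewhere.\<close>

lemma small_ball_from_char:
  fixes X :: "'a \<Rightarrow> 'k::euclidean_space"
  assumes "prob_space M" and X: "X \<in> borel_measurable M"
    and "r > 0" "\<delta> > 0" "K \<ge> 0"
    and char: "\<And>\<tau>. \<tau> \<noteq> 0 \<Longrightarrow> norm (\<integral>\<omega>. cis (\<tau> \<bullet> X \<omega>) \<partial>M) \<le> K / (norm \<tau>)\<^sup>2"
  shows "measure M {\<omega> \<in> space M. norm (X \<omega>) \<le> r}
    \<le> exp (1 / 2) * (measure kgauss {x :: 'k. norm x \<le> \<delta>} + K * r\<^sup>2 / \<delta>\<^sup>2)"
proof -
  let ?\<beta> = "real DIM('k)"
  let ?E = "\<integral>\<omega>. exp (- (norm (X \<omega>) / r)\<^sup>2 / (2 * ?\<beta>)) \<partial>M"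
  interpret M: prob_space M by fact
  interpret K: prob_space "kgauss :: 'k measure" by (rule prob_space_kgauss)
  interpret MK: pair_prob_space M "kgauss :: 'k measure" ..
  note X [measurable]
  have "measure M {\<omega> \<in> space M. norm (X \<omega>) \<le> r} = (\<integral>\<omega>. indicator {\<omega> \<in> space M. norm (X \<omega>) \<le> r} \<omega> \<partial>M)"
    by simp
  also have "\<dots> \<le> (\<integral>\<omega>. exp (1 / 2) * exp (- (norm (X \<omega>) / r)\<^sup>2 / (2 * ?\<beta>)) \<partial>M)"
  proof (rule integral_mono)
    show "integrable M (\<lambda>\<omega>. exp (1 / 2) * exp (- (norm (X \<omega>) / r)\<^sup>2 / (2 * ?\<beta>)))"
      by (intro M.integrable_const_bound[where B = "exp (1 / 2)"]) auto
    fix \<omega> assume "\<omega> \<in> space M"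
    show "indicat_real {\<omega> \<in> space M. norm (X \<omega>) \<le> r} \<omega> \<le> exp (1 / 2) * exp (- (norm (X \<omega>) / r)\<^sup>2 / (2 * ?\<beta>))"
    proof (cases "norm (X \<omega>) \<le> r")
      case True
      \<comment> \<open>Since the dimension is at least 1, the exponent is at least -1/2 on the
        ball; this is the origin of the prefactor exp(1/2).\<close>
      hence "(norm (X \<omega>) / r)\<^sup>2 \<le> 1" using \<open>r > 0\<close> by (simp add: power_le_one)
      also have "1 \<le> ?\<beta>" by (simp add: Suc_le_eq)
      finally have "(norm (X \<omega>) / r)\<^sup>2 / (2 * ?\<beta>) \<le> 1 / 2"
        by (simp add: pos_divide_le_eq)
      hence "1 \<le> exp (1 / 2 - (norm (X \<omega>) / r)\<^sup>2 / (2 * ?\<beta>))" by simp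
      also have "\<dots> = exp (1 / 2) * exp (- (norm (X \<omega>) / r)\<^sup>2 / (2 * ?\<beta>))"
        by (simp flip: exp_add)
      finally show ?thesis by (simp add: indicator_def)
    qed simp
  qed (auto intro!: M.integrable_const_bound[where B = 1])
  also have "\<dots> = exp (1 / 2) * ?E" by simp
  finally have markov: "measure M {\<omega> \<in> space M. norm (X \<omega>) \<le> r} \<le> exp (1 / 2) * ?E" .
  let ?\<phi> = "\<lambda>\<tau>. \<integral>\<omega>. cis (((1 / r) *\<^sub>R \<tau>) \<bullet> X \<omega>) \<partial>M"
  have "of_real ?E = (\<integral>\<omega>. complex_of_real (exp (- (norm (X \<omega>) / r)\<^sup>2 / (2 * ?\<beta>))) \<partial>M)"
    by simp
  also have "\<dots> = (\<integral>\<omega>. \<integral>\<tau>. cis (((1 / r) *\<^sub>R \<tau>) \<bullet> X \<omega>) \<partial>kgauss \<partial>M)"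
  proof (intro Bochner_Integration.integral_cong refl)
    fix \<omega>
    have "(\<integral>\<tau>. cis (((1 / r) *\<^sub>R \<tau>) \<bullet> X \<omega>) \<partial>kgauss) = (\<integral>\<tau>. cis (((1 / r) *\<^sub>R X \<omega>) \<bullet> \<tau>) \<partial>kgauss)"
      by (simp add: inner_commute)
    also have "\<dots> = of_real (exp (- (norm (X \<omega>) / r)\<^sup>2 / (2 * ?\<beta>)))"
      using \<open>r > 0\<close> by (subst kgauss_char) simp
    finally show "complex_of_real (exp (- (norm (X \<omega>) / r)\<^sup>2 / (2 * ?\<beta>))) = (\<integral>\<tau>. cis (((1 / r) *\<^sub>R \<tau>) \<bullet> X \<omega>) \<partial>kgauss)" ..
  qed
  also have "\<dots> = (\<integral>\<tau>. ?\<phi> \<tau> \<partial>kgauss)"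
    by (intro MK.Fubini_integral[symmetric] integrable_bounded_1 MK.prob_space_axioms) auto
  finally have "norm (complex_of_real ?E) = norm (\<integral>\<tau>. ?\<phi> \<tau> \<partial>kgauss)"
    by (rule arg_cong)
  moreover have "?E \<ge> 0" by (intro Bochner_Integration.integral_nonneg) simp
  ultimately have E: "?E = norm (\<integral>\<tau>. ?\<phi> \<tau> \<partial>kgauss)" by simp
  have \<phi>_meas [measurable]: "?\<phi> \<in> borel_measurable kgauss"
    by (rule M.borel_measurable_lebesgue_integral) measurable
  have \<phi>_le_1: "norm (?\<phi> \<tau>) \<le> 1" for \<tau>
    by (intro norm_integral_le_1 M.prob_space_axioms) simp
  have \<phi>_le: "norm (?\<phi> \<tau>) \<le> indicat_real {x. norm x \<le> \<delta>} \<tau> + K * r\<^sup>2 / \<delta>\<^sup>2" for \<tau>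
  proof (cases "norm \<tau> \<le> \<delta>")
    case True
    have "0 \<le> K * r\<^sup>2 / \<delta>\<^sup>2" using \<open>K \<ge> 0\<close> by simp
    thus ?thesis using True \<phi>_le_1[of \<tau>] by simp
  next
    case False
    hence "\<tau> \<noteq> 0" "norm \<tau> > 0" using \<open>\<delta> > 0\<close> by auto
    hence "norm (?\<phi> \<tau>) \<le> K / (norm ((1 / r) *\<^sub>R \<tau>))\<^sup>2"
      using \<open>r > 0\<close> by (intro char) auto
    also have "\<dots> = K * r\<^sup>2 / (norm \<tau>)\<^sup>2"
      using \<open>r > 0\<close> by (simp add: power_divide)
    also have "\<dots> \<le> K * r\<^sup>2 / \<delta>\<^sup>2"
      using False \<open>\<delta> > 0\<close> \<open>K \<ge> 0\<close> \<open>norm \<tau> > 0\<close>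
      by (intro divide_left_mono power_mono) auto
    finally show ?thesis using False by simp
  qed
  have "?E \<le> (\<integral>\<tau>. norm (?\<phi> \<tau>) \<partial>kgauss)"
    unfolding E by (rule integral_norm_bound)
  also have "\<dots> \<le> (\<integral>\<tau>. indicat_real {x. norm x \<le> \<delta>} \<tau> + K * r\<^sup>2 / \<delta>\<^sup>2 \<partial>(kgauss :: 'k measure))"
  proof (rule integral_mono)
    show "integrable kgauss (\<lambda>\<tau>. norm (?\<phi> \<tau>))"
      by (intro integrable_norm integrable_bounded_1 K.prob_space_axioms \<phi>_meas \<phi>_le_1)
    show "integrable (kgauss :: 'k measure) (\<lambda>\<tau>. indicat_real {x. norm x \<le> \<delta>} \<tau> + K * r\<^sup>2 / \<delta>\<^sup>2)"
      by (intro Bochner_Integration.integrable_add integrable_real_indicator)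
         (auto simp: K.emeasure_eq_measure)
  qed (rule \<phi>_le)
  also have "\<dots> = measure kgauss {x :: 'k. norm x \<le> \<delta>} + K * r\<^sup>2 / \<delta>\<^sup>2"
    by (subst Bochner_Integration.integral_add)
       (auto intro!: integrable_real_indicator simp: K.emeasure_eq_measure K.prob_space[simplified])
  finally have "?E \<le> measure kgauss {x :: 'k. norm x \<le> \<delta>} + K * r\<^sup>2 / \<delta>\<^sup>2" .
  hence "exp (1 / 2) * ?E \<le> exp (1 / 2) * (measure kgauss {x :: 'k. norm x \<le> \<delta>} + K * r\<^sup>2 / \<delta>\<^sup>2)"
    by (intro mult_left_mono) auto
  with markov show ?thesis by linarith
qed

text \<open>Apply the small ball estimate with \<delta> = 1/n. As n!/(n-2)! = n(n-1), dividing the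
  radius by n^3 makes the tail term \<beta>^2 n(n-1)/n^4; any fixed power of n is harmless after
  taking logarithms.\<close>

lemma permanent_small_prob:
  fixes G :: "'a \<Rightarrow> nat \<Rightarrow> nat \<Rightarrow> 'k::{real_normed_div_algebra, euclidean_space}"
  assumes G: "gaussian_matrix M n G" and "n \<ge> 2"
  shows "measure M {\<omega> \<in> space M. norm (permanent n (G \<omega>)) \<le> sqrt (fact n) / real n ^ 3}
    \<le> exp (1 / 2) * (exp 1 * real DIM('k) + (real DIM('k))\<^sup>2) / real n"
proof -
  let ?\<beta> = "real DIM('k)" and ?r = "sqrt (fact n) / real n ^ 3"
  let ?K = "?\<beta>\<^sup>2 / fact (n - 2)"
  have pM: "prob_space M" using G by (simp add: gaussian_matrix_def)
  have "norm (\<integral>\<omega>. cis (\<tau> \<bullet> permanent n (G \<omega>)) \<partial>M) \<le> ?K / (norm \<tau>)\<^sup>2" if "\<tau> \<noteq> 0" for \<tau>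
    using norm_chf_le[of n "{..<n}" \<tau>] that \<open>n \<ge> 2\<close>
    by (subst permanent_char[OF G]) auto
  hence "measure M {\<omega> \<in> space M. norm (permanent n (G \<omega>)) \<le> ?r}
      \<le> exp (1 / 2) * (measure kgauss {x :: 'k. norm x \<le> 1 / real n} + ?K * ?r\<^sup>2 / (1 / real n)\<^sup>2)"
    using \<open>n \<ge> 2\<close> by (intro small_ball_from_char pM permanent_measurable[OF G]) auto
  also have "\<dots> \<le> exp (1 / 2) * (exp 1 * (1 / real n * ?\<beta>) + ?\<beta>\<^sup>2 / real n)"
  proof (intro mult_left_mono add_mono kgauss_small_ball)
    have fact: "fact n = real n * (real n - 1) * fact (n - 2)"
    proof -
      obtain k where "n = 2 + k" using le_Suc_ex[OF \<open>n \<ge> 2\<close>] by auto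
      hence "n = Suc (Suc k)" by simp
      thus ?thesis by simp
    qed
    have "?r\<^sup>2 = fact n / (real n ^ 3)\<^sup>2" by (simp add: power_divide)
    hence "?K * ?r\<^sup>2 = ?\<beta>\<^sup>2 * (real n * (real n - 1)) / (real n ^ 3)\<^sup>2"
      by (simp only: fact) simp
    hence "?K * ?r\<^sup>2 / (1 / real n)\<^sup>2 = ?\<beta>\<^sup>2 * (real n * (real n - 1)) / real n ^ 4"
      using \<open>n \<ge> 2\<close> by (simp add: power_divide field_simps flip: power_mult power_add)
    also have "\<dots> \<le> ?\<beta>\<^sup>2 * (real n * real n ^ 2) / real n ^ 4"
      using \<open>n \<ge> 2\<close> by (intro divide_right_mono mult_left_mono) (auto simp: power2_eq_square mult_le_cancel_right1
        intro: order.trans[of _ "real n * 1"])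
    also have "\<dots> = ?\<beta>\<^sup>2 / real n"
      using \<open>n \<ge> 2\<close> by (simp add: field_simps power2_eq_square power4_eq_xxxx)
    finally show "?K * ?r\<^sup>2 / (1 / real n)\<^sup>2 \<le> ?\<beta>\<^sup>2 / real n" .
  qed (use \<open>n \<ge> 2\<close> in auto)
  also have "\<dots> = exp (1 / 2) * (exp 1 * ?\<beta> + ?\<beta>\<^sup>2) / real n"
    by (simp add: algebra_simps add_divide_distrib)
  finally show ?thesis .
qed

section \<open>From the two tails to boundedness in probability\<close>

lemma permanent_bigO_prob:
  fixes G :: "nat \<Rightarrow> 'a \<Rightarrow> nat \<Rightarrow> nat \<Rightarrow> 'k::{real_normed_div_algebra, euclidean_space}"
  assumes G: "\<And>n. gaussian_matrix (M n) n (G n)"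
    and a: "\<And>n. n \<ge> 2 \<Longrightarrow> \<bar>1 / 2 * ln (fact n) - a n\<bar> \<le> 2 * ln (real n)"
  shows "bigO_prob M (\<lambda>n \<omega>. ln (norm (permanent n (G n \<omega>))) - a n) (\<lambda>n. ln (real n))"
  unfolding bigO_prob_def
proof (intro conjI allI impI)
  fix n
  note [measurable] = permanent_measurable[OF G[of n]]
  show "(\<lambda>\<omega>. ln (norm (permanent n (G n \<omega>))) - a n) \<in> borel_measurable (M n)"
    by measurable
next
  fix \<eta> :: real assume "\<eta> > 0"
  \<comment> \<open>The summand 1 pays for the upper tail, whose probability 1/n^2 is at most 1/n.
    Both tails together are then at most B/n.\<close>
  define B where "B = exp (1 / 2) * (exp 1 * real DIM('k) + (real DIM('k))\<^sup>2) + 1"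
  define n0 where "n0 = max 2 (nat \<lceil>B / \<eta>\<rceil>)"
  \<comment> \<open>The constant 5 is 3, from the radius sqrt(n!)/n^3, plus 2, from the allowed
    distance of the centring to half of ln(n!). The upper threshold n sqrt(n!) needs only 1 +
    2.\<close>
  have "measure (M n) {\<omega> \<in> space (M n). \<bar>ln (norm (permanent n (G n \<omega>))) - a n\<bar> > 5 * ln (real n)} \<le> \<eta>"
    if "n \<ge> n0" for n
  proof -
    have n: "n \<ge> 2" "real n \<ge> B / \<eta>" using that by (auto simp: n0_def nat_ceiling_le_eq)
    interpret prob_space "M n" using G[of n] by (simp add: gaussian_matrix_def)
    note [measurable] = permanent_measurable[OF G[of n]]
    let ?p = "\<lambda>\<omega>. norm (permanent n (G n \<omega>))"
    let ?S = "{\<omega> \<in> space (M n). ?p \<omega> \<le> sqrt (fact n) / real n ^ 3}"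
    let ?L = "{\<omega> \<in> space (M n). ?p \<omega> \<ge> real n * sqrt (fact n)}"
    have "{\<omega> \<in> space (M n). \<bar>ln (?p \<omega>) - a n\<bar> > 5 * ln (real n)} \<subseteq> ?S \<union> ?L"
    proof (rule subsetI, rule ccontr)
      fix \<omega> assume "\<omega> \<in> {\<omega> \<in> space (M n). \<bar>ln (?p \<omega>) - a n\<bar> > 5 * ln (real n)}" "\<omega> \<notin> ?S \<union> ?L"
      hence *: "5 * ln (real n) < \<bar>ln (?p \<omega>) - a n\<bar>"
        "\<not> ?p \<omega> \<ge> real n * sqrt (fact n)" "\<not> ?p \<omega> \<le> sqrt (fact n) / real n ^ 3"
        by auto
      have lnp: "ln (sqrt (fact n)) = 1 / 2 * ln (fact n)" by (simp add: ln_sqrt)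
      have pos: "sqrt (fact n) / real n ^ 3 > 0" using n by simp
      hence p: "?p \<omega> > 0" using * by linarith
      have "ln (sqrt (fact n) / real n ^ 3) < ln (?p \<omega>)"
        using * pos p by (subst ln_less_cancel_iff) auto
      moreover have "ln (?p \<omega>) < ln (real n * sqrt (fact n))"
        using * n p by (subst ln_less_cancel_iff) auto
      moreover have "ln (sqrt (fact n) / real n ^ 3) = 1 / 2 * ln (fact n) - 3 * ln (real n)"
        using n by (simp add: ln_div ln_realpow lnp del: ln_sqrt)
      moreover have "ln (real n * sqrt (fact n)) = 1 / 2 * ln (fact n) + ln (real n)"
        using n by (simp add: ln_mult lnp)
      moreover have "ln (real n) > 0" using n by simp
      ultimately show False using a[OF n(1)] *(1) by linarith
    qed
    hence "prob {\<omega> \<in> space (M n). \<bar>ln (?p \<omega>) - a n\<bar> > 5 * ln (real n)} \<le> prob (?S \<union> ?L)"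
      by (intro finite_measure_mono) auto
    also have "\<dots> \<le> prob ?S + prob ?L"
      by (intro measure_Un_le) auto
    also have "\<dots> \<le> exp (1 / 2) * (exp 1 * real DIM('k) + (real DIM('k))\<^sup>2) / real n + 1 / (real n)\<^sup>2"
      using n by (intro add_mono permanent_small_prob permanent_large_prob G) auto
    also have "1 / (real n)\<^sup>2 \<le> 1 / real n"
      using n by (simp add: power2_eq_square field_simps)
    also have "exp (1 / 2) * (exp 1 * real DIM('k) + (real DIM('k))\<^sup>2) / real n + 1 / real n = B / real n"
      by (simp add: B_def add_divide_distrib)
    also have "\<dots> \<le> \<eta>"
      using n \<open>\<eta> > 0\<close> by (simp add: field_simps)
    finally show ?thesis by simp
  qed
  thus "\<exists>C n0. \<forall>n\<ge>n0. measure (M n) {\<omega> \<in> space (M n). \<bar>ln (norm (permanent n (G n \<omega>))) - a n\<bar> > C * ln (real n)} \<le> \<eta>"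
    by blast
qed

text \<open>A crude Stirling bound by induction; an error of order ln n is all that passing from
  half of ln(n!) to the explicit centring can afford.\<close>

lemma ln_fact_bounds:
  assumes "n \<ge> 1"
  shows "real n * ln (real n) - real n \<le> ln (fact n)"
    and "ln (fact n) \<le> real n * ln (real n) - real n + ln (real n) + 1"
proof -
  have "real n * ln (real n) - real n \<le> ln (fact n) \<and>
    ln (fact n) \<le> real n * ln (real n) - real n + ln (real n) + 1"
    using assms
  proof (induction n rule: dec_induct)
    case (step n)
    have n: "real n > 0" using step by simp
    \<comment> \<open>In the induction step the lower bound reduces to n d \<le> 1 and the upper one
      to (n+1) d \<ge> 1, both consequences of ln(1+x) \<le> x for suitable x.\<close>
    define d where "d = ln (real n + 1) - ln (real n)"
    have d: "d = ln (1 + 1 / real n)"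
    proof -
      have "d = ln ((real n + 1) / real n)" unfolding d_def using n by (simp add: ln_div)
      also have "(real n + 1) / real n = 1 + 1 / real n" using n by (simp add: add_divide_distrib)
      finally show ?thesis .
    qed
    have "d \<le> 1 / real n" unfolding d using n by (intro ln_add_one_self_le_self) auto
    hence 1: "real n * d \<le> 1" using n by (simp add: field_simps)
    have "- d = ln (1 - 1 / (real n + 1))"
    proof -
      have "- d = ln (real n / (real n + 1))" unfolding d_def using n by (simp add: ln_div)
      also have "real n / (real n + 1) = 1 - 1 / (real n + 1)" using n by (simp add: field_simps)
      finally show ?thesis .
    qed
    also have "\<dots> \<le> - (1 / (real n + 1))"
      using n by (intro ln_le_minus_one[THEN order.trans]) (auto simp: field_simps)
    finally have 2: "(real n + 1) * d \<ge> 1" using n by (simp add: field_simps)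
    have "ln (fact (Suc n)) = ln (real n + 1) + ln (fact n)"
      by (simp add: ln_mult add.commute)
    moreover have "ln (real n + 1) = ln (real n) + d" by (simp add: d_def)
    ultimately show ?case using step.IH 1 2 by (simp add: algebra_simps)
  qed simp
  thus "real n * ln (real n) - real n \<le> ln (fact n)"
    "ln (fact n) \<le> real n * ln (real n) - real n + ln (real n) + 1" by auto
qed

lemma permanent_bigO_prob_both:
  fixes G :: "nat \<Rightarrow> 'a \<Rightarrow> nat \<Rightarrow> nat \<Rightarrow> 'k::{real_normed_div_algebra, euclidean_space}"
  assumes "\<forall>n. gaussian_matrix (M n) n (G n)"
  shows "bigO_prob M (\<lambda>n \<omega>. ln (norm (permanent n (G n \<omega>))) - 1/2 * ln (fact n)) (\<lambda>n. ln (real n)) \<and>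
    bigO_prob M (\<lambda>n \<omega>. ln (norm (permanent n (G n \<omega>))) - (real n / 2 * ln (real n) - real n / 2))
      (\<lambda>n. ln (real n))"
proof (intro conjI permanent_bigO_prob)
  fix n :: nat assume n: "n \<ge> 2"
  \<comment> \<open>The two centrings differ by at most (ln n + 1)/2, which is below 2 ln n as soon
    as ln n \<ge> 1/3; hence a numerical lower bound for ln 2.\<close>
  have "ln 2 \<le> ln (real n)" using n by simp
  hence "ln (real n) \<ge> 2 / 3" using ln2_ge_two_thirds by linarith
  thus "\<bar>1 / 2 * ln (fact n) - (real n / 2 * ln (real n) - real n / 2)\<bar> \<le> 2 * ln (real n)"
    using ln_fact_bounds[of n] n by linarith
qed (use assms in auto)

theorem corollary1p2:
  fixes M :: "nat \<Rightarrow> 'a measure"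
    and GR :: "nat \<Rightarrow> 'a \<Rightarrow> nat \<Rightarrow> nat \<Rightarrow> real"
    and GC :: "nat \<Rightarrow> 'a \<Rightarrow> nat \<Rightarrow> nat \<Rightarrow> complex"
    and GH :: "nat \<Rightarrow> 'a \<Rightarrow> nat \<Rightarrow> nat \<Rightarrow> quat"
  shows
    "((\<forall>n. gaussian_matrix (M n) n (GR n)) \<longrightarrow>
        bigO_prob M (\<lambda>n \<omega>. ln (norm (permanent n (GR n \<omega>))) - 1/2 * ln (fact n)) (\<lambda>n. ln (real n)) \<and>
        bigO_prob M (\<lambda>n \<omega>. ln (norm (permanent n (GR n \<omega>))) - (real n / 2 * ln (real n) - real n / 2))
          (\<lambda>n. ln (real n))) \<and>
     ((\<forall>n. gaussian_matrix (M n) n (GC n)) \<longrightarrow>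
        bigO_prob M (\<lambda>n \<omega>. ln (norm (permanent n (GC n \<omega>))) - 1/2 * ln (fact n)) (\<lambda>n. ln (real n)) \<and>
        bigO_prob M (\<lambda>n \<omega>. ln (norm (permanent n (GC n \<omega>))) - (real n / 2 * ln (real n) - real n / 2))
          (\<lambda>n. ln (real n))) \<and>
     ((\<forall>n. gaussian_matrix (M n) n (GH n)) \<longrightarrow>
        bigO_prob M (\<lambda>n \<omega>. ln (norm (permanent n (GH n \<omega>))) - 1/2 * ln (fact n)) (\<lambda>n. ln (real n)) \<and>
        bigO_prob M (\<lambda>n \<omega>. ln (norm (permanent n (GH n \<omega>))) - (real n / 2 * ln (real n) - real n / 2))
          (\<lambda>n. ln (real n)))"
  using permanent_bigO_prob_both[of M GR] permanent_bigO_prob_both[of M GC]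
    permanent_bigO_prob_both[of M GH]
  by blast

end
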